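(* For every $\varepsilon\in(0,1)$ there exists a set $\mathcal{D}_\varepsilon\subseteq \mathcal{S}^1$ of lower box dimension $\varepsilon$ that is universal for the class $\mathcal{C}_{WR}$ of weakly regular subsets of $\mathbb{R}^2$.
   Context: $\mathcal{S}^1$ is the unit circle in $\mathbb{R}^2$. For $e\in\mathcal{S}^1$ and $x\in\mathbb{R}^2$, $p_ex=e\cdot x$ and $p_eE=\{p_ex:x\in E\}$. A set $\mathcal{D}\subseteq\mathcal{S}^1$ is universal for a class $\mathcal{C}$ of subsets of $\mathbb{R}^2$ if for every $E\in\mathcal{C}$ there is some $e\in\mathcal{D}$ such that $\dim_H(p_eE)=\min\{\dim_H(E),1\}$. A set $E\subseteq\mathbb{R}^2$ (with no measurability assumption) is weakly regular if $\dim_H(E)=\dim_P(E)$, where $\dim_H$ and $\dim_P$ are Hausdorff and packing dimension. *)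

theory Defs
  imports "HOL-Analysis.Analysis"
begin

(* diameter is a junk value on unbounded sets, hence the explicit boundedness conditions below. *)

definition hausdorff_delta :: "real \<Rightarrow> real \<Rightarrow> 'a::euclidean_space set \<Rightarrow> ennreal" where
  "hausdorff_delta s \<delta> A =
     (INF U\<in>{U :: nat \<Rightarrow> 'a set. A \<subseteq> (\<Union>i. U i) \<and> (\<forall>i. bounded (U i) \<and> diameter (U i) \<le> \<delta>)}.
        \<Sum>i. ennreal (diameter (U i) powr s))"

definition hausdorff_measure :: "real \<Rightarrow> 'a::euclidean_space set \<Rightarrow> ennreal" where
  "hausdorff_measure s A = (SUP \<delta>\<in>{0<..}. hausdorff_delta s \<delta> A)"

(* Only s > 0 is used: since 0 powr 0 = 0, hausdorff_measure 0 is not the counting measure.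
   Omitting s = 0 does not change the infimum, as only the empty set has zero-dimensional
   measure 0. In particular the empty set has dimension 0. *)
definition hausdorff_dim :: "'a::euclidean_space set \<Rightarrow> ereal" where
  "hausdorff_dim A = (INF s\<in>{s. 0 < s \<and> hausdorff_measure s A = 0}. ereal s)"

(* A packing is recorded as a set of centre-radius pairs; a ball of radius r contributes
   (2 * r) powr s, its diameter to the power s. *)
definition ball_packings :: "real \<Rightarrow> 'a::euclidean_space set \<Rightarrow> ('a \<times> real) set set" where
  "ball_packings \<delta> A =
     {P. countable P \<and> P \<subseteq> A \<times> {0<..\<delta>} \<and>
         pairwise (\<lambda>(x, r) (y, t). cball x r \<inter> cball y t = {}) P}"

definition packing_delta :: "real \<Rightarrow> real \<Rightarrow> 'a::euclidean_space set \<Rightarrow> ennreal" where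
  "packing_delta s \<delta> A =
     (SUP P\<in>ball_packings \<delta> A. \<Sum>\<^sub>\<infinity>(x, r)\<in>P. ennreal ((2 * r) powr s))"

definition packing_premeasure :: "real \<Rightarrow> 'a::euclidean_space set \<Rightarrow> ennreal" where
  "packing_premeasure s A = (INF \<delta>\<in>{0<..}. packing_delta s \<delta> A)"

definition packing_measure :: "real \<Rightarrow> 'a::euclidean_space set \<Rightarrow> ennreal" where
  "packing_measure s A =
     (INF B\<in>{B :: nat \<Rightarrow> 'a set. A \<subseteq> (\<Union>i. B i)}. \<Sum>i. packing_premeasure s (B i))"

definition packing_dim :: "'a::euclidean_space set \<Rightarrow> ereal" where
  "packing_dim A = (INF s\<in>{s. 0 < s \<and> packing_measure s A = 0}. ereal s)"

(* Meaningful for bounded A and \<delta> > 0, where a finite cover exists. *)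
definition covering_number :: "real \<Rightarrow> 'a::euclidean_space set \<Rightarrow> nat" where
  "covering_number \<delta> A =
     (LEAST n. \<exists>F. finite F \<and> card F = n \<and> A \<subseteq> \<Union>F \<and> (\<forall>U\<in>F. bounded U \<and> diameter U \<le> \<delta>))"

(* Used for nonempty bounded sets only. *)
definition lower_box_dim :: "'a::euclidean_space set \<Rightarrow> ereal" where
  "lower_box_dim A =
     Liminf (at_right 0) (\<lambda>\<delta>. ereal (ln (real (covering_number \<delta> A)) / (- ln \<delta>)))"

definition weakly_regular :: "(real^2) set \<Rightarrow> bool" where
  "weakly_regular E \<longleftrightarrow> hausdorff_dim E = packing_dim E"

definition dir_proj :: "real^2 \<Rightarrow> real^2 \<Rightarrow> real" where
  "dir_proj e x = e \<bullet> x"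

definition universal_for :: "(real^2) set \<Rightarrow> (real^2) set set \<Rightarrow> bool" where
  "universal_for D \<C> \<longleftrightarrow>
     D \<subseteq> sphere 0 1 \<and> (\<forall>E\<in>\<C>. \<exists>e\<in>D. hausdorff_dim (dir_proj e ` E) = min (hausdorff_dim E) 1)"

end

theory Submission
  imports Defs
begin

text \<open>Directions are parametrised by slopes \<theta> in [0, 1], that is, by the maps x \<mapsto> \<theta> x1 + x2. The
admissible slopes have free binary digits in very long blocks, separated by blocks of zeros whose
lengths are tuned so that the lower box dimension is \<epsilon>.

A set with packing dimension s splits into pieces F which meet at most about 2^(tn) dyadic squares
of side 2^(-n), with t slightly larger than s. Discard from F, at a cost that is small in the Hausdorff
content of an exponent s' slightly below s, all dyadic squares that are overcrowded. For the remaining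
squares, the siblings inside a square q levels up have on average few members in the strip around a
given square when \<theta> varies in an arithmetic progression of step at most 2^(-q) and of length at
least 2^(-gq) for a small constant g. Since relative position over q levels only requires \<theta> up to
precision 2^(-q), the strips over N q levels are controlled by N applications of this
estimate, and every scale is comparable to N q with N bounded and q a precision at which \<theta> is
still free. So a null cover of the projection lifts to a null cover of F, which contradicts
dim E = s. The bad choices at each block of digits form a proportion less than 1, summed over all
pieces and scales, so a slope can be selected block by block; neither measurability nor a Frostman measure
is needed.\<close>

section \<open>Hausdorff content\<close>

text \<open>The obstacle is that the lower box dimension is below 1: at precision 2^(-gap) only
  about 2^depth directions remain, so inside a vanishing block no averaging over directions reaches
  level n. Splitting n into N steps of precision q avoids this, and N stays bounded because a
  vanishing block ends near depth / \<epsilon>. The parameters are chosen in this order: the loss g,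
  a bound M for N, then \<eta> = g / (4 M). Up to a constant there are at most 2^((s + \<eta>) n)
  squares at level n, while content is taken with exponent s - \<eta>. At n = N q the mismatch costs
  2 \<eta> N q in the exponent, which must be at most half of the gain g q from one averaging. So
  packing dimension is used to bound the counts at every fine level, and Hausdorff dimension to
  exclude that E is null for s - \<eta>. Averaging leaves at most 2^((max (s - 1) 0 + 4 g) q)
  squares of a strip per step; against the factor 2^(-s q) this is 2^(-(min s 1 - 4 g) q), the
  exponent with which covers of the projection are compared.\<close>

definition hausdorff_content :: "real \<Rightarrow> 'a::euclidean_space set \<Rightarrow> ennreal" where
  "hausdorff_content s A =
     (INF U\<in>{U :: nat \<Rightarrow> 'a set. A \<subseteq> (\<Union>i. U i) \<and> (\<forall>i. bounded (U i))}.
        \<Sum>i. ennreal (diameter (U i) powr s))"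

lemma hausdorff_content_less_cover:
  assumes "hausdorff_content s A < x"
  obtains U where "A \<subseteq> (\<Union>i. U i)" "\<And>i. bounded (U i)"
    "(\<Sum>i. ennreal (diameter (U i) powr s)) < x"
  using assms unfolding hausdorff_content_def INF_less_iff by blast

lemma hausdorff_content_le_cover:
  assumes "A \<subseteq> (\<Union>i. U i)" "\<And>i::nat. bounded (U i)"
  shows "hausdorff_content s A \<le> (\<Sum>i. ennreal (diameter (U i) powr s))"
  unfolding hausdorff_content_def using assms by (auto intro!: INF_lower)

lemma hausdorff_content_mono:
  "A \<subseteq> B \<Longrightarrow> hausdorff_content s A \<le> hausdorff_content s B"
  unfolding hausdorff_content_def by (rule INF_superset_mono) auto

lemma hausdorff_content_le_diameter:
  assumes "bounded A"
  shows "hausdorff_content s A \<le> ennreal (diameter A powr s)"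
proof -
  let ?U = "\<lambda>i::nat. if i = 0 then A else {}"
  have "hausdorff_content s A \<le> (\<Sum>i. ennreal (diameter (?U i) powr s))"
    by (rule hausdorff_content_le_cover) (use assms in auto)
  also have "\<dots> = (\<Sum>i\<in>{0}. ennreal (diameter (?U i) powr s))"
    by (rule suminf_finite) auto
  finally show ?thesis by simp
qed

lemma hausdorff_content_empty [simp]: "hausdorff_content s {} = 0"
  using hausdorff_content_le_diameter[of "{}" s] by simp

lemma ennreal_suminf_geometric_half:
  "0 \<le> e \<Longrightarrow> (\<Sum>i. ennreal (e * (1/2) ^ Suc i)) = ennreal e"
  using sums_mult[OF power_half_series, of e]
  by (intro suminf_ennreal_eq) auto

lemma hausdorff_content_UN_le:
  fixes A :: "nat \<Rightarrow> 'a::euclidean_space set"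
  shows "hausdorff_content s (\<Union>i. A i) \<le> (\<Sum>i. hausdorff_content s (A i))"
proof (rule ennreal_le_epsilon)
  fix e :: real
  assume top: "(\<Sum>i. hausdorff_content s (A i)) < top" and e: "0 < e"
  have "\<exists>U. A i \<subseteq> (\<Union>j. U j) \<and> (\<forall>j::nat. bounded (U j)) \<and>
      (\<Sum>j. ennreal (diameter (U j) powr s)) < hausdorff_content s (A i) + ennreal (e * (1/2) ^ Suc i)" for i
  proof -
    have "hausdorff_content s (A i) < top"
      using top by (rule ennreal_suminf_lessD)
    moreover have "0 < ennreal (e * (1/2) ^ Suc i)" using e by simp
    ultimately have "hausdorff_content s (A i) < hausdorff_content s (A i) + ennreal (e * (1/2) ^ Suc i)"
      using ennreal_add_left_cancel_less[of "hausdorff_content s (A i)" 0] by (simp add: top.not_eq_extremum del: power_Suc)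
    then show ?thesis by (rule hausdorff_content_less_cover) blast
  qed
  then obtain U where U: "\<And>i. A i \<subseteq> (\<Union>j. U i j)" "\<And>i j. bounded (U i (j::nat))"
    "\<And>i. (\<Sum>j. ennreal (diameter (U i j) powr s)) < hausdorff_content s (A i) + ennreal (e * (1/2) ^ Suc i)"
    by metis
  define V where "V = (\<lambda>n. case prod_decode n of (i, j) \<Rightarrow> U i j)"
  have "hausdorff_content s (\<Union>i. A i) \<le> (\<Sum>n. ennreal (diameter (V n) powr s))"
  proof (rule hausdorff_content_le_cover)
    show "(\<Union>i. A i) \<subseteq> (\<Union>n. V n)"
    proof
      fix x assume "x \<in> (\<Union>i. A i)"
      then obtain i j where "x \<in> U i j" using U(1) by blast
      then have "x \<in> V (prod_encode (i, j))" by (simp add: V_def)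
      then show "x \<in> (\<Union>n. V n)" by blast
    qed
    show "bounded (V n)" for n using U(2) by (simp add: V_def split: prod.split)
  qed
  also have "\<dots> = (\<Sum>i. \<Sum>j. ennreal (diameter (U i j) powr s))"
  proof -
    have "(\<Sum>n. ennreal (diameter (V n) powr s)) =
        (\<Sum>n. (\<lambda>(i, j). ennreal (diameter (U i j) powr s)) (prod_decode n))"
      by (intro suminf_cong) (simp add: V_def split: prod.split)
    also have "\<dots> = (\<Sum>i. \<Sum>j. ennreal (diameter (U i j) powr s))"
      by (rule suminf_ennreal_2dimen) simp
    finally show ?thesis .
  qed
  also have "\<dots> \<le> (\<Sum>i. hausdorff_content s (A i) + ennreal (e * (1/2) ^ Suc i))"
    using U(3) by (intro suminf_le) (auto intro: less_imp_le)
  also have "\<dots> = (\<Sum>i. hausdorff_content s (A i)) + (\<Sum>i. ennreal (e * (1/2) ^ Suc i))"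
    by (intro suminf_add[symmetric]) auto
  also have "(\<Sum>i. ennreal (e * (1/2) ^ Suc i)) = ennreal e"
    using e by (intro ennreal_suminf_geometric_half) simp
  finally show "hausdorff_content s (\<Union>i. A i) \<le> (\<Sum>i. hausdorff_content s (A i)) + ennreal e" .
qed

lemma hausdorff_content_Un_le:
  "hausdorff_content s (A \<union> B) \<le> hausdorff_content s A + hausdorff_content s B"
proof -
  let ?A = "\<lambda>i::nat. if i = 0 then A else if i = 1 then B else {}"
  have "A \<union> B \<subseteq> (\<Union>i. ?A i)" 
  proof -
    have "?A 0 \<union> ?A 1 \<subseteq> (\<Union>i. ?A i)" by blast
    then show ?thesis by simp
  qed
  then have "hausdorff_content s (A \<union> B) \<le> hausdorff_content s (\<Union>i. ?A i)"
    by (rule hausdorff_content_mono)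
  also have "\<dots> \<le> (\<Sum>i. hausdorff_content s (?A i))" by (rule hausdorff_content_UN_le)
  also have "\<dots> = (\<Sum>i\<in>{0,1}. hausdorff_content s (?A i))"
    by (rule suminf_finite) auto
  finally show ?thesis by simp
qed

lemma hausdorff_content_finite_UN_le:
  assumes "finite I"
  shows "hausdorff_content s (\<Union>i\<in>I. A i) \<le> (\<Sum>i\<in>I. hausdorff_content s (A i))"
  using assms
proof (induction I)
  case (insert x F)
  have "hausdorff_content s (\<Union>i\<in>insert x F. A i) \<le> hausdorff_content s (A x) + hausdorff_content s (\<Union>i\<in>F. A i)"
    using hausdorff_content_Un_le by auto
  also have "\<dots> \<le> hausdorff_content s (A x) + (\<Sum>i\<in>F. hausdorff_content s (A i))"
    by (intro add_left_mono insert.IH)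
  finally show ?case using insert by simp
qed simp

lemma hausdorff_measure_eq_0_iff:
  assumes "0 < s"
  shows "hausdorff_measure s A = 0 \<longleftrightarrow> hausdorff_content s A = 0"
proof
  assume *: "hausdorff_measure s A = 0"
  have "hausdorff_content s A \<le> hausdorff_delta s 1 A"
    unfolding hausdorff_content_def hausdorff_delta_def by (rule INF_superset_mono) auto
  also have "\<dots> \<le> hausdorff_measure s A"
    unfolding hausdorff_measure_def by (rule SUP_upper) simp
  finally show "hausdorff_content s A = 0" using * by simp
next
  assume *: "hausdorff_content s A = 0"
  have "hausdorff_delta s \<delta> A \<le> 0 + ennreal e" if "0 < \<delta>" "0 < e" for \<delta> e :: real
  proof -
    define m where "m = min e (\<delta> powr s)"
    have m: "0 < m" using that by (simp add: m_def)
    obtain U where U: "A \<subseteq> (\<Union>i. U i)" "\<And>i. bounded (U i)"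
      "(\<Sum>i. ennreal (diameter (U i) powr s)) < ennreal m"
      by (rule hausdorff_content_less_cover[of s A "ennreal m"]) (use * m in auto)
    have "diameter (U i) \<le> \<delta>" for i
    proof -
      have "ennreal (diameter (U i) powr s) < ennreal m"
        using U(3) by (rule ennreal_suminf_lessD)
      then have "diameter (U i) powr s \<le> \<delta> powr s" using m by (simp add: m_def ennreal_less_iff)
      then show ?thesis
        using assms that diameter_ge_0[OF U(2), of i] powr_less_mono2[of s \<delta> "diameter (U i)"] by linarith
    qed
    then have "hausdorff_delta s \<delta> A \<le> (\<Sum>i. ennreal (diameter (U i) powr s))"
      unfolding hausdorff_delta_def using U by (intro INF_lower) auto
    also have "\<dots> \<le> ennreal m" using U(3) by simp
    also have "\<dots> \<le> ennreal e" by (simp add: m_def ennreal_leI)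
    finally show ?thesis by simp
  qed
  then have "hausdorff_delta s \<delta> A \<le> 0" if "0 < \<delta>" for \<delta>
    using that by (blast intro: ennreal_le_epsilon)
  then have "hausdorff_measure s A \<le> 0" unfolding hausdorff_measure_def by (intro SUP_least) simp
  then show "hausdorff_measure s A = 0" by simp
qed

lemma hausdorff_content_eq_0I:
  assumes "\<And>e::real. 0 < e \<Longrightarrow> hausdorff_content s A \<le> ennreal e"
  shows "hausdorff_content s A = 0"
  using ennreal_le_epsilon[of 0 "hausdorff_content s A"] assms by simp

lemma hausdorff_content_UN_eq_0:
  fixes A :: "nat \<Rightarrow> 'a::euclidean_space set"
  assumes "\<And>i. hausdorff_content s (A i) = 0"
  shows "hausdorff_content s (\<Union>i. A i) = 0"
  using hausdorff_content_UN_le[of s A] assms by simp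

text \<open>A cover with sum below 1 consists of sets of diameter at most 1, and for these a larger
  exponent only lowers the terms.\<close>

lemma hausdorff_content_eq_0_mono:
  assumes "hausdorff_content s A = 0" "0 < s" "s \<le> t"
  shows "hausdorff_content t A = 0"
proof (rule hausdorff_content_eq_0I)
  fix e :: real assume e: "0 < e"
  define m where "m = min e 1"
  have m: "0 < m" "m \<le> 1" "m \<le> e" using e by (auto simp: m_def)
  obtain U where U: "A \<subseteq> (\<Union>i. U i)" "\<And>i. bounded (U i)"
    "(\<Sum>i. ennreal (diameter (U i) powr s)) < ennreal m"
    by (rule hausdorff_content_less_cover[of s A "ennreal m"]) (use assms m in auto)
  have le: "diameter (U i) powr t \<le> diameter (U i) powr s" for i
  proof -
    have "ennreal (diameter (U i) powr s) < ennreal m"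
      using U(3) by (rule ennreal_suminf_lessD)
    then have "diameter (U i) powr s < 1 powr s" using m by (simp add: ennreal_less_iff)
    then have "diameter (U i) \<le> 1"
      using assms powr_less_mono2[of s 1 "diameter (U i)"] by fastforce
    then show ?thesis
      using powr_mono'[of s t "diameter (U i)"] diameter_ge_0[OF U(2)] assms(3) by simp
  qed
  have "hausdorff_content t A \<le> (\<Sum>i. ennreal (diameter (U i) powr t))"
    by (rule hausdorff_content_le_cover[OF U(1,2)])
  also have "\<dots> \<le> (\<Sum>i. ennreal (diameter (U i) powr s))"
    by (intro suminf_le) (auto intro!: ennreal_leI le)
  also have "\<dots> \<le> ennreal e" using U(3) m by (auto intro: order.trans[OF less_imp_le] ennreal_leI)
  finally show "hausdorff_content t A \<le> ennreal e" .
qed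

section \<open>Dimension in terms of null content\<close>

lemma hausdorff_dim_le:
  assumes "0 < s" "hausdorff_content s A = 0"
  shows "hausdorff_dim A \<le> ereal s"
  unfolding hausdorff_dim_def using assms
  by (intro INF_lower) (simp add: hausdorff_measure_eq_0_iff)

lemma hausdorff_content_eq_0_if_dim_less:
  assumes "hausdorff_dim A < ereal t"
  shows "hausdorff_content t A = 0" "0 < t"
proof -
  obtain s where "0 < s" "hausdorff_measure s A = 0" "s < t"
    using assms unfolding hausdorff_dim_def INF_less_iff by auto
  then show "hausdorff_content t A = 0" "0 < t"
    using hausdorff_content_eq_0_mono[of s A t] by (auto simp: hausdorff_measure_eq_0_iff)
qed

lemma hausdorff_dim_nonneg: "0 \<le> hausdorff_dim A"
  unfolding hausdorff_dim_def by (rule INF_greatest) auto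

lemma hausdorff_dim_le_if_content_imp:
  assumes "\<And>s. 0 < s \<Longrightarrow> hausdorff_content s A = 0 \<Longrightarrow> hausdorff_content s B = 0"
  shows "hausdorff_dim B \<le> hausdorff_dim A"
  unfolding hausdorff_dim_def
  by (rule INF_superset_mono) (use assms in \<open>auto simp: hausdorff_measure_eq_0_iff\<close>)

lemma hausdorff_content_Lipschitz_image_eq_0:
  fixes f :: "'a::euclidean_space \<Rightarrow> 'b::euclidean_space"
  assumes "hausdorff_content s A = 0" "0 < s"
    and lip: "\<And>x y. x \<in> A \<Longrightarrow> y \<in> A \<Longrightarrow> dist (f x) (f y) \<le> L * dist x y"
  shows "hausdorff_content s (f ` A) = 0"
proof (rule hausdorff_content_eq_0I)
  fix e :: real assume e: "0 < e"
  \<comment> \<open>The constant must be positive, because the cover of \<open>A\<close> is chosen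
    with sum below \<open>e / K powr s\<close>.\<close>
  define K where "K = max L 1"
  have K: "0 < K" "L \<le> K" by (auto simp: K_def)
  have m: "0 < e / K powr s" using e K by simp
  obtain U where U: "A \<subseteq> (\<Union>i. U i)" "\<And>i. bounded (U i)"
    "(\<Sum>i. ennreal (diameter (U i) powr s)) < ennreal (e / K powr s)"
    by (rule hausdorff_content_less_cover[of s A "ennreal (e / K powr s)"]) (use assms m in auto)
  have d: "dist (f x) (f y) \<le> K * diameter (U i)" if "x \<in> U i \<inter> A" "y \<in> U i \<inter> A" for x y i
  proof -
    have "dist (f x) (f y) \<le> L * dist x y" using lip that by auto
    also have "\<dots> \<le> K * dist x y" using K by (intro mult_right_mono) auto
    also have "\<dots> \<le> K * diameter (U i)"
      using K that by (intro mult_left_mono diameter_bounded_bound U) auto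
    finally show ?thesis .
  qed
  have bd: "bounded (f ` (U i \<inter> A))" for i
  proof (cases "U i \<inter> A = {}")
    case False
    then obtain z where "z \<in> U i \<inter> A" by blast
    then show ?thesis using d[of z i] unfolding bounded_def by (intro exI[of _ "f z"] exI) auto
  qed simp
  have diam: "diameter (f ` (U i \<inter> A)) \<le> K * diameter (U i)" for i
    using d[of _ i] K diameter_ge_0[OF U(2)[of i]] by (intro diameter_le) (auto simp: dist_norm)
  have "hausdorff_content s (f ` A) \<le> (\<Sum>i. ennreal (diameter (f ` (U i \<inter> A)) powr s))"
  proof (rule hausdorff_content_le_cover)
    show "f ` A \<subseteq> (\<Union>i. f ` (U i \<inter> A))"
    proof
      fix y assume "y \<in> f ` A"
      then obtain x where x: "x \<in> A" "y = f x" by (rule imageE)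
      with U(1) obtain i where "x \<in> U i" by (meson UN_E subsetD)
      with x have "y \<in> f ` (U i \<inter> A)" by simp
      then show "y \<in> (\<Union>i. f ` (U i \<inter> A))" by (rule UN_I[OF UNIV_I])
    qed
  qed (rule bd)
  also have "\<dots> \<le> (\<Sum>i. ennreal (K powr s) * ennreal (diameter (U i) powr s))"
  proof (intro suminf_le)
    fix i
    have "diameter (f ` (U i \<inter> A)) powr s \<le> (K * diameter (U i)) powr s"
      using assms by (intro powr_mono2 diam diameter_ge_0 bd) simp
    then show "ennreal (diameter (f ` (U i \<inter> A)) powr s) \<le> ennreal (K powr s) * ennreal (diameter (U i) powr s)"
      using K diameter_ge_0[OF U(2)[of i]] by (simp add: powr_mult ennreal_mult[symmetric] ennreal_leI)
  qed auto
  also have "\<dots> = ennreal (K powr s) * (\<Sum>i. ennreal (diameter (U i) powr s))" by simp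
  also have "\<dots> \<le> ennreal (K powr s) * ennreal (e / K powr s)"
    using U(3) by (intro mult_left_mono) auto
  also have "\<dots> = ennreal e" using K e by (simp add: ennreal_mult[symmetric])
  finally show "hausdorff_content s (f ` A) \<le> ennreal e" .
qed

section \<open>Dyadic squares and packing dimension\<close>

text \<open>A grid of n^d cubes gives a sum of at most n^d (d / n)^s = d^s n^(d - s), which tends to
  0 for s > d. The diameter bound d / n comes from the l1 norm.\<close>

lemma hausdorff_content_unit_cube:
  assumes s: "real DIM('a::euclidean_space) < s"
  shows "hausdorff_content s (cbox 0 (One::'a)) = 0"
proof (rule hausdorff_content_eq_0I)
  fix e :: real assume e: "0 < e"
  let ?d = "real DIM('a)"
  have "((\<lambda>n. ?d powr s * (real n powr (?d - s))) \<longlongrightarrow> ?d powr s * 0) sequentially"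
    using s by (intro tendsto_mult tendsto_const tendsto_neg_powr filterlim_real_sequentially) auto
  then have "eventually (\<lambda>n. ?d powr s * (real n powr (?d - s)) < e) sequentially"
    using e by (intro order_tendstoD) auto
  from eventually_happens[OF eventually_conj[OF this eventually_gt_at_top[of 0]]]
  obtain n where n: "0 < n" "?d powr s * (real n powr (?d - s)) < e"
    by auto
  define I where "I = (Basis :: 'a set) \<rightarrow>\<^sub>E {..<n}"
  define Q :: "('a \<Rightarrow> nat) \<Rightarrow> 'a set" where
    "Q f = {x. \<forall>b\<in>Basis. real (f b) / n \<le> x \<bullet> b \<and> x \<bullet> b \<le> real (f b + 1) / n}" for f
  have "finite I" by (auto simp: I_def intro: finite_PiE)
  have card: "card I = n ^ DIM('a)" by (simp add: I_def card_PiE)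
  have Q: "dist x y \<le> ?d / n" if "x \<in> Q f" "y \<in> Q f" for x y f
  proof -
    have "\<bar>(x - y) \<bullet> b\<bar> \<le> 1 / n" if "b \<in> Basis" for b
      using \<open>x \<in> Q f\<close> \<open>y \<in> Q f\<close> that by (force simp: Q_def inner_diff_left add_divide_distrib abs_le_iff)
    then have "(\<Sum>b\<in>Basis. \<bar>(x - y) \<bullet> b\<bar>) \<le> (\<Sum>b\<in>(Basis::'a set). 1 / real n)" by (intro sum_mono)
    then show ?thesis using norm_le_l1[of "x - y"] by (simp add: dist_norm)
  qed
  have bd: "bounded (Q f)" for f
  proof (cases "Q f = {}")
    case False
    then obtain z where "z \<in> Q f" by blast
    then show ?thesis using Q[of z f] unfolding bounded_def by blast
  qed simp
  have "cbox 0 (One::'a) \<subseteq> (\<Union>f\<in>I. Q f)"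
  proof
    fix x :: 'a assume "x \<in> cbox 0 One"
    then have x: "0 \<le> x \<bullet> b" "x \<bullet> b \<le> 1" if "b \<in> Basis" for b using that by (auto simp: mem_box)
    have "\<exists>k<n. real k / n \<le> x \<bullet> b \<and> x \<bullet> b \<le> real (k + 1) / n" if "b \<in> Basis" for b
    proof (cases "x \<bullet> b = 1")
      case True
      then show ?thesis using n by (intro exI[of _ "n - 1"]) (auto simp: field_simps of_nat_diff)
    next
      case False
      then have "x \<bullet> b < 1" using x[OF that] by simp
      then have "real n * (x \<bullet> b) < real n" using n by simp
      then have "nat \<lfloor>real n * (x \<bullet> b)\<rfloor> < n" using x[OF that] n by (simp add: nat_less_iff floor_less_iff)
      moreover have "real (nat \<lfloor>real n * (x \<bullet> b)\<rfloor>) \<le> real n * (x \<bullet> b)"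
        using x[OF that] n by (simp add: of_nat_floor)
      moreover have "real n * (x \<bullet> b) \<le> real (nat \<lfloor>real n * (x \<bullet> b)\<rfloor> + 1)" by linarith
      ultimately show ?thesis using n by (intro exI[of _ "nat \<lfloor>real n * (x \<bullet> b)\<rfloor>"]) (auto simp: field_simps)
    qed
    then obtain k where "\<And>b. b \<in> Basis \<Longrightarrow> k b < n \<and> real (k b) / n \<le> x \<bullet> b \<and> x \<bullet> b \<le> real (k b + 1) / n"
      by metis
    then have "restrict k Basis \<in> I" "x \<in> Q (restrict k Basis)" by (auto simp: I_def Q_def)
    then show "x \<in> (\<Union>f\<in>I. Q f)" by blast
  qed
  then have "hausdorff_content s (cbox 0 (One::'a)) \<le> hausdorff_content s (\<Union>f\<in>I. Q f)"
    by (rule hausdorff_content_mono)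
  also have "\<dots> \<le> (\<Sum>f\<in>I. hausdorff_content s (Q f))"
    by (rule hausdorff_content_finite_UN_le) fact
  also have "\<dots> \<le> (\<Sum>f\<in>I. ennreal ((?d / n) powr s))"
  proof (rule sum_mono)
    fix f
    have "hausdorff_content s (Q f) \<le> ennreal (diameter (Q f) powr s)"
      by (rule hausdorff_content_le_diameter[OF bd])
    also have "\<dots> \<le> ennreal ((?d / n) powr s)"
      using Q[of _ f] s by (intro ennreal_leI powr_mono2 diameter_ge_0 bd diameter_le) (auto simp: dist_norm)
    finally show "hausdorff_content s (Q f) \<le> ennreal ((?d / n) powr s)" .
  qed
  also have "\<dots> = ennreal (real n ^ DIM('a) * (?d / n) powr s)"
    by (simp add: card ennreal_mult'' ennreal_of_nat_eq_real_of_nat)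
  also have "real n ^ DIM('a) * (?d / n) powr s = ?d powr s * (real n powr (?d - s))"
    using n by (simp add: powr_divide powr_diff powr_realpow)
  also have "ennreal \<dots> \<le> ennreal e" using n by (intro ennreal_leI) simp
  finally show "hausdorff_content s (cbox 0 (One::'a)) \<le> ennreal e" .
qed

lemma hausdorff_content_eq_0_above_dimension:
  fixes A :: "'a::euclidean_space set"
  assumes s: "real DIM('a) < s"
  shows "hausdorff_content s A = 0"
proof -
  \<comment> \<open>\<open>f k\<close> maps the unit cube onto [-k, k]^d, and these cubes exhaust
    the space.\<close>
  define f :: "nat \<Rightarrow> 'a \<Rightarrow> 'a" where "f k x = (2 * real k) *\<^sub>R x - real k *\<^sub>R One" for k x
  have "hausdorff_content s (f k ` cbox 0 One) = 0" for k
  proof (rule hausdorff_content_Lipschitz_image_eq_0[OF hausdorff_content_unit_cube[OF s], of _ "2 * real k"])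
    show "0 < s" using s by (meson of_nat_0_le_iff order.strict_trans1)
    show "dist (f k x) (f k y) \<le> 2 * real k * dist x y" for x y
      by (simp add: f_def dist_norm flip: scaleR_right_diff_distrib)
  qed
  then have "hausdorff_content s (\<Union>k. f k ` cbox 0 One) = 0"
    by (rule hausdorff_content_UN_eq_0)
  moreover have "x \<in> (\<Union>k. f k ` cbox 0 One)" for x :: 'a
  proof -
    obtain k :: nat where k: "norm x < real k" using reals_Archimedean2 by blast
    have k0: "0 < real k" using norm_ge_zero[of x] k by linarith
    define y where "y = (1 / (2 * real k)) *\<^sub>R (x + real k *\<^sub>R One)"
    have "y \<in> cbox 0 One"
      unfolding mem_box
    proof (intro ballI conjI)
      fix b :: 'a assume b: "b \<in> Basis"
      have "\<bar>x \<bullet> b\<bar> \<le> real k" using Basis_le_norm[OF b, of x] k by linarith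
      then show "0 \<bullet> b \<le> y \<bullet> b" "y \<bullet> b \<le> One \<bullet> b"
        using k0 b by (auto simp: y_def inner_add_left field_simps)
    qed
    moreover have "f k y = x" using k0 by (simp add: f_def y_def)
    ultimately show ?thesis by blast
  qed
  moreover from this have "A \<subseteq> (\<Union>k. f k ` cbox 0 One)" by blast
  ultimately show ?thesis
    using hausdorff_content_mono[of A "\<Union>k. f k ` cbox 0 One" s] by simp
qed

text \<open>On the line this gives the bound 1 for projections; in the plane it shows that the
  dimension of a set is a real number.\<close>

lemma hausdorff_dim_le_DIM: "hausdorff_dim (A :: 'a::euclidean_space set) \<le> ereal (real DIM('a))"
proof (rule ereal_le_epsilon2)
  fix e :: real assume "0 < e"
  then have "hausdorff_dim A \<le> ereal (real DIM('a) + e)"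
    by (intro hausdorff_dim_le hausdorff_content_eq_0_above_dimension) auto
  then show "hausdorff_dim A \<le> ereal (real DIM('a)) + ereal e" by simp
qed

section \<open>Dyadic squares as integer vectors\<close>

definition cell :: "nat \<Rightarrow> real^2 \<Rightarrow> int \<times> int" where
  "cell n x = (\<lfloor>2 ^ n * x $ 1\<rfloor>, \<lfloor>2 ^ n * x $ 2\<rfloor>)"

text \<open>The ancestor i levels up in the dyadic tree. Integer \<open>div\<close> rounds down, so
  this is right for negative coordinates as well.\<close>

definition coarse :: "nat \<Rightarrow> int \<times> int \<Rightarrow> int \<times> int" where
  "coarse i Q = (fst Q div 2 ^ i, snd Q div 2 ^ i)"

definition cell_dist :: "int \<times> int \<Rightarrow> int \<times> int \<Rightarrow> int" where
  "cell_dist Q R = max \<bar>fst Q - fst R\<bar> \<bar>snd Q - snd R\<bar>"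

lemma coarse_cell: "i \<le> n \<Longrightarrow> coarse i (cell n x) = cell (n - i) x"
proof -
  assume i: "i \<le> n"
  have "\<lfloor>2 ^ (n - i) * y\<rfloor> = \<lfloor>2 ^ n * y\<rfloor> div 2 ^ i" for y :: real
  proof -
    have "\<lfloor>(2 ^ n * y) / real_of_int (2 ^ i)\<rfloor> = \<lfloor>2 ^ n * y\<rfloor> div 2 ^ i"
      by (rule floor_divide_real_eq_div) simp
    moreover have "(2 ^ n * y) / real_of_int (2 ^ i) = 2 ^ (n - i) * y"
      using i by (simp add: power_diff)
    ultimately show ?thesis by simp
  qed
  then show ?thesis by (simp add: coarse_def cell_def)
qed

lemma norm_vec2_le: "norm (x :: real^2) \<le> \<bar>x $ 1\<bar> + \<bar>x $ 2\<bar>"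
  using norm_le_l1_cart[of x] by (simp add: sum_2)

lemma hausdorff_content_cell:
  assumes "0 < s"
  shows "hausdorff_content s {x. cell n x = Q} \<le> ennreal ((2 / 2 ^ n) powr s)"
proof -
  \<comment> \<open>Each coordinate differs by at most one side length; the 2 is the sum over both
    coordinates.\<close>
  have d: "norm (x - y) \<le> 2 / 2 ^ n" if "cell n x = Q" "cell n y = Q" for x y
  proof -
    have "\<bar>2 ^ n * x $ i - 2 ^ n * y $ i\<bar> \<le> 1" if "i = 1 \<or> i = 2" for i
    proof -
      have "\<lfloor>2 ^ n * x $ i\<rfloor> = \<lfloor>2 ^ n * y $ i\<rfloor>"
        using that \<open>cell n x = Q\<close> \<open>cell n y = Q\<close> by (auto simp: cell_def)
      then show ?thesis by linarith
    qed
    then have "2 ^ n * \<bar>x $ i - y $ i\<bar> \<le> 1" if "i = 1 \<or> i = 2" for i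
      using that by (simp add: abs_mult flip: right_diff_distrib)
    then have "\<bar>x $ i - y $ i\<bar> \<le> 1 / 2 ^ n" if "i = 1 \<or> i = 2" for i
      using that by (simp add: field_simps)
    from this[of 1] this[of 2] show ?thesis using norm_vec2_le[of "x - y"] by simp
  qed
  have bd: "bounded {x. cell n x = Q}"
  proof (cases "{x. cell n x = Q} = {}")
    case False
    then obtain z where "cell n z = Q" by blast
    then show ?thesis using d[of z] unfolding bounded_def by (auto simp: dist_norm)
  qed simp
  have "hausdorff_content s {x. cell n x = Q} \<le> ennreal (diameter {x. cell n x = Q} powr s)"
    by (rule hausdorff_content_le_diameter[OF bd])
  also have "\<dots> \<le> ennreal ((2 / 2 ^ n) powr s)"
    using assms d by (intro ennreal_leI powr_mono2 diameter_ge_0 bd diameter_le) auto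
  finally show ?thesis .
qed

lemma hausdorff_content_cells:
  assumes "0 < s" "finite S" "\<And>x. x \<in> F \<Longrightarrow> cell n x \<in> S"
  shows "hausdorff_content s F \<le> ennreal (real (card S) * (2 / 2 ^ n) powr s)"
proof -
  have "hausdorff_content s F \<le> hausdorff_content s (\<Union>Q\<in>S. {x. cell n x = Q})"
    using assms(3) by (intro hausdorff_content_mono) auto
  also have "\<dots> \<le> (\<Sum>Q\<in>S. hausdorff_content s {x. cell n x = Q})"
    by (rule hausdorff_content_finite_UN_le) fact
  also have "\<dots> \<le> (\<Sum>Q\<in>S. ennreal ((2 / 2 ^ n) powr s))"
    by (intro sum_mono hausdorff_content_cell assms)
  also have "\<dots> = ennreal (real (card S) * (2 / 2 ^ n) powr s)"
    by (simp add: ennreal_mult'' ennreal_of_nat_eq_real_of_nat)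
  finally show ?thesis .
qed

section \<open>From packing dimension to counts of squares\<close>

lemma packing_delta_ge_finite:
  assumes "finite P" "P \<in> ball_packings \<delta> A"
  shows "ennreal (\<Sum>(x, r)\<in>P. (2 * r) powr s) \<le> packing_delta s \<delta> A"
proof -
  have "ennreal (\<Sum>(x, r)\<in>P. (2 * r) powr s) = (\<Sum>\<^sub>\<infinity>(x, r)\<in>P. ennreal ((2 * r) powr s))"
    using assms(1) by (simp add: case_prod_unfold)
  also have "\<dots> \<le> packing_delta s \<delta> A"
    unfolding packing_delta_def by (rule SUP_upper) fact
  finally show ?thesis .
qed

text \<open>The residues modulo 3 split the squares into nine classes in which the balls of radius 2^(-n) around one point per square are disjoint.\<close>

lemma cell_eq_if_close_and_cong:
  assumes "\<bar>x $ 1 - y $ 1\<bar> \<le> 2 / 2 ^ n" "\<bar>x $ 2 - y $ 2\<bar> \<le> 2 / 2 ^ n"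
    and "fst (cell n x) mod 3 = fst (cell n y) mod 3" "snd (cell n x) mod 3 = snd (cell n y) mod 3"
  shows "cell n x = cell n y"
proof -
  have *: "\<lfloor>2 ^ n * a\<rfloor> = \<lfloor>2 ^ n * b\<rfloor>"
    if "\<bar>a - b\<bar> \<le> 2 / 2 ^ n" "\<lfloor>2 ^ n * a\<rfloor> mod 3 = \<lfloor>2 ^ n * b\<rfloor> mod 3" for a b :: real
  proof -
    have "2 ^ n * \<bar>a - b\<bar> \<le> 2" using that(1) by (simp add: field_simps)
    then have "\<bar>2 ^ n * a - 2 ^ n * b\<bar> \<le> 2" by (simp add: abs_mult flip: right_diff_distrib)
    then have "\<bar>\<lfloor>2 ^ n * a\<rfloor> - \<lfloor>2 ^ n * b\<rfloor>\<bar> < 3" by linarith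
    moreover have "3 dvd \<lfloor>2 ^ n * a\<rfloor> - \<lfloor>2 ^ n * b\<rfloor>" using that(2) by (simp add: mod_eq_dvd_iff)
    ultimately show ?thesis using zdvd_not_zless[of "\<bar>\<lfloor>2 ^ n * a\<rfloor> - \<lfloor>2 ^ n * b\<rfloor>\<bar>" 3] by auto
  qed
  show ?thesis using assms *[of "x $ 1" "y $ 1"] *[of "x $ 2" "y $ 2"] by (simp add: cell_def)
qed

lemma card_cells_class_le:
  fixes B :: "(real^2) set"
  assumes S: "finite S" "S \<subseteq> cell n ` B" "\<And>Q. Q \<in> S \<Longrightarrow> fst Q mod 3 = a \<and> snd Q mod 3 = b"
    and \<delta>: "1 / 2 ^ n \<le> \<delta>"
  shows "ennreal (real (card S) * (2 / 2 ^ n) powr t) \<le> packing_delta t \<delta> B"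
proof -
  define f where "f = inv_into B (cell n)"
  have fB: "f Q \<in> B" and fc: "cell n (f Q) = Q" if "Q \<in> S" for Q
    unfolding f_def using subsetD[OF S(2) that] by (simp_all only: inv_into_into f_inv_into_f)
  define P where "P = (\<lambda>Q. (f Q, 1 / 2 ^ n :: real)) ` S"
  have inj: "inj_on (\<lambda>Q. (f Q, 1 / 2 ^ n :: real)) S"
  proof (rule inj_onI)
    fix Q R assume QR: "Q \<in> S" "R \<in> S" and "(f Q, 1 / 2 ^ n :: real) = (f R, 1 / 2 ^ n)"
    then have "cell n (f Q) = cell n (f R)" by (simp only: prod.inject)
    then show "Q = R" by (simp only: fc QR)
  qed
  have "finite P" using S by (simp add: P_def)
  have disj: "Q = R" if "Q \<in> S" "R \<in> S" "cball (f Q) (1 / 2 ^ n) \<inter> cball (f R) (1 / 2 ^ n) \<noteq> {}" for Q R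
  proof -
    from that(3) obtain z where "dist (f Q) z \<le> 1 / 2 ^ n" "dist (f R) z \<le> 1 / 2 ^ n" by auto
    then have "norm (f Q - f R) \<le> 2 / 2 ^ n"
      using dist_triangle2[of "f Q" "f R" z] by (simp add: dist_norm)
    then have "\<bar>f Q $ i - f R $ i\<bar> \<le> 2 / 2 ^ n" for i
      using component_le_norm_cart[of "f Q - f R" i] by simp
    then have "cell n (f Q) = cell n (f R)"
      using S(3)[OF that(1)] S(3)[OF that(2)] by (intro cell_eq_if_close_and_cong) (simp_all only: fc that)
    then show ?thesis by (simp only: fc that)
  qed
  have "P \<in> ball_packings \<delta> B"
    unfolding ball_packings_def
  proof (intro CollectI conjI)
    show "countable P" using \<open>finite P\<close> by (rule countable_finite)
    show "P \<subseteq> B \<times> {0<..\<delta>}" using \<delta> fB by (auto simp: P_def)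
    show "pairwise (\<lambda>(x, r) (y, t). cball x r \<inter> cball y t = {}) P"
      unfolding P_def pairwise_image using disj by (intro pairwiseI) (simp only: prod.case, blast)
  qed
  then have "ennreal (\<Sum>(x, r)\<in>P. (2 * r) powr t) \<le> packing_delta t \<delta> B"
    by (rule packing_delta_ge_finite[OF \<open>finite P\<close>])
  also have "(\<Sum>(x, r)\<in>P. (2 * r) powr t) = real (card S) * (2 / 2 ^ n) powr t"
    unfolding P_def by (subst sum.reindex[OF inj]) simp
  finally show ?thesis .
qed

text \<open>At some \<delta> the packing sums are bounded by a real p, so each of the nine residue
  classes has at most p / (2 / 2^n)^t squares. Boundedness of B is not assumed: finiteness of the
  set of squares follows from the uniform bound on its finite subsets.\<close>

lemma card_cells_le_packing_premeasure:
  fixes B :: "(real^2) set"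
  assumes "packing_premeasure t B < \<infinity>"
  obtains C n0 where "0 < C" "\<And>n. n0 \<le> n \<Longrightarrow> finite (cell n ` B)"
    "\<And>n. n0 \<le> n \<Longrightarrow> real (card (cell n ` B)) \<le> C * 2 powr (t * real n)"
proof -
  obtain \<delta> where \<delta>: "0 < \<delta>" "packing_delta t \<delta> B < \<infinity>"
    using assms unfolding packing_premeasure_def INF_less_iff by auto
  then obtain p where p: "packing_delta t \<delta> B = ennreal p" "0 \<le> p"
    by (cases "packing_delta t \<delta> B" rule: ennreal_cases) auto
  obtain n0 where n0: "(1/2) ^ n0 < \<delta>" using \<delta>(1) real_arch_pow_inv[of \<delta> "1/2"] by auto
  \<comment> \<open>The 9 counts the residue classes; \<open>p + 1\<close> in place of
    \<open>p\<close> makes C positive.\<close>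
  define C where "C = 9 * (p + 1) / 2 powr t"
  have bound: "real (card S) \<le> C * 2 powr (t * real n)"
    if n: "n0 \<le> n" and S: "finite S" "S \<subseteq> cell n ` B" for n S
  proof -
    define c where "c = (2 / 2 ^ n :: real) powr t"
    have c: "c > 0" by (simp add: c_def)
    have c': "1 / c = 2 powr (t * real n) / 2 powr t"
    proof -
      have "c = 2 powr t / (2 ^ n) powr t" by (simp add: c_def powr_divide)
      also have "(2 ^ n :: real) powr t = 2 powr (t * real n)"
        by (simp add: powr_powr mult.commute flip: powr_realpow)
      finally show ?thesis by simp
    qed
    have "(1/2::real) ^ n \<le> (1/2) ^ n0" using n by (intro power_decreasing) auto
    then have d: "1 / 2 ^ n \<le> \<delta>" using n0 by (simp add: power_one_over)
    define T where "T = (\<lambda>(a, b). {Q \<in> S. fst Q mod 3 = a \<and> snd Q mod 3 = b})"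
    have T: "real (card (T ab)) \<le> p / c" for ab
    proof -
      obtain a b where ab: "ab = (a, b)" by force
      have "ennreal (real (card (T ab)) * c) \<le> ennreal p"
        unfolding p(1)[symmetric] c_def
        by (rule card_cells_class_le[where a = a and b = b]) (use S d in \<open>auto simp: T_def ab\<close>)
      then show ?thesis using p c by (simp add: field_simps)
    qed
    have "S \<subseteq> (\<Union>ab\<in>{0..2}\<times>{0..2}. T ab)"
      by (auto simp: T_def)
    then have "card S \<le> card (\<Union>ab\<in>{0..2}\<times>{0..2}. T ab)"
      using S by (intro card_mono) (auto simp: T_def split: prod.splits)
    also have "\<dots> \<le> (\<Sum>ab\<in>{0..2}\<times>{0..2}. card (T ab))" by (rule card_UN_le) simp
    finally have "real (card S) \<le> (\<Sum>ab\<in>{0..2}\<times>{0..2}. real (card (T ab)))"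
      by (metis of_nat_le_iff of_nat_sum)
    also have "\<dots> \<le> (\<Sum>ab\<in>({0..2}\<times>{0..2} :: (int \<times> int) set). p / c)" by (intro sum_mono T)
    also have "\<dots> = 9 * p * (1 / c)" by simp
    also have "\<dots> \<le> C * 2 powr (t * real n)"
      unfolding c' C_def using p by (simp add: field_simps)
    finally show ?thesis .
  qed
  have fin: "finite (cell n ` B)" if n: "n0 \<le> n" for n
  proof (rule finite_if_finite_subsets_card_bdd[THEN conjunct1])
    fix S assume "S \<subseteq> cell n ` B" "finite S"
    then have "real (card S) \<le> C * 2 powr (t * real n)" using bound n by blast
    then show "card S \<le> nat \<lfloor>C * 2 powr (t * real n)\<rfloor>" by linarith
  qed
  show ?thesis
  proof (rule that)
    show "0 < C" using p by (simp add: C_def)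
  qed (use fin bound in auto)
qed

text \<open>Null packing measure at some exponent below t supplies countably many pieces of
  premeasure less than 1, and each has controlled counts at all fine levels. The constants depend on
  the piece, which is why the slope must later meet countably many families of requirements.\<close>

lemma packing_dim_less_cover:
  fixes E :: "(real^2) set"
  assumes "packing_dim E < ereal t"
  obtains B C n0 where "E \<subseteq> (\<Union>i::nat. B i)" "\<And>i. 0 < C i"
    "\<And>i n. n0 i \<le> n \<Longrightarrow> finite (cell n ` B i)"
    "\<And>i n. n0 i \<le> n \<Longrightarrow> real (card (cell n ` B i)) \<le> C i * 2 powr (t * real n)"
proof -
  obtain t0 where t0: "t0 < t" "packing_measure t0 E = 0"
    using assms unfolding packing_dim_def INF_less_iff by auto
  then have "packing_measure t0 E < 1" by simp
  then obtain B where B: "E \<subseteq> (\<Union>i::nat. B i)" "(\<Sum>i. packing_premeasure t0 (B i)) < 1"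
    unfolding packing_measure_def INF_less_iff by blast
  have "\<exists>C n0. 0 < C \<and> (\<forall>n\<ge>n0. finite (cell n ` B i) \<and> real (card (cell n ` B i)) \<le> C * 2 powr (t * real n))" for i
  proof -
    have "packing_premeasure t0 (B i) < 1" using B(2) by (rule ennreal_suminf_lessD)
    then have "packing_premeasure t0 (B i) < \<infinity>" by (simp add: order.strict_trans)
    then obtain C n0 where C: "0 < C" "\<And>n. n0 \<le> n \<Longrightarrow> finite (cell n ` B i)"
      "\<And>n. n0 \<le> n \<Longrightarrow> real (card (cell n ` B i)) \<le> C * 2 powr (t0 * real n)"
      by (rule card_cells_le_packing_premeasure) blast
    have "C * 2 powr (t0 * real n) \<le> C * 2 powr (t * real n)" for n
      using C(1) t0 by (intro mult_left_mono powr_mono mult_right_mono) auto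
    then show ?thesis using C by (meson order.trans)
  qed
  then obtain C n0 where "\<And>i. 0 < C i \<and> (\<forall>n\<ge>n0 i. finite (cell n ` B i) \<and> real (card (cell n ` B i)) \<le> C i * 2 powr (t * real n))"
    by metis
  then show ?thesis using that[OF B(1)] by blast
qed

section \<open>Counting squares in strips\<close>

lemma abs_div_diff_le_1:
  fixes x y k :: int
  assumes "\<bar>x - y\<bar> \<le> k" "0 < k"
  shows "\<bar>x div k - y div k\<bar> \<le> 1"
proof -
  have "x div k \<le> y div k + 1" if "x \<le> y + k" for x y
    using zdiv_mono1[OF that, of k] assms(2) by simp
  from this[of x y] this[of y x] show ?thesis using assms by linarith
qed

lemma abs_diff_less_if_div_eq:
  fixes x y k :: int
  assumes "x div k = y div k" "0 < k"
  shows "\<bar>x - y\<bar> < k"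
proof -
  have "x - y = x mod k - y mod k"
    using assms(1) by (metis add_diff_cancel_left mult_div_mod_eq)
  then show ?thesis
    using pos_mod_sign[of k x] pos_mod_bound[of k x] pos_mod_sign[of k y] pos_mod_bound[of k y] assms(2)
    by linarith
qed

text \<open>Overcrowded squares need not be few, but they lie in few larger squares, and this is all that the content sees.\<close>

lemma card_coarse_heavy_le:
  assumes A: "finite A"
  shows "real (card (coarse i ` {Q \<in> A. T < real (card {R \<in> A. cell_dist Q R \<le> 2 ^ i})})) * T
    \<le> 9 * real (card A)"
proof -
  define H where "H = {Q \<in> A. T < real (card {R \<in> A. cell_dist Q R \<le> 2 ^ i})}"
  define S where "S = coarse i ` H"
  \<comment> \<open>One overcrowded representative per ancestor. In the double count below, R is
    counted for at most nine ancestors, since a representative within 2^i of R has its ancestor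
    equal or adjacent to that of R.\<close>
  define f where "f = inv_into H (coarse i)"
  have f: "f P \<in> H" "coarse i (f P) = P" if "P \<in> S" for P
    using that unfolding f_def S_def by (simp_all only: inv_into_into f_inv_into_f)
  have fin: "finite S" using A by (simp add: S_def H_def)
  have "real (card S) * T = (\<Sum>P\<in>S. T)" by simp
  also have "\<dots> \<le> (\<Sum>P\<in>S. real (card {R \<in> A. cell_dist (f P) R \<le> 2 ^ i}))"
    using f(1) by (intro sum_mono) (auto simp: H_def intro: less_imp_le)
  also have "\<dots> = real (\<Sum>P\<in>S. card {R \<in> A. cell_dist (f P) R \<le> 2 ^ i})" by simp
  also have "(\<Sum>P\<in>S. card {R \<in> A. cell_dist (f P) R \<le> 2 ^ i}) =
      (\<Sum>R\<in>A. card {P \<in> S. cell_dist (f P) R \<le> 2 ^ i})"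
    by (rule sum_multicount_gen) (use A fin in auto)
  also have "real \<dots> \<le> real (\<Sum>R\<in>A. 9)"
  proof (intro of_nat_mono sum_mono)
    fix R
    obtain a b where ab: "coarse i R = (a, b)" by force
    have "{P \<in> S. cell_dist (f P) R \<le> 2 ^ i} \<subseteq> {a - 1..a + 1} \<times> {b - 1..b + 1}"
    proof
      fix P assume P: "P \<in> {P \<in> S. cell_dist (f P) R \<le> 2 ^ i}"
      then have *: "coarse i (f P) = P" using f by blast
      have "\<bar>fst (f P) - fst R\<bar> \<le> 2 ^ i" "\<bar>snd (f P) - snd R\<bar> \<le> 2 ^ i"
        using P by (auto simp: cell_dist_def)
      then have "\<bar>fst P - a\<bar> \<le> 1" "\<bar>snd P - b\<bar> \<le> 1"
        using abs_div_diff_le_1[of "fst (f P)" "fst R" "2 ^ i"] abs_div_diff_le_1[of "snd (f P)" "snd R" "2 ^ i"]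
          ab arg_cong[OF *, of fst] arg_cong[OF *, of snd]
        by (auto simp: coarse_def)
      then show "P \<in> {a - 1..a + 1} \<times> {b - 1..b + 1}"
        by (auto simp: mem_Times_iff)
    qed
    from card_mono[OF _ this] show "card {P \<in> S. cell_dist (f P) R \<le> 2 ^ i} \<le> 9" by simp
  qed
  finally show ?thesis by (simp add: S_def H_def)
qed

lemma card_nat_set_le_spread:
  fixes S :: "nat set"
  assumes "0 \<le> B" "\<And>a b. a \<in> S \<Longrightarrow> b \<in> S \<Longrightarrow> a \<le> b \<Longrightarrow> real b - real a \<le> B"
  shows "real (card S) \<le> B + 1"
proof (cases "S = {}")
  case False
  define m where "m = (LEAST x. x \<in> S)"
  have m: "m \<in> S" "\<And>x. x \<in> S \<Longrightarrow> m \<le> x"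
    using False unfolding m_def by (auto intro: LeastI Least_le)
  have "S \<subseteq> {m..m + nat \<lfloor>B\<rfloor>}"
  proof
    fix x assume x: "x \<in> S"
    then have "real x - real m \<le> B" using m assms by auto
    then show "x \<in> {m..m + nat \<lfloor>B\<rfloor>}" using m(2)[OF x] assms(1) by (simp) linarith
  qed
  then have "card S \<le> card {m..m + nat \<lfloor>B\<rfloor>}" by (rule card_mono[rotated]) simp
  then have "card S \<le> nat \<lfloor>B\<rfloor> + 1" by simp
  then show ?thesis using assms(1) by linarith
qed (use assms in simp)

text \<open>Transversality. If |v1| is at least d / 2, then \<theta> v1 + v2 moves with speed at
  least d / 2, so the admissible a spread over at most 16 / (d h), and d h <= 1 absorbs the extra 1
  of the count into 17. Otherwise |v2| = d and |\<theta> v1| <= d / 2, so a value of size at most 4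
  forces d <= 8; then even all L directions are few enough because L h <= 1.\<close>

lemma card_directions_le:
  fixes v1 v2 :: int and h \<theta> :: real
  defines "d \<equiv> max \<bar>v1\<bar> \<bar>v2\<bar>"
  assumes h: "0 < h" "0 \<le> \<theta>" "\<theta> + real L * h \<le> 1" and d: "1 \<le> d" "d * h \<le> 1"
  shows "real (card {a. a < L \<and> \<bar>(\<theta> + real a * h) * v1 + v2\<bar> \<le> 4}) \<le> 17 / (d * h)"
proof -
  let ?S = "{a. a < L \<and> \<bar>(\<theta> + real a * h) * v1 + v2\<bar> \<le> 4}"
  have dh: "0 < d * h" "0 < real_of_int d" using d h by auto
  have inv: "1 \<le> 1 / (d * h)" using d dh by simp
  show ?thesis
  proof (cases "d \<le> 2 * \<bar>v1\<bar>")
    case True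
    then have dv: "real_of_int d \<le> 2 * \<bar>real_of_int v1\<bar>" by linarith
    have "real b - real a \<le> 16 / (d * h)" if "a \<in> ?S" "b \<in> ?S" "a \<le> b" for a b
    proof -
      have "\<bar>((\<theta> + real b * h) * v1 + v2) - ((\<theta> + real a * h) * v1 + v2)\<bar> \<le> 8" using that by auto
      then have "\<bar>((real b - real a) * h) * v1\<bar> \<le> 8" by (simp add: algebra_simps)
      then have *: "(real b - real a) * h * \<bar>v1\<bar> \<le> 8" using that h by (simp add: abs_mult)
      have "(real b - real a) * h * d \<le> (real b - real a) * h * (2 * \<bar>v1\<bar>)"
        using that h dv by (intro mult_left_mono) simp_all
      also have "\<dots> = 2 * ((real b - real a) * h * \<bar>v1\<bar>)" by simp
      also have "\<dots> \<le> 16" using * by linarith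
      finally show ?thesis using dh by (simp add: pos_le_divide_eq mult_ac)
    qed
    then have "real (card ?S) \<le> 16 / (d * h) + 1"
      using dh by (intro card_nat_set_le_spread) auto
    also have "\<dots> \<le> 16 / (d * h) + 1 / (d * h)" using inv by (rule add_left_mono)
    also have "\<dots> = 17 / (d * h)" unfolding add_divide_distrib[symmetric] by simp
    finally show ?thesis .
  next
    case False
    then have v: "\<bar>v2\<bar> = d" "2 * \<bar>v1\<bar> < d" by (auto simp: d_def)
    show ?thesis
    proof (cases "?S = {}")
      case False
      then obtain a where a: "a < L" "\<bar>(\<theta> + real a * h) * v1 + v2\<bar> \<le> 4" by blast
      have "real a * h \<le> real L * h" using a h by (intro mult_right_mono) auto
      then have t: "0 \<le> \<theta> + real a * h" "\<theta> + real a * h \<le> 1" using h(1-3) by (simp_all only: add_nonneg_nonneg of_nat_0_le_iff mult_nonneg_nonneg less_imp_le)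
      have "\<bar>(\<theta> + real a * h) * v1\<bar> \<le> 1 * \<bar>real_of_int v1\<bar>"
        unfolding abs_mult using t by (intro mult_right_mono) auto
      moreover have "2 * \<bar>real_of_int v1\<bar> < d" "\<bar>real_of_int v2\<bar> = d"
        using v by linarith+
      ultimately have "real_of_int d \<le> 8" using a(2) by linarith
      then have "d * (real L * h) \<le> 8 * 1" using h d by (intro mult_mono) auto
      then have "real L \<le> 8 / (d * h)" using dh by (simp add: pos_le_divide_eq mult_ac)
      moreover have "real (card ?S) \<le> real L"
        using card_mono[of "{..<L}" ?S] by auto
      moreover have "8 / (d * h) \<le> 17 / (d * h)" using dh by (intro divide_right_mono) auto
      ultimately show ?thesis by linarith
    next
      case True
      show ?thesis unfolding True using dh by simp
    qed
  qed
qed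

text \<open>Squares Q, R at level n are integer vectors, so R lies in the strip of Q when the projections of their corners differ by at most c 2^(-n); only siblings, with a common ancestor q levels up, are counted.\<close>

definition light :: "real \<Rightarrow> real \<Rightarrow> nat \<Rightarrow> (int \<times> int) set \<Rightarrow> (int \<times> int) set" where
  "light s g q A =
     {Q \<in> A. \<forall>i\<le>q. real (card {R \<in> A. cell_dist Q R \<le> 2 ^ i}) \<le> 2 powr (s * real i + g * real q)}"

definition strip :: "real \<Rightarrow> real \<Rightarrow> nat \<Rightarrow> (int \<times> int) set \<Rightarrow> int \<times> int \<Rightarrow> (int \<times> int) set" where
  "strip c \<theta> q A Q =
     {R \<in> A. coarse q R = coarse q Q \<and> \<bar>\<theta> * (fst R - fst Q) + (snd R - snd Q)\<bar> \<le> c}"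

text \<open>\<open>max (s - 1) 0\<close> is the expected dimension of a fibre of an s-dimensional
  set. Of the three losses g, one comes from \<open>light\<close>, one from the shortness 2^(-g q)
  of the progression of directions, and one is the margin that makes bad directions rare.\<close>

definition spread_direction :: "real \<Rightarrow> real \<Rightarrow> real \<Rightarrow> nat \<Rightarrow> (int \<times> int) set \<Rightarrow> real \<Rightarrow> bool" where
  "spread_direction c s g q A \<theta> \<longleftrightarrow>
     (\<Sum>Q\<in>light s g q A. real (card (strip c \<theta> q A Q)))
       \<le> real (card A) * 2 powr ((max (s - 1) 0 + 3 * g) * real q)"

lemma finite_light [simp]: "finite A \<Longrightarrow> finite (light s g q A)"
  by (simp add: light_def)

lemma finite_strip [simp]: "finite A \<Longrightarrow> finite (strip c \<theta> q A Q)"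
  by (simp add: strip_def)

lemma cell_dist_less_if_coarse_eq:
  assumes "coarse q R = coarse q Q"
  shows "cell_dist Q R < 2 ^ q"
  using assms abs_diff_less_if_div_eq[of "fst Q" "2 ^ q" "fst R"] abs_diff_less_if_div_eq[of "snd Q" "2 ^ q" "snd R"]
  by (auto simp: coarse_def cell_dist_def)

text \<open>After exchanging the sums, a sibling R at distance about 2^i from Q lies in the strip
  for at most about 2^(-i) / h directions, and lightness allows about 2^(s i + g q) such R. The
  products 2^((s - 1) i) over q + 1 shells produce the exponent \<mu>; the square Q itself adds
  L.\<close>

lemma sum_card_strip_le:
  fixes s g h \<theta> :: real
  defines "\<mu> \<equiv> max (s - 1) 0"
  assumes A: "finite A" and Q: "Q \<in> light s g q A"
    and h: "0 < h" "0 \<le> \<theta>" "\<theta> + real L * h \<le> 1" "h * 2 ^ q \<le> 1" "1 \<le> real L * h * 2 powr (g * q)"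
    and g: "0 \<le> g"
  shows "(\<Sum>a<L. real (card (strip 4 (\<theta> + real a * h) q A Q)))
    \<le> real L * (35 * (real q + 1) * 2 powr ((\<mu> + 2 * g) * q))"
proof -
  define Y where "Y = {R \<in> A. coarse q R = coarse q Q}"
  define str where "str a R \<longleftrightarrow> \<bar>(\<theta> + real a * h) * (fst R - fst Q) + (snd R - snd Q)\<bar> \<le> 4" for a R
  \<comment> \<open>Dyadic shells around Q. A distance that is a power of 2 belongs to two shells,
    which is harmless for an upper bound. Replacing the distance by 2^i turns 17 into 34.\<close>
  define Yi where "Yi i R \<longleftrightarrow> cell_dist Q R \<le> 2 ^ i \<and> 2 ^ i \<le> 2 * cell_dist Q R" for i R
  have finY: "finite Y" using A by (simp add: Y_def)
  have "(\<Sum>a<L. real (card (strip 4 (\<theta> + real a * h) q A Q))) = real (\<Sum>a<L. card {R \<in> Y. str a R})"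
    by (simp add: strip_def Y_def str_def conj_assoc)
  also have "(\<Sum>a<L. card {R \<in> Y. str a R}) = (\<Sum>R\<in>Y. card {a \<in> {..<L}. str a R})"
    by (rule sum_multicount_gen) (use finY in auto)
  also have "real \<dots> = (\<Sum>R\<in>Y. real (card {a. a < L \<and> str a R}))"
    by simp
  also have "\<dots> \<le> (\<Sum>R\<in>Y. (if R = Q then real L else 0) + (\<Sum>i\<le>q. if Yi i R then 34 / (2 ^ i * h) else 0))"
  proof (rule sum_mono)
    fix R assume R: "R \<in> Y"
    have nn: "0 \<le> (\<Sum>i\<le>q. if Yi i R then 34 / (2 ^ i * h) else 0)"
      using h by (intro sum_nonneg) auto
    show "real (card {a. a < L \<and> str a R}) \<le> (if R = Q then real L else 0) + (\<Sum>i\<le>q. if Yi i R then 34 / (2 ^ i * h) else 0)"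
    proof (cases "R = Q")
      case True
      have "real (card {a. a < L \<and> str a R}) \<le> real L"
        using card_mono[of "{..<L}" "{a. a < L \<and> str a R}"] by auto
      then show ?thesis using True nn by simp
    next
      case False
      define d where "d = cell_dist Q R"
      have d1: "1 \<le> d" using False by (cases R; cases Q) (auto simp: d_def cell_dist_def)
      have dq: "d \<le> 2 ^ q" using R cell_dist_less_if_coarse_eq[of q R Q] by (auto simp: Y_def d_def)
      define i where "i = (LEAST i. d \<le> 2 ^ i)"
      have i: "d \<le> 2 ^ i" unfolding i_def using dq by (rule LeastI)
      have iq: "i \<le> q" unfolding i_def using dq by (rule Least_le)
      have i2: "2 ^ i \<le> 2 * d"
      proof (cases i)
        case (Suc j)
        have "\<not> d \<le> 2 ^ j" using not_less_Least[of j "\<lambda>i. d \<le> 2 ^ i"] Suc by (simp add: i_def)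
        then show ?thesis using Suc by simp
      qed (use d1 in simp)
      have Yi: "Yi i R" using i i2 by (simp add: Yi_def d_def)
      have "real_of_int d \<le> 2 ^ q" using dq by (metis of_int_le_iff of_int_numeral of_int_power)
      then have "real_of_int d * h \<le> 2 ^ q * h" using h by (intro mult_right_mono) auto
      also have "2 ^ q * h \<le> 1" using h(4) by (simp add: mult.commute)
      finally have dh: "real_of_int d * h \<le> 1" .
      have d': "d = max \<bar>fst R - fst Q\<bar> \<bar>snd R - snd Q\<bar>" by (simp add: d_def cell_dist_def abs_minus_commute)
      have "real (card {a. a < L \<and> str a R}) \<le> 17 / (d * h)"
        unfolding str_def d' of_int_diff[symmetric]
        by (rule card_directions_le) (use h d1 dh d' in \<open>simp_all\<close>)
      also have "\<dots> \<le> 34 / (2 ^ i * h)"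
      proof -
        have "(2::real) ^ i \<le> 2 * d" using i2 by (metis of_int_le_iff of_int_mult of_int_numeral of_int_power)
        then show ?thesis using h d1 by (simp add: divide_simps)
      qed
      also have "\<dots> = (if Yi i R then 34 / (2 ^ i * h) else 0)" using Yi by simp
      also have "\<dots> \<le> (\<Sum>i\<le>q. if Yi i R then 34 / (2 ^ i * h) else 0)"
        using h iq by (intro member_le_sum) auto
      finally show ?thesis using False by simp
    qed
  qed
  also have "\<dots> = (\<Sum>R\<in>Y. if R = Q then real L else 0) + (\<Sum>i\<le>q. \<Sum>R\<in>Y. if Yi i R then 34 / (2 ^ i * h) else 0)"
    by (subst sum.distrib, subst (2) sum.swap) simp
  also have "(\<Sum>R\<in>Y. if R = Q then real L else 0) \<le> real L"
    using finY by simp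
  also have "(\<Sum>i\<le>q. \<Sum>R\<in>Y. if Yi i R then 34 / (2 ^ i * h) else 0) \<le>
      (\<Sum>i\<le>q. real L * 34 * 2 powr ((\<mu> + 2 * g) * q))"
  proof (rule sum_mono)
    fix i assume i: "i \<in> {..q}"
    have "(\<Sum>R\<in>Y. if Yi i R then 34 / (2 ^ i * h) else 0) = real (card {R \<in> Y. Yi i R}) * (34 / (2 ^ i * h))"
      using finY by (simp add: sum.If_cases Int_def)
    also have "\<dots> \<le> 2 powr (s * i + g * q) * (34 / (2 ^ i * h))"
    proof (intro mult_right_mono)
      have "card {R \<in> Y. Yi i R} \<le> card {R \<in> A. cell_dist Q R \<le> 2 ^ i}"
        using A by (intro card_mono) (auto simp: Y_def Yi_def)
      also have "real \<dots> \<le> 2 powr (s * i + g * q)" using Q i by (auto simp: light_def)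
      finally show "real (card {R \<in> Y. Yi i R}) \<le> 2 powr (s * i + g * q)" by simp
    qed (use h in auto)
    also have "\<dots> = 34 * 2 powr ((s - 1) * i + g * q) * (1 / h)"
      by (simp add: left_diff_distrib powr_diff powr_add powr_realpow field_simps)
    also have "\<dots> \<le> 34 * 2 powr (\<mu> * q + g * q) * (real L * 2 powr (g * q))"
    proof (intro mult_mono)
      have "(s - 1) * i \<le> \<mu> * i" by (intro mult_right_mono) (auto simp: \<mu>_def)
      also have "\<dots> \<le> \<mu> * q" using i by (intro mult_left_mono) (auto simp: \<mu>_def)
      finally show "(2::real) powr ((s - 1) * i + g * q) \<le> 2 powr (\<mu> * q + g * q)" by simp
      show "1 / h \<le> real L * 2 powr (g * q)" using h by (simp add: field_simps)
    qed (use h in auto)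
    also have "\<dots> = real L * 34 * 2 powr ((\<mu> + 2 * g) * q)"
      by (simp add: powr_add[symmetric] algebra_simps)
    finally show "(\<Sum>R\<in>Y. if Yi i R then 34 / (2 ^ i * h) else 0) \<le> real L * 34 * 2 powr ((\<mu> + 2 * g) * q)" .
  qed
  also have "real L + (\<Sum>i\<le>q. real L * 34 * 2 powr ((\<mu> + 2 * g) * q)) =
      real L * (1 + 34 * (real q + 1) * 2 powr ((\<mu> + 2 * g) * q))"
    by (simp add: algebra_simps)
  also have "\<dots> \<le> real L * (35 * (real q + 1) * 2 powr ((\<mu> + 2 * g) * q))"
  proof (intro mult_left_mono)
    have "1 \<le> (real q + 1) * 2 powr ((\<mu> + 2 * g) * q)"
      using mult_mono[of 1 "real q + 1" 1 "2 powr ((\<mu> + 2 * g) * q)"] g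
      by (simp add: \<mu>_def ge_one_powr_ge_zero)
    then show "1 + 34 * (real q + 1) * 2 powr ((\<mu> + 2 * g) * q) \<le> 35 * (real q + 1) * 2 powr ((\<mu> + 2 * g) * q)"
      by (simp add: algebra_simps)
  qed simp
  finally show ?thesis by simp
qed

text \<open>Markov's inequality in the direction: the threshold exceeds the average over a by 2^(g
  q), up to the factor 35 (q + 1). Without squares the threshold is 0 and cannot be divided by,
  hence the separate case.\<close>

lemma card_not_spread_direction_le:
  fixes s g h \<theta> :: real
  assumes A: "finite A"
    and h: "0 < h" "0 \<le> \<theta>" "\<theta> + real L * h \<le> 1" "h * 2 ^ q \<le> 1" "1 \<le> real L * h * 2 powr (g * q)"
    and g: "0 \<le> g"
  shows "real (card {a. a < L \<and> \<not> spread_direction 4 s g q A (\<theta> + real a * h)})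
    \<le> real L * (35 * (real q + 1) * 2 powr (- g * q))"
proof (cases "A = {}")
  case True
  then show ?thesis by (simp add: spread_direction_def light_def)
next
  case False
  define \<mu> where "\<mu> = max (s - 1) 0"
  define f where "f a = (\<Sum>Q\<in>light s g q A. real (card (strip 4 (\<theta> + real a * h) q A Q)))" for a
  define \<tau> where "\<tau> = real (card A) * 2 powr ((\<mu> + 3 * g) * q)"
  have \<tau>: "0 < \<tau>" using False A by (simp add: \<tau>_def card_gt_0_iff)
  have f0: "0 \<le> f a" for a by (simp add: f_def sum_nonneg)
  let ?B = "{a. a < L \<and> \<not> spread_direction 4 s g q A (\<theta> + real a * h)}"
  have "real (card ?B) * \<tau> = (\<Sum>a\<in>?B. \<tau>)" by simp
  also have "\<dots> \<le> (\<Sum>a\<in>?B. f a)"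
    by (intro sum_mono) (auto simp: spread_direction_def f_def \<tau>_def \<mu>_def)
  also have "\<dots> \<le> (\<Sum>a<L. f a)" using f0 by (intro sum_mono2) auto
  also have "\<dots> = (\<Sum>Q\<in>light s g q A. \<Sum>a<L. real (card (strip 4 (\<theta> + real a * h) q A Q)))"
    unfolding f_def by (rule sum.swap)
  also have "\<dots> \<le> (\<Sum>Q\<in>light s g q A. real L * (35 * (real q + 1) * 2 powr ((\<mu> + 2 * g) * q)))"
    unfolding \<mu>_def by (intro sum_mono sum_card_strip_le) (use assms in auto)
  also have "\<dots> = real (card (light s g q A)) * (real L * (35 * (real q + 1) * 2 powr ((\<mu> + 2 * g) * q)))"
    by simp
  also have "\<dots> \<le> real (card A) * (real L * (35 * (real q + 1) * 2 powr ((\<mu> + 2 * g) * q)))"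
    using A by (intro mult_right_mono) (auto simp: light_def intro!: card_mono)
  also have "\<dots> = real L * (35 * (real q + 1) * 2 powr (- g * q)) * \<tau>"
  proof -
    have "(2::real) powr ((\<mu> + 2 * g) * q) = 2 powr (- g * q) * 2 powr ((\<mu> + 3 * g) * q)"
      by (simp add: powr_add[symmetric] algebra_simps)
    then show ?thesis by (simp add: \<tau>_def)
  qed
  finally show ?thesis using \<tau> by simp
qed

text \<open>The loss from 4 to 3 absorbs all digits of the slope that are chosen later.\<close>

lemma spread_direction_perturb:
  assumes A: "finite A" and good: "spread_direction 4 s g q A \<theta>" and near: "\<bar>\<theta>' - \<theta>\<bar> * 2 ^ q \<le> 1"
  shows "spread_direction 3 s g q A \<theta>'"
proof -
  have "strip 3 \<theta>' q A Q \<subseteq> strip 4 \<theta> q A Q" for Q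
  proof
    fix R assume R: "R \<in> strip 3 \<theta>' q A Q"
    then have "cell_dist Q R < 2 ^ q" by (intro cell_dist_less_if_coarse_eq) (simp add: strip_def)
    then have "\<bar>fst R - fst Q\<bar> \<le> 2 ^ q" by (auto simp: cell_dist_def)
    then have "\<bar>real_of_int (fst R - fst Q)\<bar> \<le> 2 ^ q"
      by (metis of_int_abs of_int_le_iff of_int_numeral of_int_power)
    then have "\<bar>\<theta>' - \<theta>\<bar> * \<bar>real_of_int (fst R - fst Q)\<bar> \<le> \<bar>\<theta>' - \<theta>\<bar> * 2 ^ q"
      by (intro mult_left_mono) auto
    then have "\<bar>(\<theta>' - \<theta>) * real_of_int (fst R - fst Q)\<bar> \<le> 1"
      using near by (simp add: abs_mult)
    moreover have "\<theta>' * real_of_int (fst R - fst Q) = \<theta> * real_of_int (fst R - fst Q) + (\<theta>' - \<theta>) * real_of_int (fst R - fst Q)"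
      by (simp add: algebra_simps)
    ultimately show "R \<in> strip 4 \<theta> q A Q" using R by (auto simp: strip_def)
  qed
  then have "(\<Sum>Q\<in>light s g q A. real (card (strip 3 \<theta>' q A Q))) \<le>
      (\<Sum>Q\<in>light s g q A. real (card (strip 4 \<theta> q A Q)))"
    using A by (intro sum_mono of_nat_mono card_mono) auto
  then show ?thesis using good unfolding spread_direction_def by linarith
qed

text \<open>Markov's inequality again, now over the squares for a fixed slope; this is the origin of
  the fourth g.\<close>

lemma card_crowded_le:
  assumes A: "finite A" and good: "spread_direction c s g q A \<theta>"
  shows "real (card {Q \<in> light s g q A. 2 powr ((max (s - 1) 0 + 4 * g) * real q) < real (card (strip c \<theta> q A Q))})
    \<le> real (card A) * 2 powr (- g * real q)"
proof -
  let ?K = "2 powr ((max (s - 1) 0 + 4 * g) * real q) :: real"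
  let ?B = "{Q \<in> light s g q A. ?K < real (card (strip c \<theta> q A Q))}"
  have "real (card ?B) * ?K = (\<Sum>Q\<in>?B. ?K)" by simp
  also have "\<dots> \<le> (\<Sum>Q\<in>?B. real (card (strip c \<theta> q A Q)))" by (intro sum_mono) auto
  also have "\<dots> \<le> (\<Sum>Q\<in>light s g q A. real (card (strip c \<theta> q A Q)))"
    using A by (intro sum_mono2) auto
  also have "\<dots> \<le> real (card A) * 2 powr ((max (s - 1) 0 + 3 * g) * real q)"
    using good by (simp add: spread_direction_def)
  also have "\<dots> = real (card A) * 2 powr (- g * real q) * ?K"
    by (simp add: powr_add[symmetric] algebra_simps)
  finally show ?thesis by simp
qed

section \<open>Content of tame fibres\<close>

text \<open>Light and not crowded, with all counts taken among the squares of F. This makes tameness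
  a condition on single points that survives passing to the subsets of F lying over small
  intervals.\<close>

definition tame :: "real \<Rightarrow> real \<Rightarrow> real \<Rightarrow> (real^2) set \<Rightarrow> nat \<Rightarrow> nat \<Rightarrow> (real^2) set" where
  "tame s g \<theta> F n q = {x \<in> F. cell n x \<in> light s g q (cell n ` F) \<and>
     real (card (strip 3 \<theta> q (cell n ` F) (cell n x))) \<le> 2 powr ((max (s - 1) 0 + 4 * g) * real q)}"

lemma two_div_power_powr: "(2 / 2 ^ n :: real) powr s = 2 powr s * 2 powr (- s * real n)"
  by (simp add: powr_divide powr_minus_divide powr_powr mult.commute flip: powr_realpow)

text \<open>Squares overcrowded at distance 2^i are covered by their ancestors i levels up: about
  2^(t n) / 2^(s i + g q) sets of content 2^(-s (n - i)), so i cancels. Crowded squares are covered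
  at level n itself. Both give 2^((t - s) n - g q), at most 2^(-g q / 2) by \<open>ts\<close>. The
  factor 9 (q + 1) + 1 adds the q + 1 distances and the crowded squares.\<close>

lemma hausdorff_content_wild_le:
  fixes F :: "(real^2) set"
  assumes fin: "finite (cell n ` F)" and card: "real (card (cell n ` F)) \<le> C * 2 powr (t * real n)"
    and C: "0 < C" and s: "0 < s" and qn: "q \<le> n" and ts: "(t - s) * real n \<le> g * real q / 2"
    and good: "spread_direction 3 s g q (cell n ` F) \<theta>"
  shows "hausdorff_content s (F - tame s g \<theta> F n q) \<le>
    ennreal (2 powr s * C * (9 * (real q + 1) + 1) * 2 powr (- g * real q / 2))"
proof -
  define A where "A = cell n ` F"
  have finA: "finite A" using fin by (simp add: A_def)
  define W where "W = 2 powr s * C * 2 powr (- g * real q / 2)"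
  have W: "0 \<le> W" using C by (simp add: W_def)
  have expo: "2 powr (t * n) * 2 powr (- g * q) * 2 powr (- s * n) \<le> 2 powr (- g * real q / 2)"
  proof -
    have "2 powr (t * n) * 2 powr (- g * q) * 2 powr (- s * n) = 2 powr ((t - s) * n - g * q)"
      by (simp add: powr_add[symmetric] algebra_simps)
    also have "\<dots> \<le> 2 powr (- g * real q / 2)" using ts by simp
    finally show ?thesis .
  qed
  define H where "H i = {Q \<in> A. 2 powr (s * real i + g * real q) < real (card {R \<in> A. cell_dist Q R \<le> 2 ^ i})}" for i
  define B where "B = {Q \<in> light s g q A. 2 powr ((max (s - 1) 0 + 4 * g) * real q) < real (card (strip 3 \<theta> q A Q))}"
  have H: "hausdorff_content s {x \<in> F. cell n x \<in> H i} \<le> ennreal (9 * W)" if i: "i \<le> q" for i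
  proof -
    have finH: "finite (coarse i ` H i)" using finA by (simp add: H_def)
    have c: "real (card (coarse i ` H i)) * 2 powr (s * real i + g * real q) \<le> 9 * real (card A)"
      unfolding H_def by (rule card_coarse_heavy_le[OF finA])
    have "hausdorff_content s {x \<in> F. cell n x \<in> H i} \<le>
        ennreal (real (card (coarse i ` H i)) * (2 / 2 ^ (n - i)) powr s)"
    proof (rule hausdorff_content_cells[OF s finH])
      fix x assume "x \<in> {x \<in> F. cell n x \<in> H i}"
      then have "coarse i (cell n x) \<in> coarse i ` H i" by blast
      then show "cell (n - i) x \<in> coarse i ` H i" using i qn by (simp add: coarse_cell)
    qed
    also have "real (card (coarse i ` H i)) * (2 / 2 ^ (n - i)) powr s =
        (real (card (coarse i ` H i)) * 2 powr (s * real i + g * real q)) * (2 powr s * 2 powr (- g * q) * 2 powr (- s * n))"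
    proof -
      have "2 powr (- s * real (n - i)) = 2 powr (s * real i + g * real q) * (2 powr (- g * q) * 2 powr (- s * n))"
        using i qn by (simp add: powr_add[symmetric] of_nat_diff algebra_simps)
      then show ?thesis unfolding two_div_power_powr by simp
    qed
    also have "\<dots> \<le> (9 * (C * 2 powr (t * n))) * (2 powr s * 2 powr (- g * q) * 2 powr (- s * n))"
      using c card by (intro mult_right_mono) (auto simp: A_def)
    also have "\<dots> = 9 * 2 powr s * C * (2 powr (t * n) * 2 powr (- g * q) * 2 powr (- s * n))" by simp
    also have "\<dots> \<le> 9 * 2 powr s * C * 2 powr (- g * real q / 2)"
      using C by (intro mult_left_mono expo) auto
    finally show ?thesis by (simp add: W_def ennreal_leI mult.assoc)
  qed
  have B: "hausdorff_content s {x \<in> F. cell n x \<in> B} \<le> ennreal W"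
  proof -
    have c: "real (card B) \<le> real (card A) * 2 powr (- g * real q)"
      unfolding B_def by (rule card_crowded_le[OF finA]) (use good in \<open>simp add: A_def\<close>)
    have "hausdorff_content s {x \<in> F. cell n x \<in> B} \<le> ennreal (real (card B) * (2 / 2 ^ n) powr s)"
      by (rule hausdorff_content_cells[OF s]) (use finA in \<open>auto simp: B_def\<close>)
    also have "real (card B) * (2 / 2 ^ n) powr s \<le> (C * 2 powr (t * n) * 2 powr (- g * real q)) * (2 / 2 ^ n) powr s"
      using card by (intro mult_right_mono order.trans[OF c]) (auto simp: A_def)
    also have "\<dots> = 2 powr s * C * (2 powr (t * n) * 2 powr (- g * q) * 2 powr (- s * n))"
      unfolding two_div_power_powr by simp
    also have "\<dots> \<le> W"
      unfolding W_def using C by (intro mult_left_mono expo) auto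
    finally show ?thesis by (simp add: ennreal_leI)
  qed
  have "F - tame s g \<theta> F n q \<subseteq> (\<Union>i\<in>{..q}. {x \<in> F. cell n x \<in> H i}) \<union> {x \<in> F. cell n x \<in> B}"
    by (auto simp: tame_def H_def B_def A_def light_def not_le)
  then have "hausdorff_content s (F - tame s g \<theta> F n q) \<le>
      hausdorff_content s ((\<Union>i\<in>{..q}. {x \<in> F. cell n x \<in> H i}) \<union> {x \<in> F. cell n x \<in> B})"
    by (rule hausdorff_content_mono)
  also have "\<dots> \<le> hausdorff_content s (\<Union>i\<in>{..q}. {x \<in> F. cell n x \<in> H i}) + hausdorff_content s {x \<in> F. cell n x \<in> B}"
    by (rule hausdorff_content_Un_le)
  also have "\<dots> \<le> (\<Sum>i\<in>{..q}. hausdorff_content s {x \<in> F. cell n x \<in> H i}) + ennreal W"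
    by (intro add_mono B hausdorff_content_finite_UN_le) auto
  also have "\<dots> \<le> (\<Sum>i\<in>{..q}. ennreal (9 * W)) + ennreal W"
    by (intro add_mono sum_mono H) auto
  also have "\<dots> = ennreal (real (q + 1) * (9 * W) + W)"
    using W by (simp add: ennreal_mult'' ennreal_plus ennreal_of_nat_eq_real_of_nat del: of_nat_add of_nat_Suc)
  also have "real (q + 1) * (9 * W) + W = 2 powr s * C * (9 * (real q + 1) + 1) * 2 powr (- g * real q / 2)"
    by (simp add: W_def algebra_simps)
  finally show ?thesis .
qed

lemma card_image_le_fibres:
  assumes fin: "finite (f ` Z)" "finite (h ` Z)"
    and fib: "\<And>x. x \<in> Z \<Longrightarrow> real (card (f ` {y \<in> Z. h y = h x})) \<le> K"
  shows "real (card (f ` Z)) \<le> real (card (h ` Z)) * K"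
proof -
  have "f ` Z \<subseteq> (\<Union>P\<in>h ` Z. f ` {y \<in> Z. h y = P})" by blast
  then have "card (f ` Z) \<le> card (\<Union>P\<in>h ` Z. f ` {y \<in> Z. h y = P})"
    by (rule card_mono[rotated]) (auto intro!: finite_UN_I fin(2) finite_subset[OF _ fin(1)])
  also have "\<dots> \<le> (\<Sum>P\<in>h ` Z. card (f ` {y \<in> Z. h y = P}))"
    by (rule card_UN_le) fact
  finally have "real (card (f ` Z)) \<le> real (\<Sum>P\<in>h ` Z. card (f ` {y \<in> Z. h y = P}))"
    by (simp only: of_nat_le_iff)
  also have "\<dots> = (\<Sum>P\<in>h ` Z. real (card (f ` {y \<in> Z. h y = P})))" by simp
  also have "\<dots> \<le> (\<Sum>P\<in>h ` Z. K)" using fib by (intro sum_mono) auto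
  finally show ?thesis by simp
qed

text \<open>In units of 2^(-n) the projections of the points differ by at most 1, and rounding to
  corners adds at most \<theta> + 1 <= 2. This explains the width 3 in \<open>tame\<close>.\<close>

lemma cell_in_strip:
  assumes x: "x \<in> F" and \<theta>: "0 \<le> \<theta>" "\<theta> \<le> 1" and qn: "q \<le> n"
    and parent: "cell (n - q) x = cell (n - q) y"
    and near: "2 ^ n * \<bar>(\<theta> * x $ 1 + x $ 2) - (\<theta> * y $ 1 + y $ 2)\<bar> \<le> 1"
  shows "cell n x \<in> strip 3 \<theta> q (cell n ` F) (cell n y)"
proof -
  define a where "a i = (of_int \<lfloor>2 ^ n * x $ i\<rfloor> - of_int \<lfloor>2 ^ n * y $ i\<rfloor>) - (2 ^ n * x $ i - 2 ^ n * y $ i)" for i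
  have a: "\<bar>a i\<bar> \<le> 1" for i unfolding a_def by linarith
  have "\<bar>2 ^ n * ((\<theta> * x $ 1 + x $ 2) - (\<theta> * y $ 1 + y $ 2))\<bar> \<le> 1"
    using near by (simp add: abs_mult)
  moreover have "\<bar>\<theta> * a 1\<bar> \<le> 1 * 1" unfolding abs_mult using \<theta> a by (intro mult_mono) auto
  moreover have "\<theta> * (of_int \<lfloor>2 ^ n * x $ 1\<rfloor> - of_int \<lfloor>2 ^ n * y $ 1\<rfloor>) + (of_int \<lfloor>2 ^ n * x $ 2\<rfloor> - of_int \<lfloor>2 ^ n * y $ 2\<rfloor>)
    = 2 ^ n * ((\<theta> * x $ 1 + x $ 2) - (\<theta> * y $ 1 + y $ 2)) + \<theta> * a 1 + a 2"
    by (simp add: a_def algebra_simps)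
  ultimately have "\<bar>\<theta> * (of_int \<lfloor>2 ^ n * x $ 1\<rfloor> - of_int \<lfloor>2 ^ n * y $ 1\<rfloor>) + (of_int \<lfloor>2 ^ n * x $ 2\<rfloor> - of_int \<lfloor>2 ^ n * y $ 2\<rfloor>)\<bar> \<le> 3"
    using a[of 2] by linarith
  then show ?thesis
    using x parent qn by (auto simp: strip_def coarse_cell) (simp_all add: cell_def)
qed

text \<open>Each step of q levels multiplies the number of squares over a short interval by at most K, since all of them lie in the strip of any one of them.\<close>

lemma card_cells_tame_fibre_le:
  fixes F :: "(real^2) set" and s g \<theta> :: real and q :: nat
  defines "K \<equiv> 2 powr ((max (s - 1) 0 + 4 * g) * real q)"
  assumes \<theta>: "0 \<le> \<theta>" "\<theta> \<le> 1"
    and fin0: "finite (cell 0 ` F)" and fin: "\<And>j. 1 \<le> j \<Longrightarrow> j \<le> N \<Longrightarrow> finite (cell (j * q) ` F)"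
    and Z: "Z \<subseteq> F" "\<And>x j. x \<in> Z \<Longrightarrow> 1 \<le> j \<Longrightarrow> j \<le> N \<Longrightarrow> x \<in> tame s g \<theta> F (j * q) q"
    and near: "\<And>x y. x \<in> Z \<Longrightarrow> y \<in> Z \<Longrightarrow>
      2 ^ (N * q) * \<bar>(\<theta> * x $ 1 + x $ 2) - (\<theta> * y $ 1 + y $ 2)\<bar> \<le> 1"
    and "j \<le> N"
  shows "real (card (cell (j * q) ` Z)) \<le> real (card (cell 0 ` F)) * K ^ j"
  using \<open>j \<le> N\<close>
proof (induction j)
  case 0
  then show ?case using Z(1) fin0 by (auto intro!: card_mono image_mono)
next
  case (Suc j)
  let ?n = "Suc j * q"
  have finZ: "finite (cell ?n ` Z)" "finite (cell (j * q) ` Z)"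
  proof -
    have "finite (cell (i * q) ` F)" if "i \<le> N" for i
      using fin[of i] fin0 that by (cases i) auto
    note * = finite_subset[OF image_mono[OF Z(1)] this]
    show "finite (cell ?n ` Z)" "finite (cell (j * q) ` Z)"
      using *[of "Suc j"] *[of j] Suc.prems by simp_all
  qed
  have "real (card (cell ?n ` Z)) \<le> real (card (cell (j * q) ` Z)) * K"
  proof (rule card_image_le_fibres[OF finZ])
    fix y assume y: "y \<in> Z"
    have "cell ?n ` {x \<in> Z. cell (j * q) x = cell (j * q) y} \<subseteq> strip 3 \<theta> q (cell ?n ` F) (cell ?n y)"
    proof
      fix R assume "R \<in> cell ?n ` {x \<in> Z. cell (j * q) x = cell (j * q) y}"
      then obtain x where x: "x \<in> Z" "cell (j * q) x = cell (j * q) y" "R = cell ?n x" by blast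
      have "(2::real) ^ ?n \<le> 2 ^ (N * q)" using Suc.prems by (intro power_increasing mult_right_mono) auto
      then have "2 ^ ?n * \<bar>(\<theta> * x $ 1 + x $ 2) - (\<theta> * y $ 1 + y $ 2)\<bar> \<le> 1"
        using near[OF x(1) y] by (meson abs_ge_zero mult_right_mono order.trans)
      then have "cell ?n x \<in> strip 3 \<theta> q (cell ?n ` F) (cell ?n y)"
        using x Z(1) \<theta> by (intro cell_in_strip) auto
      then show "R \<in> strip 3 \<theta> q (cell ?n ` F) (cell ?n y)" using x by simp
    qed
    then have "card (cell ?n ` {x \<in> Z. cell (j * q) x = cell (j * q) y}) \<le> card (strip 3 \<theta> q (cell ?n ` F) (cell ?n y))"
      using fin[of "Suc j"] Suc.prems by (intro card_mono finite_strip) auto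
    also have "real \<dots> \<le> K"
      using Z(2)[OF y, of "Suc j"] Suc.prems by (simp add: tame_def K_def)
    finally show "real (card (cell ?n ` {x \<in> Z. cell (j * q) x = cell (j * q) y})) \<le> K" by simp
  qed
  also have "\<dots> \<le> real (card (cell 0 ` F)) * K ^ j * K"
    using Suc by (intro mult_right_mono) (auto simp: K_def)
  finally show ?case by (simp add: mult_ac)
qed

text \<open>Cover by squares of level N q, of which there are at most K^N per square of level 0.
  Since max (s - 1) 0 - s = - min s 1, the part over an interval of length r = 2^(-N q) has content
  of order r^(min s 1 - 4 g), the same form as a term in a cover of the projection.\<close>

lemma hausdorff_content_tame_fibre_le:
  fixes F :: "(real^2) set"
  assumes s: "0 < s" and \<theta>: "0 \<le> \<theta>" "\<theta> \<le> 1"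
    and fin0: "finite (cell 0 ` F)" and fin: "\<And>j. 1 \<le> j \<Longrightarrow> j \<le> N \<Longrightarrow> finite (cell (j * q) ` F)"
    and Z: "Z \<subseteq> F" "\<And>x j. x \<in> Z \<Longrightarrow> 1 \<le> j \<Longrightarrow> j \<le> N \<Longrightarrow> x \<in> tame s g \<theta> F (j * q) q"
    and near: "\<And>x y. x \<in> Z \<Longrightarrow> y \<in> Z \<Longrightarrow>
      2 ^ (N * q) * \<bar>(\<theta> * x $ 1 + x $ 2) - (\<theta> * y $ 1 + y $ 2)\<bar> \<le> 1"
  shows "hausdorff_content s Z \<le>
    ennreal (real (card (cell 0 ` F)) * 2 powr s * 2 powr (- (min s 1 - 4 * g) * real (N * q)))"
proof -
  define K where "K = 2 powr ((max (s - 1) 0 + 4 * g) * real q)"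
  have finZ: "finite (cell (N * q) ` Z)"
    using fin0 fin[of N] by (intro finite_subset[OF image_mono[OF Z(1)]]) (cases N; simp)
  have "hausdorff_content s Z \<le> ennreal (real (card (cell (N * q) ` Z)) * (2 / 2 ^ (N * q)) powr s)"
    by (rule hausdorff_content_cells[OF s finZ]) auto
  also have "\<dots> \<le> ennreal ((real (card (cell 0 ` F)) * K ^ N) * (2 / 2 ^ (N * q)) powr s)"
    unfolding K_def
    by (intro ennreal_leI mult_right_mono card_cells_tame_fibre_le[OF \<theta> fin0 fin Z near]) auto
  also have "(real (card (cell 0 ` F)) * K ^ N) * (2 / 2 ^ (N * q)) powr s =
      real (card (cell 0 ` F)) * 2 powr s * (K ^ N * 2 powr (- s * real (N * q)))"
    unfolding two_div_power_powr by simp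
  also have "K ^ N = 2 powr ((max (s - 1) 0 + 4 * g) * real (N * q))"
    unfolding K_def by (simp add: powr_powr mult_ac flip: powr_realpow)
  also have "2 powr ((max (s - 1) 0 + 4 * g) * real (N * q)) * 2 powr (- s * real (N * q)) =
      2 powr (- (min s 1 - 4 * g) * real (N * q))"
  proof -
    have "max (s - 1) 0 + 4 * g + - s = - (min s 1 - 4 * g)" by (simp add: min_def max_def)
    then show ?thesis by (metis powr_add distrib_right)
  qed
  finally show ?thesis .
qed

section \<open>Lifting covers of the projection\<close>

lemma summable_linear_times_powr:
  fixes c :: real
  assumes "0 < c"
  shows "summable (\<lambda>n. (a * (real n + 1) + b) * 2 powr (- c * real n))"
proof -
  define x where "x = 2 powr (- c)"
  have x: "0 < x" "x < 1" using assms by (auto simp: x_def powr_less_one)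
  have eq: "2 powr (- c * real n) = x ^ n" for n by (simp add: x_def powr_powr flip: powr_realpow)
  have "summable (\<lambda>n. of_nat (Suc n) * x ^ n)"
    using geometric_deriv_sums[of x] x by (intro sums_summable) auto
  then have "summable (\<lambda>n. a * (of_nat (Suc n) * x ^ n) + b * x ^ n)"
    using x by (intro summable_add summable_mult summable_geometric) auto
  then show ?thesis unfolding eq by (simp add: algebra_simps)
qed

text \<open>Points that are wild at some usable q beyond a threshold have small content, because the
  bounds are summable in q. Over a covering set of size about 2^(-R) choose N q within M of R; the
  remaining points over it have content at most a constant times the term of the cover. The
  threshold is fixed before the cover, which is then taken so fine that no smaller q occurs.\<close>

lemma hausdorff_content_eq_0_if_projection_null:
  fixes F :: "(real^2) set" and G :: "nat set" and M :: nat
  assumes fin: "\<And>n. n0 \<le> n \<Longrightarrow> finite (cell n ` F)"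
    and card: "\<And>n. n0 \<le> n \<Longrightarrow> real (card (cell n ` F)) \<le> C * 2 powr (t * real n)"
    and C: "0 < C" and s: "0 < s" "s \<le> t" and g: "0 < g" and ts: "(t - s) * real M \<le> g / 2"
    and \<theta>: "0 \<le> \<theta>" "\<theta> \<le> 1"
    and good: "\<And>q j. q \<in> G \<Longrightarrow> q1 \<le> q \<Longrightarrow> 1 \<le> j \<Longrightarrow> j \<le> M \<Longrightarrow>
      spread_direction 3 s g q (cell (j * q) ` F) \<theta>"
    and scales: "\<And>R. R0 \<le> R \<Longrightarrow> \<exists>N q. 1 \<le> N \<and> N \<le> M \<and> q \<in> G \<and> N * q \<le> R \<and> R \<le> N * q + M"
    and u: "u = min s 1 - 4 * g" "0 < u"
    and null: "hausdorff_content u ((\<lambda>x. \<theta> * x $ 1 + x $ 2) ` F) = 0"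
  shows "hausdorff_content s F = 0"
proof (rule hausdorff_content_eq_0I)
  fix e' :: real assume e': "0 < e'"
  define e where "e = e' / 2"
  have e: "0 < e" using e' by (simp add: e_def)
  have fin0: "finite (cell 0 ` F)"
  proof -
    have "cell 0 ` F = coarse n0 ` cell n0 ` F" by (simp add: image_image coarse_cell)
    then show ?thesis using fin[of n0] by simp
  qed
  define f where "f q = 2 powr s * C * (9 * (real q + 1) + 1) * 2 powr (- g * real q / 2)" for q
  have f0: "0 \<le> f q" for q using C by (simp add: f_def)
  have "summable (\<lambda>q. 2 powr s * C * real M * ((9 * (real q + 1) + 1) * 2 powr (- (g / 2) * real q)))"
    using g by (intro summable_mult summable_linear_times_powr) simp
  also have "(\<lambda>q. 2 powr s * C * real M * ((9 * (real q + 1) + 1) * 2 powr (- (g / 2) * real q))) = (\<lambda>q. real M * f q)"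
    by (simp add: f_def fun_eq_iff)
  finally have sumf: "summable (\<lambda>q. real M * f q)" .
  then obtain q3 where q3: "\<And>n. q3 \<le> n \<Longrightarrow> norm (\<Sum>i. real M * f (i + n)) < e"
    using suminf_exist_split[OF e] by blast
  \<comment> \<open>Beyond \<open>q2\<close> the slope is good, the counts hold, and the tail of
    discarded content is below \<open>e\<close>.\<close>
  define q2 where "q2 = Max {q1, n0, q3}"
  have q2: "q1 \<le> q2" "n0 \<le> q2" "q3 \<le> q2" by (auto simp: q2_def)
  define X where "X q = (if q \<in> G then (\<Union>j\<in>{1..M}. F - tame s g \<theta> F (j * q) q) else {})" for q
  have X: "hausdorff_content s (X q) \<le> ennreal (real M * f q)" if q: "q2 \<le> q" for q
  proof (cases "q \<in> G")
    case True
    have "hausdorff_content s (X q) \<le> (\<Sum>j\<in>{1..M}. hausdorff_content s (F - tame s g \<theta> F (j * q) q))"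
      using True unfolding X_def by (simp only: if_True) (rule hausdorff_content_finite_UN_le, simp)
    also have "\<dots> \<le> (\<Sum>j\<in>{1..M}. ennreal (f q))"
    proof (rule sum_mono)
      fix j assume j: "j \<in> {1..M}"
      then have jq: "q \<le> j * q" by simp
      then have "n0 \<le> j * q" using q q2 by linarith
      moreover have "(t - s) * real (j * q) \<le> g * real q / 2"
      proof -
        have "(t - s) * real j \<le> (t - s) * real M" using s j by (intro mult_left_mono) auto
        then have "(t - s) * real j \<le> g / 2" using ts by linarith
        then have "(t - s) * real j * real q \<le> g / 2 * real q" by (intro mult_right_mono) auto
        then show ?thesis by (simp add: mult.assoc)
      qed
      moreover have "spread_direction 3 s g q (cell (j * q) ` F) \<theta>"
        using good[OF True, of j] q q2 j by auto
      ultimately show "hausdorff_content s (F - tame s g \<theta> F (j * q) q) \<le> ennreal (f q)"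
        unfolding f_def using jq C s by (intro hausdorff_content_wild_le[where t = t] fin card) auto
    qed
    also have "\<dots> = ennreal (real M * f q)"
      using f0 by (simp add: ennreal_mult'' ennreal_of_nat_eq_real_of_nat)
    finally show ?thesis .
  qed (simp add: X_def)
  define XX where "XX = (\<Union>i. X (i + q2))"
  have XX: "hausdorff_content s XX \<le> ennreal e"
  proof -
    have sf: "summable (\<lambda>i. real M * f (i + q2))" using sumf by (simp add: summable_iff_shift)
    have "hausdorff_content s XX \<le> (\<Sum>i. hausdorff_content s (X (i + q2)))"
      unfolding XX_def by (rule hausdorff_content_UN_le)
    also have "\<dots> \<le> (\<Sum>i. ennreal (real M * f (i + q2)))" by (intro suminf_le X) auto
    also have "\<dots> = ennreal (\<Sum>i. real M * f (i + q2))" using f0 sf by (intro suminf_ennreal2) auto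
    also have "\<dots> \<le> ennreal e" using q3[OF q2(3)] by (intro ennreal_leI) auto
    finally show ?thesis .
  qed
  \<comment> \<open>The exponent has M for the distance from R to N q and 1 for rounding the
    logarithm of the size. The final 1 keeps K positive when F is empty.\<close>
  define K where "K = real (card (cell 0 ` F)) * 2 powr s * 2 powr (u * (real M + 1)) + 1"
  have K: "0 < K" by (simp add: K_def add_nonneg_pos)
  \<comment> \<open>With q < q2 one would have R <= M (q2 - 1) + M < R1, so R >= R1 forces q >=
    q2.\<close>
  define R1 where "R1 = max R0 (M * q2 + M)"
  \<comment> \<open>The first bound makes the lifted sum at most \<open>e\<close>; the second makes
    every covering set smaller than 2^(-R1).\<close>
  define e2 where "e2 = min (e / K) (2 powr (- u * real R1))"
  have e2: "0 < e2" using e K by (simp add: e2_def)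
  obtain U where U: "(\<lambda>x. \<theta> * x $ 1 + x $ 2) ` F \<subseteq> (\<Union>k. U k)" "\<And>k::nat. bounded (U k)"
    "(\<Sum>k. ennreal (diameter (U k) powr u)) < ennreal (e2 / 2)"
    by (rule hausdorff_content_less_cover[of u _ "ennreal (e2 / 2)"]) (use null e2 in auto)
  \<comment> \<open>The geometric term gives a positive size, and hence a level R, even to covering
    sets of diameter 0.\<close>
  define w where "w k = diameter (U k) powr u + e2 / 2 * (1 / 2) ^ Suc k" for k
  have w0: "0 < w k" for k using e2 by (simp add: w_def add_nonneg_pos)
  have sumw: "(\<Sum>k. ennreal (w k)) \<le> ennreal e2"
  proof -
    have "(\<Sum>k. ennreal (w k)) = (\<Sum>k. ennreal (diameter (U k) powr u) + ennreal (e2 / 2 * (1 / 2) ^ Suc k))"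
      using e2 by (intro suminf_cong) (simp add: w_def ennreal_plus del: power_Suc)
    also have "\<dots> = (\<Sum>k. ennreal (diameter (U k) powr u)) + (\<Sum>k. ennreal (e2 / 2 * (1 / 2) ^ Suc k))"
      by (intro suminf_add[symmetric]) auto
    also have "(\<Sum>k. ennreal (e2 / 2 * (1 / 2) ^ Suc k)) = ennreal (e2 / 2)"
      using e2 by (intro ennreal_suminf_geometric_half) simp
    also have "(\<Sum>k. ennreal (diameter (U k) powr u)) + ennreal (e2 / 2) \<le> ennreal (e2 / 2) + ennreal (e2 / 2)"
      using U(3) by (intro add_right_mono) simp
    also have "\<dots> = ennreal e2" using e2 by (simp flip: ennreal_plus)
    finally show ?thesis .
  qed
  define Z where "Z k = {x \<in> F - XX. \<theta> * x $ 1 + x $ 2 \<in> U k}" for k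
  have Z: "hausdorff_content s (Z k) \<le> ennreal (K * w k)" for k
  proof -
    define d where "d = w k powr (1 / u)"
    have d0: "0 < d" using w0[of k] by (simp add: d_def)
    have du: "d powr u = w k" using w0[of k] u(2) by (simp add: d_def powr_powr)
    have "ennreal (w k) \<le> ennreal e2"
      using sum_le_suminf[OF summableI, of "{k}" "\<lambda>k. ennreal (w k)"] sumw by simp
    then have "w k \<le> e2" using e2 by simp
    then have "d powr u \<le> (2 powr (- real R1)) powr u"
      by (simp add: du e2_def powr_powr mult.commute)
    then have dR1: "d \<le> 2 powr (- real R1)"
      using u(2) powr_less_mono2[of u "2 powr (- real R1)" d] by force
    then have "log 2 d \<le> log 2 (2 powr (- real R1))" using d0 by (subst log_le_cancel_iff) auto
    then have lR1: "real R1 \<le> - log 2 d" by simp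
    define R where "R = nat \<lfloor>- log 2 d\<rfloor>"
    have "R1 \<le> R" using lR1 by (simp add: R_def le_nat_floor)
    have R: "real R \<le> - log 2 d" "- log 2 d < real R + 1" using lR1 unfolding R_def by linarith+
    have dR: "d \<le> 2 powr (- real R)" "2 powr (- real R - 1) \<le> d"
      using R d0 powr_log_cancel[of 2 d] powr_mono[of "log 2 d" "- real R" 2] powr_mono[of "- real R - 1" "log 2 d" 2] by auto
    obtain N q where Nq: "1 \<le> N" "N \<le> M" "q \<in> G" "N * q \<le> R" "R \<le> N * q + M"
      using scales[of R] \<open>R1 \<le> R\<close> by (auto simp: R1_def)
    have qq: "q2 \<le> q"
    proof (rule ccontr)
      assume "\<not> q2 \<le> q"
      then have "N * q \<le> M * (q2 - 1)" using Nq by (intro mult_mono) auto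
      also have "\<dots> < M * q2" using Nq \<open>\<not> q2 \<le> q\<close> by simp
      finally show False using Nq \<open>R1 \<le> R\<close> by (simp add: R1_def)
    qed
    have nr: "n0 \<le> j * q" if "1 \<le> j" for j
    proof -
      have "1 * q \<le> j * q" using that by (intro mult_right_mono) auto
      then show ?thesis using qq q2 by linarith
    qed
    have "hausdorff_content s (Z k) \<le>
        ennreal (real (card (cell 0 ` F)) * 2 powr s * 2 powr (- (min s 1 - 4 * g) * real (N * q)))"
    proof (rule hausdorff_content_tame_fibre_le[OF s(1) \<theta> fin0])
      show "finite (cell (j * q) ` F)" if "1 \<le> j" for j using that by (intro fin nr)
      show "Z k \<subseteq> F" by (auto simp: Z_def)
      show "x \<in> tame s g \<theta> F (j * q) q" if "x \<in> Z k" "1 \<le> j" "j \<le> N" for x j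
      proof -
        have "x \<notin> X q" using that(1) le_add_diff_inverse2[OF qq] by (auto simp: Z_def XX_def) metis
        then show ?thesis using that Nq by (auto simp: X_def Z_def)
      qed
      show "2 ^ (N * q) * \<bar>(\<theta> * x $ 1 + x $ 2) - (\<theta> * y $ 1 + y $ 2)\<bar> \<le> 1" if "x \<in> Z k" "y \<in> Z k" for x y
      proof -
        have "\<bar>(\<theta> * x $ 1 + x $ 2) - (\<theta> * y $ 1 + y $ 2)\<bar> \<le> diameter (U k)"
          using that diameter_bounded_bound[OF U(2), of "\<theta> * x $ 1 + x $ 2" k "\<theta> * y $ 1 + y $ 2"]
          by (simp add: Z_def dist_real_def)
        also have "\<dots> \<le> d"
        proof -
          have "diameter (U k) powr u \<le> d powr u" using e2 unfolding du w_def by simp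
          then show ?thesis using u d0 powr_less_mono2[of u d "diameter (U k)"] by linarith
        qed
        also have "\<dots> \<le> 2 powr (- real (N * q))"
          using Nq(4) by (intro order.trans[OF dR(1)]) (simp flip: of_nat_mult)
        also have "\<dots> = 1 / 2 ^ (N * q)"
          using powr_realpow[of 2 "N * q"] by (simp only: powr_minus_divide)
        finally show ?thesis by (simp add: pos_le_divide_eq mult.commute)
      qed
    qed
    also have "\<dots> \<le> ennreal (K * w k)"
    proof (intro ennreal_leI)
      have "2 powr (- (min s 1 - 4 * g) * real (N * q)) \<le> 2 powr (u * (real M + 1) + u * (- real R - 1))"
      proof -
        have "u * real R \<le> u * (real (N * q) + real M)" using Nq(5) u(2)
          by (intro mult_left_mono) (simp_all del: of_nat_mult of_nat_add flip: of_nat_add)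
        then show ?thesis unfolding u(1)[symmetric] by (simp add: algebra_simps)
      qed
      also have "\<dots> = 2 powr (u * (real M + 1)) * (2 powr (- real R - 1)) powr u"
        by (simp add: powr_add powr_powr mult.commute)
      also have "\<dots> \<le> 2 powr (u * (real M + 1)) * d powr u"
        using u by (intro mult_left_mono powr_mono2 dR) auto
      finally have "real (card (cell 0 ` F)) * 2 powr s * 2 powr (- (min s 1 - 4 * g) * real (N * q)) \<le>
          real (card (cell 0 ` F)) * 2 powr s * (2 powr (u * (real M + 1)) * d powr u)"
        by (intro mult_left_mono) auto
      also have "\<dots> \<le> K * w k" unfolding K_def du using w0[of k] by (simp add: algebra_simps)
      finally show "real (card (cell 0 ` F)) * 2 powr s * 2 powr (- (min s 1 - 4 * g) * real (N * q)) \<le> K * w k" .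
    qed
    finally show ?thesis .
  qed
  have "F \<subseteq> XX \<union> (\<Union>k. Z k)" using U(1) by (auto simp: Z_def)
  then have "hausdorff_content s F \<le> hausdorff_content s (XX \<union> (\<Union>k. Z k))" by (rule hausdorff_content_mono)
  also have "\<dots> \<le> hausdorff_content s XX + hausdorff_content s (\<Union>k. Z k)" by (rule hausdorff_content_Un_le)
  also have "\<dots> \<le> ennreal e + (\<Sum>k. hausdorff_content s (Z k))"
    by (intro add_mono XX hausdorff_content_UN_le)
  also have "\<dots> \<le> ennreal e + (\<Sum>k. ennreal K * ennreal (w k))"
    using Z K w0 by (intro add_left_mono suminf_le) (auto simp: ennreal_mult less_imp_le)
  also have "\<dots> = ennreal e + ennreal K * (\<Sum>k. ennreal (w k))" by simp
  also have "\<dots> \<le> ennreal e + ennreal K * ennreal (e / K)"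
    using K by (intro add_left_mono mult_left_mono order.trans[OF sumw]) (auto simp: e2_def intro!: ennreal_leI)
  also have "\<dots> = ennreal e'" using K e by (simp add: ennreal_mult[symmetric] e_def flip: ennreal_plus)
  finally show "hausdorff_content s F \<le> ennreal e'" .
qed

section \<open>Selection of a slope\<close>

text \<open>The ratio \<epsilon> of block start to block end becomes the lower box dimension. The 2
  makes 2^(-gap) at most a quarter of 2^(-depth), which separates clusters of slopes later, and
  gives gap >= 2, so that the squares in \<open>depth\<close> increase.\<close>

definition gap_after :: "real \<Rightarrow> nat \<Rightarrow> nat" where
  "gap_after \<epsilon> m = nat \<lceil>real m / \<epsilon>\<rceil> + 2"

text \<open>Squaring makes gap k negligible against the next depth: a free block holds all but a
  fraction 1 / gap k of the digits up to its end, so almost no count is lost there, and most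
  precisions q in it satisfy gap k <= g q.\<close>

primrec depth :: "real \<Rightarrow> nat \<Rightarrow> nat" where
  "depth \<epsilon> 0 = 1"
| "depth \<epsilon> (Suc k) = (gap_after \<epsilon> (depth \<epsilon> k))\<^sup>2"

definition gap :: "real \<Rightarrow> nat \<Rightarrow> nat" where
  "gap \<epsilon> k = gap_after \<epsilon> (depth \<epsilon> k)"

text \<open>The binary digits of a slope vanish between positions depth k and gap k, and are free between gap k and depth (k + 1) = (gap k)^2. The vanishing block is encoded by the distance to a multiple of 2^(-depth k).\<close>

definition slopes :: "real \<Rightarrow> real set" where
  "slopes \<epsilon> = {\<theta>. 0 \<le> \<theta> \<and> \<theta> \<le> 1 \<and>
     (\<forall>k. \<exists>z::nat. z / 2 ^ depth \<epsilon> k \<le> \<theta> \<and> \<theta> \<le> z / 2 ^ depth \<epsilon> k + 1 / 2 ^ gap \<epsilon> k)}"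

lemma depth_Suc_eq_gap_sq: "depth \<epsilon> (Suc k) = (gap \<epsilon> k)\<^sup>2"
  by (simp add: gap_def)

lemma gap_le: "0 < \<epsilon> \<Longrightarrow> real (gap \<epsilon> k) \<le> real (depth \<epsilon> k) / \<epsilon> + 3"
  using zero_le_divide_iff[of "real (depth \<epsilon> k)" \<epsilon>] unfolding gap_def gap_after_def by simp linarith

lemma gap_ge: "0 < \<epsilon> \<Longrightarrow> real (depth \<epsilon> k) / \<epsilon> + 2 \<le> real (gap \<epsilon> k)"
  using zero_le_divide_iff[of "real (depth \<epsilon> k)" \<epsilon>] unfolding gap_def gap_after_def by simp

lemma depth_less_gap:
  assumes "0 < \<epsilon>" "\<epsilon> < 1"
  shows "depth \<epsilon> k + 2 \<le> gap \<epsilon> k"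
proof -
  have "real (depth \<epsilon> k) * \<epsilon> \<le> real (depth \<epsilon> k) * 1" using assms by (intro mult_left_mono) auto
  then have "real (depth \<epsilon> k) \<le> real (depth \<epsilon> k) / \<epsilon>" using assms by (simp add: field_simps)
  then show ?thesis using gap_ge[OF assms(1), of k] by linarith
qed

lemma gap_less_depth_Suc:
  assumes "0 < \<epsilon>" "\<epsilon> < 1"
  shows "gap \<epsilon> k + 2 \<le> depth \<epsilon> (Suc k)"
proof -
  have g: "2 \<le> gap \<epsilon> k" using depth_less_gap[OF assms, of k] by linarith
  have "2 * gap \<epsilon> k \<le> gap \<epsilon> k * gap \<epsilon> k" using g by (intro mult_right_mono) auto
  then show ?thesis using g unfolding depth_Suc_eq_gap_sq power2_eq_square by linarith
qed

lemma less_depth: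
  assumes "0 < \<epsilon>" "\<epsilon> < 1"
  shows "k < depth \<epsilon> k"
proof (induction k)
  case (Suc k)
  then show ?case using depth_less_gap[OF assms, of k] gap_less_depth_Suc[OF assms, of k] by linarith
qed simp

lemma less_gap: "0 < \<epsilon> \<Longrightarrow> \<epsilon> < 1 \<Longrightarrow> k < gap \<epsilon> k"
  using less_depth[of \<epsilon> k] depth_less_gap[of \<epsilon> k] by linarith

lemma gap_mono:
  assumes "0 < \<epsilon>" "\<epsilon> < 1"
  shows "mono (gap \<epsilon>)"
  unfolding mono_iff_le_Suc
  using gap_less_depth_Suc[OF assms] depth_less_gap[OF assms] by (meson add_leE order.trans)

text \<open>A precision q is usable if it lies in a free block and the preceding vanishing block is short compared to q; a scale in a long vanishing block is reached as a multiple of q in the preceding free block.\<close>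

lemma exists_multiple_of_usable_scale:
  assumes \<epsilon>: "0 < \<epsilon>" "\<epsilon> < 1" and g: "0 < g" and M: "(1 / \<epsilon> + 3) / g + 1 \<le> real M"
  shows "\<exists>R0. \<forall>R\<ge>R0. \<exists>N q. 1 \<le> N \<and> N \<le> M \<and> q \<in> {q. \<exists>k. real (gap \<epsilon> k) \<le> g * real q \<and> q \<le> depth \<epsilon> (Suc k)}
    \<and> N * q \<le> R \<and> R \<le> N * q + M"
proof -
  have M1: "1 \<le> real M" using M \<epsilon> g by (smt (verit) divide_nonneg_nonneg)
  \<comment> \<open>R large puts k beyond \<open>k1\<close>, so that G = gap k has g G >= 4; then q
    >= G^2 / 4 yields g q >= G.\<close>
  define k1 where "k1 = nat \<lceil>4 / g\<rceil>"
  have k1: "4 / g \<le> real k1" by (simp add: k1_def of_nat_ceiling)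
  define R0 where "R0 = nat \<lceil>real (gap \<epsilon> k1) / g\<rceil>"
  have R0: "real (gap \<epsilon> k1) \<le> g * real R0"
  proof -
    have "real (gap \<epsilon> k1) / g \<le> real R0" by (simp add: R0_def of_nat_ceiling)
    then show ?thesis using g by (simp add: pos_divide_le_eq mult.commute)
  qed
  have "\<exists>N q. 1 \<le> N \<and> N \<le> M \<and> (\<exists>k. real (gap \<epsilon> k) \<le> g * real q \<and> q \<le> depth \<epsilon> (Suc k))
    \<and> N * q \<le> R \<and> R \<le> N * q + M" if R: "R0 \<le> R" for R
  proof -
    have gR: "real (gap \<epsilon> k1) \<le> g * real R"
      using R0 R g by (meson less_imp_le mult_left_mono of_nat_le_iff order.trans)
    define k where "k = (GREATEST k. real (gap \<epsilon> k) \<le> g * real R)"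
    have bound: "k' \<le> nat \<lceil>g * real R\<rceil>" if "real (gap \<epsilon> k') \<le> g * real R" for k'
    proof -
      have "real k' \<le> g * real R" using that less_gap[OF \<epsilon>, of k'] by linarith
      then show ?thesis by linarith
    qed
    have k: "real (gap \<epsilon> k) \<le> g * real R" unfolding k_def by (rule GreatestI_nat[where P = "\<lambda>k. real (gap \<epsilon> k) \<le> g * real R", OF gR bound])
    have "k1 \<le> k" unfolding k_def by (rule Greatest_le_nat[where P = "\<lambda>k. real (gap \<epsilon> k) \<le> g * real R", OF gR bound])
    have "\<not> real (gap \<epsilon> (Suc k)) \<le> g * real R"
    proof
      assume "real (gap \<epsilon> (Suc k)) \<le> g * real R"
      then have "Suc k \<le> k" unfolding k_def by (rule Greatest_le_nat[where P = "\<lambda>k. real (gap \<epsilon> k) \<le> g * real R", OF _ bound])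
      then show False by simp
    qed
    then have gk: "g * real R < real (gap \<epsilon> (Suc k))" by simp
    define m where "m = depth \<epsilon> (Suc k)"
    show ?thesis
    proof (cases "R \<le> m")
      case True
      then show ?thesis using k M1 by (intro exI[of _ 1] exI[of _ R]) (auto simp: m_def)
    next
      case False
      have m0: "0 < m" using less_depth[OF \<epsilon>, of "Suc k"] unfolding m_def by linarith
      \<comment> \<open>Enough steps that each has length at most m, and no more, so q is still at
        least about m / 2. N is bounded because R is less than gap (k + 1) / g, while the gap is
        comparable to m / \<epsilon>.\<close>
      define N where "N = R div m + 1"
      define q where "q = R div N"
      have "R < N * m" unfolding N_def using m0 by (metis Suc_eq_plus1 dividend_less_times_div mult.commute mult_Suc_right)
      then have qm: "q \<le> m" unfolding q_def by (simp add: less_mult_imp_div_less less_imp_le mult.commute)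
      have Nr: "real N \<le> real R / real m + 1" unfolding N_def using of_nat_div_le_of_nat[of R m] by simp
      have "g * real R \<le> real m / \<epsilon> + 3" using gk gap_le[OF \<epsilon>(1), of "Suc k"] unfolding m_def by linarith
      also have "\<dots> \<le> real m * (1 / \<epsilon> + 3)" using m0 by (simp add: distrib_left)
      finally have "real R / real m \<le> (1 / \<epsilon> + 3) / g" using g m0 by (simp add: pos_divide_le_eq pos_le_divide_eq mult_ac)
      then have NM: "N \<le> M" using Nr M by linarith
      have Rq: "R = N * q + R mod N" by (simp add: q_def)
      have "R mod N < N" by (simp add: N_def)
      then have R2: "N * q \<le> R" "R \<le> N * q + M" using Rq NM by linarith+
      have "real (gap \<epsilon> k) \<le> g * real q"
      proof -
        define G where "G = real (gap \<epsilon> k)"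
        have mG: "real m = G\<^sup>2" by (simp only: m_def depth_Suc_eq_gap_sq G_def of_nat_power)
        have G: "4 / g \<le> G" "2 \<le> G"
          using k1 \<open>k1 \<le> k\<close> less_gap[OF \<epsilon>, of k] depth_less_gap[OF \<epsilon>, of k] by (simp_all add: G_def)
        have "real N * real m \<le> real R + real m"
          using Nr m0 by (simp add: field_simps)
        also have "\<dots> \<le> 2 * real R" using False by simp
        finally have NR: "real N * real m \<le> 2 * real R" .
        have N0: "0 < real N" by (simp add: N_def)
        have "R < N * q + N" using Rq \<open>R mod N < N\<close> by linarith
        then have "real R < real (N * q + N)" by (simp only: of_nat_less_iff)
        then have "real N * real m < 2 * (real N * (real q + 1))" using NR by (simp add: algebra_simps)
        then have "real N * real m < real N * (2 * (real q + 1))" by (simp add: algebra_simps)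
        then have "real m < 2 * (real q + 1)" using N0 by (simp only: mult_less_cancel_left_pos)
        then have q: "G\<^sup>2 / 2 - 1 < real q" using mG by simp
        have "4 \<le> G\<^sup>2" using power_mono[OF G(2), of 2] by simp
        then have "G\<^sup>2 / 4 \<le> real q" using q by linarith
        then have "g * (G\<^sup>2 / 4) \<le> g * real q" using g by simp
        moreover have "4 \<le> g * G" using G(1) g by (simp add: pos_divide_le_eq mult.commute)
        then have "4 * G \<le> g * G * G" using G(2) by (intro mult_right_mono) auto
        ultimately show ?thesis by (simp add: G_def power2_eq_square)
      qed
      then show ?thesis using qm NM R2 unfolding m_def by (intro exI[of _ N] exI[of _ q]) (auto simp: N_def)
    qed
  qed
  then show ?thesis by auto
qed

text \<open>\<open>x k\<close> fixes the digits up to depth k, and \<open>step\<close> chooses those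
  of the next free block. The intervals from x k to x k + 2^(-gap k) are nested and \<theta> is a
  common point. P is obtained only at the left endpoints; its transfer to \<theta> is left to a
  perturbation argument.\<close>

lemma nested_slope_selection:
  assumes \<epsilon>: "0 < \<epsilon>" "\<epsilon> < 1"
    and step: "\<And>k \<theta>. 0 \<le> \<theta> \<Longrightarrow> \<theta> + 1 / 2 ^ gap \<epsilon> k \<le> 1 \<Longrightarrow>
      \<exists>a<2 ^ (depth \<epsilon> (Suc k) - gap \<epsilon> k). P k (\<theta> + real a / 2 ^ depth \<epsilon> (Suc k))"
  obtains \<theta> x where "\<theta> \<in> slopes \<epsilon>" "\<And>k. P k (x (Suc k))"
    "\<And>k. x k \<le> \<theta>" "\<And>k. \<theta> \<le> x k + 1 / 2 ^ gap \<epsilon> k"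
proof -
  define c where "c k \<theta> = (SOME a. a < (2::nat) ^ (depth \<epsilon> (Suc k) - gap \<epsilon> k) \<and>
      P k (\<theta> + real a / 2 ^ depth \<epsilon> (Suc k)))" for k \<theta>
  have c: "c k \<theta> < (2::nat) ^ (depth \<epsilon> (Suc k) - gap \<epsilon> k) \<and> P k (\<theta> + real (c k \<theta>) / 2 ^ depth \<epsilon> (Suc k))"
    if "0 \<le> \<theta>" "\<theta> + 1 / 2 ^ gap \<epsilon> k \<le> 1" for k \<theta>
    unfolding c_def by (rule someI_ex) (rule step[OF that])
  define x where "x = rec_nat (0::real) (\<lambda>k \<theta>. \<theta> + real (c k \<theta>) / 2 ^ depth \<epsilon> (Suc k))"
  have x0: "x 0 = 0" and xS: "x (Suc k) = x k + real (c k (x k)) / 2 ^ depth \<epsilon> (Suc k)" for k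
    by (simp_all add: x_def)
  let ?hi = "\<lambda>k. x k + 1 / 2 ^ gap \<epsilon> k"
  \<comment> \<open>The chosen digits have value at most 2^(depth (k + 1) - gap k) - 1, and the next
    interval is no longer than 2^(-depth (k + 1)), so it still fits.\<close>
  have shrink: "?hi (Suc k) \<le> ?hi k" if "0 \<le> x k" "?hi k \<le> 1" for k
  proof -
    let ?f = "depth \<epsilon> (Suc k)"
    have le: "gap \<epsilon> k \<le> ?f" "?f \<le> gap \<epsilon> (Suc k)"
      using gap_less_depth_Suc[OF \<epsilon>, of k] depth_less_gap[OF \<epsilon>, of "Suc k"] by linarith+
    have "c k (x k) + 1 \<le> 2 ^ (?f - gap \<epsilon> k)" using c[OF that] by simp
    then have "real (c k (x k) + 1) \<le> real (2 ^ (?f - gap \<epsilon> k))" by (simp only: of_nat_le_iff)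
    then have "real (c k (x k)) + 1 \<le> 2 ^ (?f - gap \<epsilon> k)" by simp
    then have "(real (c k (x k)) + 1) / 2 ^ ?f \<le> 2 ^ (?f - gap \<epsilon> k) / 2 ^ ?f"
      by (intro divide_right_mono) auto
    also have "\<dots> = 1 / 2 ^ gap \<epsilon> k" using le by (simp add: power_diff)
    finally have "real (c k (x k)) / 2 ^ ?f + 1 / 2 ^ ?f \<le> 1 / 2 ^ gap \<epsilon> k" by (simp add: add_divide_distrib)
    moreover have "(1::real) / 2 ^ gap \<epsilon> (Suc k) \<le> 1 / 2 ^ ?f"
      using le by (intro divide_left_mono power_increasing) auto
    ultimately show ?thesis unfolding xS by linarith
  qed
  have inv: "0 \<le> x k \<and> ?hi k \<le> 1" for k
  proof (induction k)
    case 0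
    show ?case by (simp add: x0)
  next
    case (Suc k)
    then show ?case using shrink[of k] xS[of k] by auto
  qed
  have incx: "incseq x" by (rule incseq_SucI) (simp add: xS)
  have dech: "decseq ?hi" by (rule decseq_SucI) (use shrink inv in blast)
  have cross: "x j \<le> ?hi k" for j k
  proof -
    have "x j \<le> x (max j k)" using incx by (simp add: incseqD)
    also have "\<dots> \<le> ?hi (max j k)" by simp
    also have "\<dots> \<le> ?hi k" using decseqD[OF dech, of k "max j k"] by simp
    finally show ?thesis .
  qed
  define \<theta> where "\<theta> = (SUP k. x k)"
  have lo: "x k \<le> \<theta>" for k
    unfolding \<theta>_def using cross[of _ 0] by (intro cSUP_upper bdd_aboveI2) auto
  have hi: "\<theta> \<le> ?hi k" for k
    unfolding \<theta>_def using cross[of _ k] by (intro cSUP_least) auto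
  have grid: "\<exists>z::nat. x k = z / 2 ^ depth \<epsilon> k" for k
  proof (induction k)
    case 0
    show ?case by (rule exI[of _ 0]) (simp add: x0)
  next
    case (Suc k)
    then obtain z :: nat where z: "x k = z / 2 ^ depth \<epsilon> k" by blast
    have le: "depth \<epsilon> k \<le> depth \<epsilon> (Suc k)"
      using gap_less_depth_Suc[OF \<epsilon>, of k] depth_less_gap[OF \<epsilon>, of k] by linarith
    have "x (Suc k) = real (z * 2 ^ (depth \<epsilon> (Suc k) - depth \<epsilon> k) + c k (x k)) / 2 ^ depth \<epsilon> (Suc k)"
    proof -
      have "real (z * 2 ^ (depth \<epsilon> (Suc k) - depth \<epsilon> k)) = z * (2 ^ depth \<epsilon> (Suc k) / 2 ^ depth \<epsilon> k)"
        using le by (simp add: power_diff_power_eq flip: power_diff del: depth.simps)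
      then show ?thesis unfolding xS by (simp add: z add_divide_distrib del: depth.simps)
    qed
    then show ?case by blast
  qed
  have "\<theta> \<in> slopes \<epsilon>"
    unfolding slopes_def
  proof (intro CollectI conjI allI)
    show "0 \<le> \<theta>" using lo[of 0] by (simp add: x0)
    show "\<theta> \<le> 1" using hi[of 0] inv[of 0] by linarith
    fix k
    obtain z :: nat where "x k = z / 2 ^ depth \<epsilon> k" using grid by blast
    then show "\<exists>z::nat. z / 2 ^ depth \<epsilon> k \<le> \<theta> \<and> \<theta> \<le> z / 2 ^ depth \<epsilon> k + 1 / 2 ^ gap \<epsilon> k"
      using lo[of k] hi[of k] by (intro exI[of _ z]) simp
  qed
  moreover have "P k (x (Suc k))" for k using c[of "x k" k] inv[of k] by (simp only: xS)
  ultimately show ?thesis using that lo hi by blast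
qed

section \<open>Union bound over pieces and scales\<close>

lemma exists_avoiding:
  assumes I: "finite I" and bad: "\<And>i. i \<in> I \<Longrightarrow> real (card {a. a < L \<and> \<not> Q i a}) \<le> real L * c i"
    and c: "(\<Sum>i\<in>I. c i) < 1" and L: "0 < L"
  shows "\<exists>a<L::nat. \<forall>i\<in>I. Q i a"
proof (rule ccontr)
  assume "\<not> ?thesis"
  then have "{..<L} \<subseteq> (\<Union>i\<in>I. {a. a < L \<and> \<not> Q i a})" by auto
  then have "card {..<L} \<le> card (\<Union>i\<in>I. {a. a < L \<and> \<not> Q i a})"
    using I by (intro card_mono) auto
  also have "\<dots> \<le> (\<Sum>i\<in>I. card {a. a < L \<and> \<not> Q i a})" by (rule card_UN_le) fact
  finally have "real L \<le> real (\<Sum>i\<in>I. card {a. a < L \<and> \<not> Q i a})" by (simp only: of_nat_le_iff card_lessThan)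
  also have "\<dots> = (\<Sum>i\<in>I. real (card {a. a < L \<and> \<not> Q i a}))" by simp
  also have "\<dots> \<le> (\<Sum>i\<in>I. real L * c i)" using bad by (intro sum_mono)
  also have "\<dots> = real L * (\<Sum>i\<in>I. c i)" by (simp add: sum_distrib_left)
  also have "\<dots> < real L * 1" using c L by (intro mult_strict_left_mono) auto
  finally show False by simp
qed

text \<open>The proportion of bad choices is summable in q, so for piece p it is at most 2^(-p - 2)
  from a late start \<open>q1 p\<close> on. The total over all pieces is at most 1/2, which leaves a
  good choice in every free block.\<close>

lemma exists_spread_slope:
  fixes F :: "nat \<Rightarrow> (real^2) set" and s g :: "nat \<Rightarrow> real" and M n0 :: "nat \<Rightarrow> nat"
  assumes \<epsilon>: "0 < \<epsilon>" "\<epsilon> < 1" and g: "\<And>p. 0 < g p"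
    and fin: "\<And>p n. n0 p \<le> n \<Longrightarrow> finite (cell n ` F p)"
  obtains \<theta> q1 where "\<theta> \<in> slopes \<epsilon>"
    "\<And>p q j k. q1 p \<le> q \<Longrightarrow> real (gap \<epsilon> k) \<le> g p * real q \<Longrightarrow> q \<le> depth \<epsilon> (Suc k) \<Longrightarrow>
       1 \<le> j \<Longrightarrow> j \<le> M p \<Longrightarrow> spread_direction 3 (s p) (g p) q (cell (j * q) ` F p) \<theta>"
proof -
  define f where "f p q = real (M p) * (35 * (real q + 1) * 2 powr (- g p * real q))" for p q
  have f0: "0 \<le> f p q" for p q by (simp add: f_def)
  have sumf: "summable (f p)" for p
    using summable_mult[OF summable_linear_times_powr[OF g, of 35 0], of "real (M p)"]
    by (simp add: f_def[abs_def])
  have "\<exists>q1. \<forall>m\<ge>q1. norm (\<Sum>i. f p (i + m)) < (1/2) ^ (p + 2)" for p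
    using suminf_exist_split[OF _ sumf[of p], of "(1/2) ^ (p + 2)"] by simp
  then obtain q' where q': "\<And>p m. q' p \<le> m \<Longrightarrow> norm (\<Sum>i. f p (i + m)) < (1/2) ^ (p + 2)" by metis
  \<comment> \<open>Including \<open>p\<close> in the maximum makes p <= q <= depth (k + 1), so each
    block faces only finitely many pieces and the index set \<open>I\<close> is finite.\<close>
  define q1 where "q1 p = Max {q' p, p, n0 p}" for p
  have q1: "q' p \<le> q1 p" "p \<le> q1 p" "n0 p \<le> q1 p" for p by (auto simp: q1_def)
  have tail: "(\<Sum>q\<in>{q1 p..<b}. f p q) \<le> (1/2) ^ (p + 2)" for p b
  proof (cases "q1 p \<le> b")
    case True
    have sm: "summable (\<lambda>i. f p (i + q1 p))" using sumf by (simp add: summable_iff_shift)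
    have "(\<Sum>q\<in>{q1 p..<b}. f p q) = (\<Sum>i<b - q1 p. f p (i + q1 p))"
      using sum.shift_bounds_nat_ivl[of "f p" 0 "q1 p" "b - q1 p"] True by (simp add: lessThan_atLeast0)
    also have "\<dots> \<le> (\<Sum>i. f p (i + q1 p))" by (rule sum_le_suminf[OF sm]) (auto simp: f0)
    also have "\<dots> \<le> (1/2) ^ (p + 2)" using q'[OF q1(1), of p] by simp
    finally show ?thesis .
  qed simp
  define P where "P k \<theta> \<longleftrightarrow> (\<forall>p q j. q1 p \<le> q \<longrightarrow> real (gap \<epsilon> k) \<le> g p * real q \<longrightarrow> q \<le> depth \<epsilon> (Suc k) \<longrightarrow>
       1 \<le> j \<longrightarrow> j \<le> M p \<longrightarrow> spread_direction 4 (s p) (g p) q (cell (j * q) ` F p) \<theta>)" for k \<theta>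
  have step: "\<exists>a<2 ^ (depth \<epsilon> (Suc k) - gap \<epsilon> k). P k (\<theta> + real a / 2 ^ depth \<epsilon> (Suc k))"
    if \<theta>: "0 \<le> \<theta>" "\<theta> + 1 / 2 ^ gap \<epsilon> k \<le> 1" for k \<theta>
  proof -
    define m where "m = depth \<epsilon> (Suc k)"
    define L :: nat where "L = 2 ^ (m - gap \<epsilon> k)"
    define h :: real where "h = 1 / 2 ^ m"
    have gm: "gap \<epsilon> k \<le> m" using gap_less_depth_Suc[OF \<epsilon>, of k] unfolding m_def by linarith
    have "real L = 2 ^ (m - gap \<epsilon> k)" by (simp add: L_def)
    then have Lh: "real L * h = 1 / 2 ^ gap \<epsilon> k" using gm by (simp add: h_def power_diff)
    define I where "I = (SIGMA p:{..m}. {q1 p..<Suc m} \<times> {1..M p})"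
    define Q where "Q = (\<lambda>(p, q, j) a. real (gap \<epsilon> k) \<le> g p * real q \<longrightarrow>
      spread_direction 4 (s p) (g p) q (cell (j * q) ` F p) (\<theta> + real a * h))"
    define c where "c = (\<lambda>(p, q, j::nat). 35 * (real q + 1) * 2 powr (- g p * real q))"
    have "\<exists>a<L. \<forall>i\<in>I. Q i a"
    proof (rule exists_avoiding[where c = c])
      show "finite I" by (auto simp: I_def)
      show "0 < L" by (simp add: L_def)
      show "real (card {a. a < L \<and> \<not> Q i a}) \<le> real L * c i" if "i \<in> I" for i
      proof -
        obtain p q j where i: "i = (p, q, j)" by (cases i)
        have pq: "q1 p \<le> q" "q \<le> m" "1 \<le> j" using that by (auto simp: i I_def)
        have cn: "0 \<le> real L * c i" by (simp add: c_def i)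
        show ?thesis
        proof (cases "real (gap \<epsilon> k) \<le> g p * real q")
          case True
          have "1 * q \<le> j * q" using pq by (intro mult_right_mono) auto
          then have "n0 p \<le> j * q" using pq q1[of p] by linarith
          then have "real (card {a. a < L \<and> \<not> spread_direction 4 (s p) (g p) q (cell (j * q) ` F p) (\<theta> + real a * h)})
              \<le> real L * (35 * (real q + 1) * 2 powr (- g p * real q))"
          proof (intro card_not_spread_direction_le fin)
            show "h * 2 ^ q \<le> 1" using pq by (simp add: h_def power_increasing)
            have "(2::real) ^ gap \<epsilon> k \<le> 2 powr (g p * real q)" using True by (simp flip: powr_realpow)
            then show "1 \<le> real L * h * 2 powr (g p * real q)" by (simp add: Lh)
          qed (use \<theta> Lh g[of p] in \<open>auto simp: h_def\<close>)
          then show ?thesis using True by (simp add: i Q_def c_def)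
        next
          case False
          then have "{a. a < L \<and> \<not> Q i a} = {}" by (auto simp: i Q_def)
          then show ?thesis using cn by (simp only: card.empty of_nat_0)
        qed
      qed
      have "(\<Sum>i\<in>I. c i) = (\<Sum>p\<le>m. \<Sum>qj\<in>{q1 p..<Suc m} \<times> {1..M p}. c (p, qj))"
        unfolding I_def by (subst sum.Sigma) (auto simp: case_prod_unfold)
      also have "\<dots> = (\<Sum>p\<le>m. \<Sum>q\<in>{q1 p..<Suc m}. \<Sum>j\<in>{1..M p}. c (p, q, j))"
        by (simp add: sum.cartesian_product case_prod_unfold)
      also have "\<dots> = (\<Sum>p\<le>m. \<Sum>q\<in>{q1 p..<Suc m}. f p q)" by (simp add: c_def f_def)
      also have "\<dots> \<le> (\<Sum>p\<le>m. (1/2) ^ (p + 2))" by (intro sum_mono tail)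
      also have "\<dots> = (1/4) * (\<Sum>p\<le>m. (1/2) ^ p)" by (simp add: sum_distrib_left power_add)
      also have "(\<Sum>p\<le>m. (1/2::real) ^ p) \<le> 2"
        by (subst atMost_atLeast0, subst sum_gp) (simp add: field_simps)
      finally show "(\<Sum>i\<in>I. c i) < 1" by simp
    qed
    then obtain a where a: "a < L" "\<And>i. i \<in> I \<Longrightarrow> Q i a" by blast
    have "P k (\<theta> + real a / 2 ^ depth \<epsilon> (Suc k))"
      unfolding P_def
    proof (intro allI impI)
      fix p q j
      assume h': "q1 p \<le> q" "real (gap \<epsilon> k) \<le> g p * real q" "q \<le> depth \<epsilon> (Suc k)" "1 \<le> j" "j \<le> M p"
      then have "(p, q, j) \<in> I" using q1(2)[of p] by (auto simp: I_def m_def)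
      from a(2)[OF this] show "spread_direction 4 (s p) (g p) q (cell (j * q) ` F p) (\<theta> + real a / 2 ^ depth \<epsilon> (Suc k))"
        using h'(2) by (simp add: Q_def h_def m_def del: depth.simps)
    qed
    then show ?thesis using a(1) unfolding L_def m_def by blast
  qed
  obtain \<theta> x where \<theta>: "\<theta> \<in> slopes \<epsilon>" "\<And>k. P k (x (Suc k))"
    "\<And>k. x k \<le> \<theta>" "\<And>k. \<theta> \<le> x k + 1 / 2 ^ gap \<epsilon> k"
    using nested_slope_selection[OF \<epsilon>, of P] step by blast
  show ?thesis
  proof (rule that[OF \<theta>(1)])
    fix p q j k
    assume h: "q1 p \<le> q" "real (gap \<epsilon> k) \<le> g p * real q" "q \<le> depth \<epsilon> (Suc k)" "1 \<le> j" "j \<le> M p"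
    have "1 * q \<le> j * q" using h by (intro mult_right_mono) auto
    then have "finite (cell (j * q) ` F p)" using h q1[of p] by (intro fin) linarith
    then show "spread_direction 3 (s p) (g p) q (cell (j * q) ` F p) \<theta>"
    proof (rule spread_direction_perturb)
      show "spread_direction 4 (s p) (g p) q (cell (j * q) ` F p) (x (Suc k))"
        using \<theta>(2)[of k] h unfolding P_def by blast
      have "q \<le> gap \<epsilon> (Suc k)" using h depth_less_gap[OF \<epsilon>, of "Suc k"] by linarith
      then have "(2::real) ^ q \<le> 2 ^ gap \<epsilon> (Suc k)" by (intro power_increasing) auto
      moreover have "\<bar>\<theta> - x (Suc k)\<bar> \<le> 1 / 2 ^ gap \<epsilon> (Suc k)" using \<theta>(3,4)[of "Suc k"] by linarith
      ultimately have "\<bar>\<theta> - x (Suc k)\<bar> * 2 ^ q \<le> 1 / 2 ^ gap \<epsilon> (Suc k) * 2 ^ gap \<epsilon> (Suc k)"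
        by (intro mult_mono) auto
      then show "\<bar>\<theta> - x (Suc k)\<bar> * 2 ^ q \<le> 1" by simp
    qed
  qed
qed

section \<open>Universality\<close>

definition slope_dir :: "real \<Rightarrow> real^2" where
  "slope_dir \<theta> = (1 / sqrt (1 + \<theta>\<^sup>2)) *\<^sub>R vector [\<theta>, 1]"

lemma sqrt_one_plus_square_ge_1: "1 \<le> sqrt (1 + \<theta>\<^sup>2)"
  by simp

lemma slope_dir_nth [simp]:
  "slope_dir \<theta> $ 1 = \<theta> / sqrt (1 + \<theta>\<^sup>2)" "slope_dir \<theta> $ 2 = 1 / sqrt (1 + \<theta>\<^sup>2)"
  by (simp_all add: slope_dir_def)

lemma norm_vector_slope: "norm (vector [\<theta>, 1] :: real^2) = sqrt (1 + \<theta>\<^sup>2)"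
  by (simp add: norm_vec_def L2_set_def sum_2 add.commute)

lemma norm_slope_dir [simp]: "norm (slope_dir \<theta>) = 1"
proof -
  have "0 < sqrt (1 + \<theta>\<^sup>2)" using sqrt_one_plus_square_ge_1[of \<theta>] by linarith
  then show ?thesis unfolding slope_dir_def norm_scaleR norm_vector_slope by simp
qed

lemma dir_proj_slope_dir: "dir_proj (slope_dir \<theta>) x = (\<theta> * x $ 1 + x $ 2) / sqrt (1 + \<theta>\<^sup>2)"
  by (simp add: dir_proj_def inner_vec_def sum_2 add_divide_distrib)

lemma hausdorff_dim_dir_proj_le:
  assumes "norm e = 1"
  shows "hausdorff_dim (dir_proj e ` E) \<le> min (hausdorff_dim E) 1"
proof (rule min.boundedI)
  show "hausdorff_dim (dir_proj e ` E) \<le> hausdorff_dim E"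
  proof (rule hausdorff_dim_le_if_content_imp, rule hausdorff_content_Lipschitz_image_eq_0)
    show "dist (dir_proj e x) (dir_proj e y) \<le> 1 * dist x y" for x y
      using Cauchy_Schwarz_ineq2[of e "x - y"] assms
      by (simp add: dir_proj_def dist_norm inner_diff_right)
  qed
  show "hausdorff_dim (dir_proj e ` E) \<le> 1"
    using hausdorff_dim_le_DIM[of "dir_proj e ` E"] by (simp add: one_ereal_def)
qed

text \<open>Provides the direction for sets of dimension 0, to which the argument with exponents
  below s does not apply.\<close>

lemma zero_in_slopes: "0 \<in> slopes \<epsilon>"
  unfolding slopes_def by (auto intro!: exI[of _ 0])

text \<open>A single slope has to serve all losses g l, which tend to 0, so the pieces for all l are
  enumerated together by \<open>prod_decode\<close>. If the projection had too small a dimension,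
  then for one l with g l small against the deficit all pieces, and hence E, would be null for an
  exponent below s.\<close>

lemma exists_slope_with_full_projection:
  assumes \<epsilon>: "0 < \<epsilon>" "\<epsilon> < 1" and s: "hausdorff_dim E = ereal s" "packing_dim E = ereal s" "0 < s"
  shows "\<exists>\<theta>\<in>slopes \<epsilon>. min (hausdorff_dim E) 1 \<le> hausdorff_dim (dir_proj (slope_dir \<theta>) ` E)"
proof -
  define g where "g l = 1 / (real l + 1)" for l
  define M where "M l = nat \<lceil>(1 / \<epsilon> + 3) / g l + 1\<rceil>" for l
  \<comment> \<open>With count exponent s + \<eta> and content exponent s - \<eta>, the difference
    times M is 2 \<eta> M = g / 2, exactly what lifting allows.\<close>
  define \<eta> where "\<eta> l = g l / (4 * real (M l))" for l
  have g: "0 < g l" for l by (simp add: g_def)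
  have M: "(1 / \<epsilon> + 3) / g l + 1 \<le> real (M l)" for l unfolding M_def by (rule of_nat_ceiling)
  have M1: "1 \<le> real (M l)" for l
  proof -
    have "0 \<le> (1 / \<epsilon> + 3) / g l" using \<epsilon> g[of l] by simp
    then show ?thesis using M[of l] by linarith
  qed
  have \<eta>: "0 < \<eta> l" "\<eta> l \<le> g l / 4" "\<eta> l * real (M l) = g l / 4" for l
  proof -
    show "0 < \<eta> l" "\<eta> l * real (M l) = g l / 4" using g[of l] M1[of l] by (simp_all add: \<eta>_def)
    show "\<eta> l \<le> g l / 4" unfolding \<eta>_def using g[of l] M1[of l] by (intro divide_left_mono) auto
  qed
  have "\<exists>B C n0. E \<subseteq> (\<Union>i::nat. B i) \<and> (\<forall>i::nat. 0 < C i) \<and>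
      (\<forall>i n. n0 i \<le> n \<longrightarrow> finite (cell n ` B i)) \<and>
      (\<forall>i n. n0 i \<le> n \<longrightarrow> real (card (cell n ` B i)) \<le> C i * 2 powr ((s + \<eta> l) * real n))" for l
  proof -
    have "packing_dim E < ereal (s + \<eta> l)" using s \<eta>(1)[of l] by simp
    then show ?thesis by (rule packing_dim_less_cover) blast
  qed
  then obtain B C n0 where B: "\<And>l. E \<subseteq> (\<Union>i::nat. B l i)" "\<And>l i. 0 < C l i"
    "\<And>l i n. n0 l i \<le> n \<Longrightarrow> finite (cell n ` B l i)"
    "\<And>l i n. n0 l i \<le> n \<Longrightarrow> real (card (cell n ` B l i)) \<le> C l i * 2 powr ((s + \<eta> l) * real n)"
    by metis
  \<comment> \<open>The pieces are cut down to E, so that a null projection of E gives null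
    projections of the pieces.\<close>
  define F where "F l i = B l i \<inter> E" for l i
  have sub: "cell n ` F l i \<subseteq> cell n ` B l i" for n l i by (auto simp: F_def)
  have finF: "finite (cell n ` F l i)" if "n0 l i \<le> n" for n l i
    using finite_subset[OF sub B(3)[OF that]] .
  have cardF: "real (card (cell n ` F l i)) \<le> C l i * 2 powr ((s + \<eta> l) * real n)" if "n0 l i \<le> n" for n l i
    using card_mono[OF B(3)[OF that] sub[of n l i]] B(4)[OF that] by linarith
  obtain \<theta> q1 where \<theta>: "\<theta> \<in> slopes \<epsilon>" and good:
    "\<And>p q j k. q1 p \<le> q \<Longrightarrow> real (gap \<epsilon> k) \<le> g (fst (prod_decode p)) * real q \<Longrightarrow> q \<le> depth \<epsilon> (Suc k) \<Longrightarrow>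
       1 \<le> j \<Longrightarrow> j \<le> M (fst (prod_decode p)) \<Longrightarrow>
       spread_direction 3 (s - \<eta> (fst (prod_decode p))) (g (fst (prod_decode p))) q
         (cell (j * q) ` (case prod_decode p of (l, i) \<Rightarrow> F l i)) \<theta>"
    by (rule exists_spread_slope[OF \<epsilon>, of "\<lambda>p. g (fst (prod_decode p))" "\<lambda>p. case prod_decode p of (l, i) \<Rightarrow> n0 l i"
          "\<lambda>p. case prod_decode p of (l, i) \<Rightarrow> F l i" "\<lambda>p. M (fst (prod_decode p))" "\<lambda>p. s - \<eta> (fst (prod_decode p))"])
      (use g finF in \<open>auto split: prod.splits\<close>)
  have \<theta>01: "0 \<le> \<theta>" "\<theta> \<le> 1" using \<theta> by (auto simp: slopes_def)
  let ?c = "sqrt (1 + \<theta>\<^sup>2)"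
  have c: "1 \<le> ?c" by (rule sqrt_one_plus_square_ge_1)
  have "min (hausdorff_dim E) 1 \<le> hausdorff_dim (dir_proj (slope_dir \<theta>) ` E)"
  proof (rule ccontr)
    assume "\<not> ?thesis"
    then have "hausdorff_dim (dir_proj (slope_dir \<theta>) ` E) < ereal (min s 1)"
      by (simp add: s one_ereal_def min_def split: if_splits)
    then obtain v where v: "hausdorff_dim (dir_proj (slope_dir \<theta>) ` E) < ereal v" "v < min s 1"
      using ereal_dense2 by (metis less_ereal.simps(1))
    have v0: "0 < v" and vn: "hausdorff_content v (dir_proj (slope_dir \<theta>) ` E) = 0"
      using hausdorff_content_eq_0_if_dim_less[OF v(1)] by auto
    have "hausdorff_content v ((\<lambda>y. ?c * y) ` dir_proj (slope_dir \<theta>) ` E) = 0"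
      by (rule hausdorff_content_Lipschitz_image_eq_0[OF vn v0, where L = ?c])
        (simp add: dist_real_def abs_mult flip: right_diff_distrib)
    also have "(\<lambda>y. ?c * y) ` dir_proj (slope_dir \<theta>) ` E = (\<lambda>x. \<theta> * x $ 1 + x $ 2) ` E"
    proof -
      have "?c \<noteq> 0" using c by linarith
      then have "?c * dir_proj (slope_dir \<theta>) x = \<theta> * x $ 1 + x $ 2" for x
        unfolding dir_proj_slope_dir times_divide_eq_right by (rule nonzero_mult_div_cancel_left)
      then show ?thesis by (simp only: image_image)
    qed
    finally have null: "hausdorff_content v ((\<lambda>x. \<theta> * x $ 1 + x $ 2) ` E) = 0" .
    obtain l :: nat where "5 / (min s 1 - v) < real l" using reals_Archimedean2 by blast
    then have "5 / (min s 1 - v) < real l + 1" by simp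
    \<comment> \<open>4 g is lost in the exponent of the fibres; the fifth g covers the shift of s
      by \<eta> <= g / 4.\<close>
    then have l: "5 * g l < min s 1 - v"
      using v(2) by (simp add: g_def pos_divide_less_eq mult.commute)
    define s' where "s' = s - \<eta> l"
    have s': "0 < s'" "v \<le> min s' 1 - 4 * g l" "s' < s"
      using l v0 \<eta>[of l] g[of l] by (auto simp: s'_def min_def split: if_splits)
    have "hausdorff_content s' (F l i) = 0" for i
    proof -
      let ?p = "prod_encode (l, i)"
      let ?G = "{q. \<exists>k. real (gap \<epsilon> k) \<le> g l * real q \<and> q \<le> depth \<epsilon> (Suc k)}"
      obtain R0 where R0: "\<forall>R\<ge>R0. \<exists>N q. 1 \<le> N \<and> N \<le> M l \<and> q \<in> ?G \<and> N * q \<le> R \<and> R \<le> N * q + M l"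
        using exists_multiple_of_usable_scale[OF \<epsilon> g M] by blast
      show ?thesis
      proof (rule hausdorff_content_eq_0_if_projection_null[of "n0 l i" "F l i" "C l i" "s + \<eta> l" s' "g l" "M l"
            \<theta> ?G "q1 ?p" R0 "min s' 1 - 4 * g l"])
        show "(s + \<eta> l - s') * real (M l) \<le> g l / 2"
          using \<eta>(3)[of l] by (simp add: s'_def algebra_simps)
        show "spread_direction 3 s' (g l) q (cell (j * q) ` F l i) \<theta>"
          if "q \<in> ?G" "q1 ?p \<le> q" "1 \<le> j" "j \<le> M l" for q j
          using that good[of ?p q _ j] by (auto simp: s'_def)
        have "hausdorff_content v ((\<lambda>x. \<theta> * x $ 1 + x $ 2) ` F l i) = 0"
          using hausdorff_content_mono[of "(\<lambda>x. \<theta> * x $ 1 + x $ 2) ` F l i" "(\<lambda>x. \<theta> * x $ 1 + x $ 2) ` E" v] null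
          by (auto simp: F_def)
        then show "hausdorff_content (min s' 1 - 4 * g l) ((\<lambda>x. \<theta> * x $ 1 + x $ 2) ` F l i) = 0"
          using hausdorff_content_eq_0_mono v0 s'(2) by blast
        show "\<exists>N q. 1 \<le> N \<and> N \<le> M l \<and> q \<in> ?G \<and> N * q \<le> R \<and> R \<le> N * q + M l" if "R0 \<le> R" for R
          using R0 that by blast
      qed (use finF cardF B(2) s' \<eta>(1)[of l] g \<theta>01 v0 in \<open>auto simp: s'_def\<close>)
    qed
    then have "hausdorff_content s' (\<Union>i. F l i) = 0" by (rule hausdorff_content_UN_eq_0)
    then have "hausdorff_content s' E = 0"
      using hausdorff_content_mono[of E "\<Union>i. F l i" s'] B(1)[of l] by (auto simp: F_def)
    then have "hausdorff_dim E \<le> ereal s'" using s' by (intro hausdorff_dim_le)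
    then show False using s s'(3) by simp
  qed
  then show ?thesis using \<theta> by blast
qed

lemma universal_slope_directions:
  assumes \<epsilon>: "0 < \<epsilon>" "\<epsilon> < 1"
  shows "universal_for (slope_dir ` slopes \<epsilon>) {E. weakly_regular E}"
  unfolding universal_for_def
proof (intro conjI ballI)
  show "slope_dir ` slopes \<epsilon> \<subseteq> sphere 0 1" by auto
  fix E assume "E \<in> {E. weakly_regular E}"
  then have reg: "hausdorff_dim E = packing_dim E" by (simp add: weakly_regular_def)
  have "\<exists>\<theta>\<in>slopes \<epsilon>. min (hausdorff_dim E) 1 \<le> hausdorff_dim (dir_proj (slope_dir \<theta>) ` E)"
  proof (cases "hausdorff_dim E = 0")
    case True
    then show ?thesis using zero_in_slopes hausdorff_dim_nonneg by (intro bexI[of _ 0]) auto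
  next
    case False
    obtain s where s: "hausdorff_dim E = ereal s"
      using hausdorff_dim_nonneg[of E] hausdorff_dim_le_DIM[of E] by (cases "hausdorff_dim E") auto
    have "0 < s" using False hausdorff_dim_nonneg[of E] by (simp add: s zero_ereal_def less_le)
    then show ?thesis using s reg by (intro exists_slope_with_full_projection \<epsilon>) auto
  qed
  then obtain \<theta> where \<theta>: "\<theta> \<in> slopes \<epsilon>" "min (hausdorff_dim E) 1 \<le> hausdorff_dim (dir_proj (slope_dir \<theta>) ` E)" by blast
  then show "\<exists>e\<in>slope_dir ` slopes \<epsilon>. hausdorff_dim (dir_proj e ` E) = min (hausdorff_dim E) 1"
    using hausdorff_dim_dir_proj_le[of "slope_dir \<theta>" E] by (intro bexI[of _ "slope_dir \<theta>"] antisym) auto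
qed

section \<open>Lower box dimension\<close>

text \<open>Outside the open unit ball normalisation has Lipschitz constant 2: one share for the
  difference of the vectors, one for that of their norms.\<close>

lemma dist_slope_dir_le: "dist (slope_dir \<theta>) (slope_dir \<phi>) \<le> 2 * \<bar>\<theta> - \<phi>\<bar>"
proof -
  define x y where "x = (vector [\<theta>, 1] :: real^2)" and "y = (vector [\<phi>, 1] :: real^2)"
  have nx: "1 \<le> norm x" and ny: "1 \<le> norm y"
    unfolding x_def y_def norm_vector_slope by simp_all
  have xy: "norm (x - y) = \<bar>\<theta> - \<phi>\<bar>"
    by (simp add: x_def y_def norm_vec_def L2_set_def sum_2)
  have d: "slope_dir \<theta> = (1 / norm x) *\<^sub>R x" "slope_dir \<phi> = (1 / norm y) *\<^sub>R y"
    by (simp_all add: slope_dir_def x_def y_def norm_vector_slope)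
  have "slope_dir \<theta> - slope_dir \<phi> = (1 / norm x) *\<^sub>R (x - y) + (1 / norm x - 1 / norm y) *\<^sub>R y"
    by (simp add: d algebra_simps)
  then have "norm (slope_dir \<theta> - slope_dir \<phi>) \<le> norm ((1 / norm x) *\<^sub>R (x - y)) + norm ((1 / norm x - 1 / norm y) *\<^sub>R y)"
    by (metis norm_triangle_ineq)
  also have "norm ((1 / norm x) *\<^sub>R (x - y)) = norm (x - y) / norm x" by simp
  also have "norm ((1 / norm x - 1 / norm y) *\<^sub>R y) = \<bar>norm y - norm x\<bar> / norm x"
  proof -
    have "(1 / norm x - 1 / norm y) * norm y = (norm y - norm x) / norm x"
    proof -
      have "x \<noteq> 0" "y \<noteq> 0" using nx ny by auto
      then show ?thesis by (simp add: field_simps)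
    qed
    then have "\<bar>1 / norm x - 1 / norm y\<bar> * norm y = \<bar>(norm y - norm x) / norm x\<bar>"
      by (metis abs_mult abs_norm_cancel)
    then show ?thesis by simp
  qed
  also have "norm (x - y) / norm x + \<bar>norm y - norm x\<bar> / norm x = (norm (x - y) + \<bar>norm y - norm x\<bar>) / norm x"
    by (simp add: add_divide_distrib)
  also have "\<dots> \<le> (norm (x - y) + norm (x - y)) / 1"
    using nx norm_triangle_ineq3[of y x] by (intro frac_le add_left_mono) (auto simp: norm_minus_commute)
  finally show ?thesis by (simp add: dist_norm xy)
qed

text \<open>With c as in the proof, (\<theta> - \<phi>) c \<theta> c \<phi> is the determinant of
  the two unit vectors. It is at most twice their distance, and c \<theta> c \<phi> >= 1/2 on
  [0, 1].\<close>

lemma slope_diff_le_dist_slope_dir: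
  assumes "0 \<le> \<theta>" "\<theta> \<le> 1" "0 \<le> \<phi>" "\<phi> \<le> 1"
  shows "\<bar>\<theta> - \<phi>\<bar> \<le> 4 * dist (slope_dir \<theta>) (slope_dir \<phi>)"
proof -
  define c where "c t = 1 / sqrt (1 + t\<^sup>2)" for t :: real
  have c: "0 < c t" "c t \<le> 1" "1 / 2 \<le> (c t)\<^sup>2" if "0 \<le> t" "t \<le> 1" for t
  proof -
    have "t\<^sup>2 \<le> 1" using that by (simp add: power_le_one)
    moreover have "0 < 1 + t\<^sup>2" by (simp add: add_pos_nonneg)
    ultimately show "1 / 2 \<le> (c t)\<^sup>2" by (simp add: c_def power_divide pos_le_divide_eq)
    show "0 < c t" "c t \<le> 1" using sqrt_one_plus_square_ge_1[of t] by (simp_all add: c_def add_pos_nonneg)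
  qed
  have nth: "slope_dir t $ 1 = t * c t" "slope_dir t $ 2 = c t" for t by (simp_all add: c_def)
  let ?D = "dist (slope_dir \<theta>) (slope_dir \<phi>)"
  have "\<bar>\<theta> * c \<theta> - \<phi> * c \<phi>\<bar> \<le> ?D" "\<bar>c \<phi> - c \<theta>\<bar> \<le> ?D"
    using component_le_norm_cart[of "slope_dir \<theta> - slope_dir \<phi>" 1] component_le_norm_cart[of "slope_dir \<theta> - slope_dir \<phi>" 2]
    by (simp_all only: dist_norm vector_minus_component nth abs_minus_commute)
  moreover have "\<bar>(\<theta> * c \<theta> - \<phi> * c \<phi>) * c \<phi>\<bar> \<le> \<bar>\<theta> * c \<theta> - \<phi> * c \<phi>\<bar> * 1"
    unfolding abs_mult using c[of \<phi>] assms by (intro mult_left_mono) auto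
  moreover have "\<bar>(c \<phi> - c \<theta>) * (\<phi> * c \<phi>)\<bar> \<le> \<bar>c \<phi> - c \<theta>\<bar> * 1"
    unfolding abs_mult using c[of \<phi>] assms mult_mono[of \<phi> 1 "c \<phi>" 1] by (intro mult_left_mono) (auto simp: abs_mult)
  moreover have "(\<theta> - \<phi>) * (c \<theta> * c \<phi>) = (\<theta> * c \<theta> - \<phi> * c \<phi>) * c \<phi> + (c \<phi> - c \<theta>) * (\<phi> * c \<phi>)"
    by (simp add: algebra_simps)
  moreover have "\<bar>t\<bar> \<le> 2 * d" if "p \<le> d" "q \<le> d" "\<bar>x\<bar> \<le> p * 1" "\<bar>y\<bar> \<le> q * 1" "t = x + y"
    for t x y p q d :: real
    using that by linarith
  ultimately have "\<bar>(\<theta> - \<phi>) * (c \<theta> * c \<phi>)\<bar> \<le> 2 * ?D" by blast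
  then have *: "\<bar>\<theta> - \<phi>\<bar> * (c \<theta> * c \<phi>) \<le> 2 * ?D" using c(1)[of \<theta>] c(1)[of \<phi>] assms by (simp add: abs_mult)
  have "(1 / 2)\<^sup>2 \<le> (c \<theta> * c \<phi>)\<^sup>2"
    using mult_mono[OF c(3)[of \<theta>] c(3)[of \<phi>]] assms by (simp add: power_mult_distrib power_divide)
  moreover have "0 \<le> c \<theta> * c \<phi>" by (simp add: c_def)
  ultimately have "1 / 2 \<le> c \<theta> * c \<phi>" by (rule power2_le_imp_le)
  then have "\<bar>\<theta> - \<phi>\<bar> * (1 / 2) \<le> \<bar>\<theta> - \<phi>\<bar> * (c \<theta> * c \<phi>)" by (intro mult_left_mono) auto
  also have "\<dots> \<le> 2 * ?D" by (rule *)
  finally show ?thesis by simp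
qed

section \<open>Covering numbers and separated sets\<close>

lemma covering_number_le:
  assumes "finite F" "A \<subseteq> \<Union>F" "\<And>U. U \<in> F \<Longrightarrow> bounded U \<and> diameter U \<le> \<delta>"
  shows "covering_number \<delta> A \<le> card F"
  unfolding covering_number_def by (rule Least_le) (use assms in blast)

lemma bounded_imp_finite_small_cover:
  fixes A :: "'a::euclidean_space set"
  assumes "bounded A" "0 < \<delta>"
  shows "\<exists>F. finite F \<and> A \<subseteq> \<Union>F \<and> (\<forall>U\<in>F. bounded U \<and> diameter U \<le> \<delta>)"
proof -
  have "compact (closure A)" using assms(1) by simp
  then obtain k where k: "finite k" "closure A \<subseteq> (\<Union>x\<in>k. ball x (\<delta> / 2))"
    using compact_eq_totally_bounded[of "closure A"] assms(2) by (meson half_gt_zero)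
  show ?thesis
    using k closure_subset[of A] assms(2)
    by (intro exI[of _ "(\<lambda>x. ball x (\<delta> / 2)) ` k"]) auto
qed

lemma card_separated_le_covering_number:
  fixes A :: "'a::euclidean_space set"
  assumes A: "bounded A" "0 < \<delta>" and W: "finite W" "W \<subseteq> A"
    and sep: "\<And>x y. x \<in> W \<Longrightarrow> y \<in> W \<Longrightarrow> x \<noteq> y \<Longrightarrow> \<delta> < dist x y"
  shows "card W \<le> covering_number \<delta> A"
proof -
  have "\<exists>n F. finite F \<and> card F = n \<and> A \<subseteq> \<Union>F \<and> (\<forall>U\<in>F. bounded U \<and> diameter U \<le> \<delta>)"
    using bounded_imp_finite_small_cover[OF A] by blast
  from LeastI_ex[OF this, folded covering_number_def]
  obtain F where F: "finite F" "card F = covering_number \<delta> A" "A \<subseteq> \<Union>F"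
    "\<And>U. U \<in> F \<Longrightarrow> bounded U \<and> diameter U \<le> \<delta>" by blast
  have "\<exists>U. U \<in> F \<and> x \<in> U" if "x \<in> W" for x using that W F(3) by blast
  then obtain f where f: "\<And>x. x \<in> W \<Longrightarrow> f x \<in> F \<and> x \<in> f x" by metis
  have "inj_on f W"
  proof (rule inj_onI, rule ccontr)
    fix x y assume xy: "x \<in> W" "y \<in> W" "f x = f y" "x \<noteq> y"
    then have "dist x y \<le> diameter (f x)"
      using f[of x] f[of y] F(4) by (intro diameter_bounded_bound) auto
    then show False using sep[OF xy(1,2,4)] F(4)[of "f x"] f[OF xy(1)] by linarith
  qed
  then have "card W \<le> card F" using f F(1) by (intro card_inj_on_le[of f]) auto
  then show ?thesis using F by simp
qed

lemma bounded_slope_directions: "bounded (slope_dir ` S)"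
  by (rule bounded_subset[of "sphere 0 1"]) auto

text \<open>At the end of a vanishing block, one set suffices for each multiple of 2^(-depth k) in
  [0, 1]; the 2 in the scale is the Lipschitz constant. There are 2^depth + 1 multiples, rounded up
  to the next power of 2.\<close>

lemma covering_number_slope_directions_le:
  assumes \<epsilon>: "0 < \<epsilon>" "\<epsilon> < 1"
  shows "covering_number (2 / 2 ^ gap \<epsilon> k) (slope_dir ` slopes \<epsilon>) \<le> 2 ^ Suc (depth \<epsilon> k)"
proof -
  define m where "m = depth \<epsilon> k"
  define J where "J z = {\<theta>. real z / 2 ^ m \<le> \<theta> \<and> \<theta> \<le> real z / 2 ^ m + 1 / 2 ^ gap \<epsilon> k}" for z :: nat
  define F where "F = (\<lambda>z. slope_dir ` J z) ` {..2 ^ m}"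
  have "covering_number (2 / 2 ^ gap \<epsilon> k) (slope_dir ` slopes \<epsilon>) \<le> card F"
  proof (rule covering_number_le)
    show "finite F" by (simp add: F_def)
    show "slope_dir ` slopes \<epsilon> \<subseteq> \<Union>F"
    proof (rule image_subsetI)
      fix \<theta> assume "\<theta> \<in> slopes \<epsilon>"
      then obtain z :: nat where z: "\<theta> \<in> J z" "\<theta> \<le> 1" unfolding slopes_def J_def m_def by blast
      then have "real z / 2 ^ m \<le> 1" unfolding J_def by (simp only: mem_Collect_eq) linarith
      then have "real z \<le> real (2 ^ m)" by (simp add: pos_divide_le_eq)
      then have "z \<le> 2 ^ m" by (simp only: of_nat_le_iff)
      then show "slope_dir \<theta> \<in> \<Union>F" using z(1) unfolding F_def by blast
    qed
    fix U assume "U \<in> F"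
    then obtain z where U: "U = slope_dir ` J z" unfolding F_def by blast
    have "diameter U \<le> 2 / 2 ^ gap \<epsilon> k"
    proof (rule diameter_le)
      fix x y assume "x \<in> U" "y \<in> U"
      then obtain \<theta> \<phi> where xy: "\<theta> \<in> J z" "\<phi> \<in> J z" "x = slope_dir \<theta>" "y = slope_dir \<phi>" unfolding U by blast
      then have "\<bar>\<theta> - \<phi>\<bar> \<le> 1 / 2 ^ gap \<epsilon> k" unfolding J_def by (simp only: mem_Collect_eq) linarith
      then show "norm (x - y) \<le> 2 / 2 ^ gap \<epsilon> k"
        using dist_slope_dir_le[of \<theta> \<phi>] xy by (simp add: dist_norm)
    qed simp
    then show "bounded U \<and> diameter U \<le> 2 / 2 ^ gap \<epsilon> k" using bounded_slope_directions U by blast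
  qed
  also have "\<dots> \<le> card {..(2::nat) ^ m}" unfolding F_def by (rule card_image_le) simp
  also have "\<dots> \<le> 2 ^ Suc m" by simp
  finally show ?thesis by (simp add: m_def)
qed

lemma real_two_power_diff_divide: "a \<le> b \<Longrightarrow> real (2 ^ (b - a)) / 2 ^ b = 1 / 2 ^ a"
  unfolding of_nat_power of_nat_numeral by (simp add: power_diff)

text \<open>Digits a in one free block, c in the next, and zeros elsewhere. The extreme value of c
  is allowed because \<open>slopes\<close> uses closed intervals.\<close>

lemma two_level_sum_in_slopes:
  assumes \<epsilon>: "0 < \<epsilon>" "\<epsilon> < 1"
    and a: "a < 2 ^ (depth \<epsilon> (Suc k) - gap \<epsilon> k)"
    and c: "c \<le> 2 ^ (depth \<epsilon> (Suc (Suc k)) - gap \<epsilon> (Suc k))"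
  shows "real a / 2 ^ depth \<epsilon> (Suc k) + real c / 2 ^ depth \<epsilon> (Suc (Suc k)) \<in> slopes \<epsilon>"
proof -
  define m m' where "m = depth \<epsilon> (Suc k)" and "m' = depth \<epsilon> (Suc (Suc k))"
  define \<theta> where "\<theta> = real a / 2 ^ m + real c / 2 ^ m'"
  have le: "gap \<epsilon> k \<le> m" "m \<le> gap \<epsilon> (Suc k)" "gap \<epsilon> (Suc k) \<le> m'"
    using gap_less_depth_Suc[OF \<epsilon>, of k] depth_less_gap[OF \<epsilon>, of "Suc k"] gap_less_depth_Suc[OF \<epsilon>, of "Suc k"]
    unfolding m_def m'_def by linarith+
  have \<theta>0: "0 \<le> \<theta>" by (simp add: \<theta>_def)
  have "real c \<le> real (2 ^ (m' - gap \<epsilon> (Suc k)))" using c unfolding m'_def by (simp only: of_nat_le_iff)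
  then have "real c / 2 ^ m' \<le> 2 ^ (m' - gap \<epsilon> (Suc k)) / 2 ^ m'" by (intro divide_right_mono) auto
  also have "\<dots> = 1 / 2 ^ gap \<epsilon> (Suc k)" using le by (simp add: power_diff)
  finally have c': "real c / 2 ^ m' \<le> 1 / 2 ^ gap \<epsilon> (Suc k)" .
  have "(1::real) / 2 ^ gap \<epsilon> (Suc k) \<le> 1 / 2 ^ m" using le by (intro divide_left_mono power_increasing) auto
  moreover have "real (a + 1) / 2 ^ m \<le> real (2 ^ (m - gap \<epsilon> k)) / 2 ^ m"
    using a unfolding m_def by (intro divide_right_mono) (simp_all only: of_nat_le_iff, simp_all)
  moreover have "real (2 ^ (m - gap \<epsilon> k)) / 2 ^ m = 1 / 2 ^ gap \<epsilon> k"
    by (rule real_two_power_diff_divide[OF le(1)])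
  ultimately have \<theta>gap: "\<theta> \<le> 1 / 2 ^ gap \<epsilon> k" using c' by (simp add: \<theta>_def add_divide_distrib)
  have "\<exists>z::nat. z / 2 ^ depth \<epsilon> j \<le> \<theta> \<and> \<theta> \<le> z / 2 ^ depth \<epsilon> j + 1 / 2 ^ gap \<epsilon> j" for j
  proof -
    have dmono: "depth \<epsilon> i \<le> depth \<epsilon> i'" if "i \<le> i'" for i i'
      using lift_Suc_mono_le[of "depth \<epsilon>", OF _ that] gap_less_depth_Suc[OF \<epsilon>] depth_less_gap[OF \<epsilon>]
      by (meson add_leE order.trans)
    consider "j \<le> k" | "j = Suc k" | "Suc (Suc k) \<le> j" by linarith
    then show ?thesis
    proof cases
      case 1
      then have "gap \<epsilon> j \<le> gap \<epsilon> k" using gap_mono[OF \<epsilon>] by (simp add: monoD)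
      then have "(1::real) / 2 ^ gap \<epsilon> k \<le> 1 / 2 ^ gap \<epsilon> j" by (intro divide_left_mono power_increasing) auto
      then show ?thesis using \<theta>gap \<theta>0 by (intro exI[of _ 0]) auto
    next
      case 2
      then show ?thesis using c' by (intro exI[of _ a]) (auto simp: \<theta>_def m_def)
    next
      case 3
      then have d: "m' \<le> depth \<epsilon> j" "m \<le> depth \<epsilon> j" unfolding m'_def m_def by (intro dmono; linarith)+
      have "real (a * 2 ^ (depth \<epsilon> j - m) + c * 2 ^ (depth \<epsilon> j - m')) / 2 ^ depth \<epsilon> j = \<theta>"
        unfolding of_nat_add of_nat_mult add_divide_distrib times_divide_eq_right[symmetric]
          real_two_power_diff_divide[OF d(1)] real_two_power_diff_divide[OF d(2)] by (simp add: \<theta>_def)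
      then show ?thesis by (intro exI[of _ "a * 2 ^ (depth \<epsilon> j - m) + c * 2 ^ (depth \<epsilon> j - m')"]) simp
    qed
  qed
  moreover have "\<theta> \<le> 1" using \<theta>gap by (rule order.trans) simp
  ultimately show ?thesis using \<theta>0 unfolding slopes_def \<theta>_def m_def m'_def by blast
qed

text \<open>A separated set: all digit choices in one free block, refined in the next one by
  multiples of a spacing just above 4 \<delta>, where 4 is the constant comparing slopes with
  directions. The unrefined count serves while \<delta> lies in the vanishing block, the refined one
  beyond it.\<close>

lemma covering_number_slope_directions_ge:
  assumes \<epsilon>: "0 < \<epsilon>" "\<epsilon> < 1"
    and \<delta>: "1 / 2 ^ (depth \<epsilon> (Suc (Suc k)) + 2) \<le> 4 * \<delta>" "4 * \<delta> < 1 / 2 ^ (depth \<epsilon> (Suc k) + 2)"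
  defines "L \<equiv> 2 ^ (depth \<epsilon> (Suc k) - gap \<epsilon> k) :: real"
  shows "L \<le> real (covering_number \<delta> (slope_dir ` slopes \<epsilon>))"
    and "L * (1 / (32 * 2 ^ gap \<epsilon> (Suc k) * \<delta>)) \<le> real (covering_number \<delta> (slope_dir ` slopes \<epsilon>))"
proof -
  define m m' where "m = depth \<epsilon> (Suc k)" and "m' = depth \<epsilon> (Suc (Suc k))"
  define n' where "n' = gap \<epsilon> (Suc k)"
  define l :: nat where "l = 2 ^ (m - gap \<epsilon> k)"
  \<comment> \<open>The least integer with \<beta> / 2^m' above 4 \<delta>. Rounding costs at most
    16 \<delta> by the lower bound on \<delta>, so the spacing is at most 20 \<delta>, relaxed below
    to 32 \<delta>, a power of 2.\<close>
  define \<beta> where "\<beta> = nat \<lfloor>4 * \<delta> * 2 ^ m'\<rfloor> + 1"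
  define b' where "b' = 2 ^ (m' - n') div \<beta>"
  have le: "m + 2 \<le> n'" "n' \<le> m'"
    using depth_less_gap[OF \<epsilon>, of "Suc k"] gap_less_depth_Suc[OF \<epsilon>, of "Suc k"]
    unfolding m_def m'_def n'_def by linarith+
  have "0 < (1::real) / 2 ^ (depth \<epsilon> (Suc (Suc k)) + 2)" by simp
  then have \<delta>0: "0 < \<delta>" using \<delta>(1) by linarith
  have \<beta>: "4 * \<delta> < real \<beta> / 2 ^ m'" "real \<beta> / 2 ^ m' \<le> 20 * \<delta>"
  proof -
    have nn: "0 \<le> 4 * \<delta> * 2 ^ m'" using \<delta>0 by simp
    have "4 * \<delta> * 2 ^ m' < real \<beta>" unfolding \<beta>_def using nn by simp linarith
    then show "4 * \<delta> < real \<beta> / 2 ^ m'" by (simp add: pos_less_divide_eq)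
    have "1 \<le> 16 * \<delta> * 2 ^ m'" using \<delta>(1) unfolding m'_def[symmetric] by (simp add: power_add field_simps)
    moreover have "real \<beta> \<le> 4 * \<delta> * 2 ^ m' + 1" unfolding \<beta>_def using nn by simp
    ultimately have "real \<beta> \<le> 20 * \<delta> * 2 ^ m'" by linarith
    then show "real \<beta> / 2 ^ m' \<le> 20 * \<delta>" by (simp add: pos_divide_le_eq)
  qed
  define pt where "pt = (\<lambda>(a, b). real a / 2 ^ m + real (b * \<beta>) / 2 ^ m')"
  let ?I = "{..<l} \<times> {..b'}"
  have bb: "b * \<beta> \<le> 2 ^ (m' - n')" if "b \<le> b'" for b
    using mult_right_mono[OF that, of \<beta>] unfolding b'_def by (metis div_times_less_eq_dividend le_trans zero_le)
  have pt: "pt ab \<in> slopes \<epsilon>" if "ab \<in> ?I" for ab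
  proof -
    obtain a b where ab: "ab = (a, b)" by force
    show ?thesis unfolding ab pt_def prod.case m_def m'_def
      by (rule two_level_sum_in_slopes[OF \<epsilon>]) (use that bb ab in \<open>auto simp: l_def m_def m'_def n'_def\<close>)
  qed
  have small: "0 \<le> real (b * \<beta>) / 2 ^ m' \<and> real (b * \<beta>) / 2 ^ m' \<le> 1 / 2 ^ n'" if "b \<le> b'" for b
  proof -
    have "real (b * \<beta>) \<le> real (2 ^ (m' - n'))" using bb[OF that] by (simp only: of_nat_le_iff)
    then have "real (b * \<beta>) / 2 ^ m' \<le> real (2 ^ (m' - n')) / 2 ^ m'" by (intro divide_right_mono) auto
    also have "\<dots> = 1 / 2 ^ n'" by (rule real_two_power_diff_divide[OF le(2)])
    finally show ?thesis by simp
  qed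
  have n'm: "(1::real) / 2 ^ n' \<le> 1 / 2 ^ m / 4"
  proof -
    have "(2::real) ^ (m + 2) \<le> 2 ^ n'" using le by (intro power_increasing) auto
    then have "(1::real) / 2 ^ n' \<le> 1 / 2 ^ (m + 2)" by (intro divide_left_mono) auto
    then show ?thesis by (simp add: power_add)
  qed
  have \<delta>m: "4 * \<delta> < 1 / 2 ^ m / 4" using \<delta>(2) unfolding m_def[symmetric] by (simp add: power_add)
  have sep: "4 * \<delta> < \<bar>pt (a, b) - pt (c, d)\<bar>" if "b \<le> b'" "d \<le> b'" "(a, b) \<noteq> (c, d)" for a b c d
  proof (cases "a = c")
    case True
    then have "b \<noteq> d" using that by simp
    then have "1 \<le> \<bar>real b - real d\<bar>" by linarith
    then have "1 * (real \<beta> / 2 ^ m') \<le> \<bar>real b - real d\<bar> * (real \<beta> / 2 ^ m')" by (intro mult_right_mono) auto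
    also have "\<dots> = \<bar>(real b - real d) * (real \<beta> / 2 ^ m')\<bar>" by (simp add: abs_mult)
    also have "(real b - real d) * (real \<beta> / 2 ^ m') = pt (a, b) - pt (c, d)"
      using True by (simp add: pt_def left_diff_distrib diff_divide_distrib)
    finally show ?thesis using \<beta> by linarith
  next
    case False
    then have "1 \<le> \<bar>real a - real c\<bar>" by linarith
    then have "1 / 2 ^ m \<le> \<bar>real a - real c\<bar> / 2 ^ m" by (intro divide_right_mono) auto
    also have "\<dots> = \<bar>real a / 2 ^ m - real c / 2 ^ m\<bar>" by (simp flip: diff_divide_distrib)
    finally have "1 / 2 ^ m \<le> \<bar>real a / 2 ^ m - real c / 2 ^ m\<bar>" .
    moreover have "0 < (1::real) / 2 ^ m" by simp
    moreover have "w < \<bar>(x + y) - (x' + y')\<bar>"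
      if "r \<le> \<bar>x - x'\<bar>" "0 < r" "0 \<le> y \<and> y \<le> f" "0 \<le> y' \<and> y' \<le> f" "f \<le> r / 4" "w < r / 4"
      for x x' y y' r f w :: real
      using that by linarith
    ultimately show ?thesis
      unfolding pt_def prod.case using small[OF that(1)] small[OF that(2)] n'm \<delta>m by blast
  qed
  define W where "W = (slope_dir \<circ> pt) ` ?I"
  have sepW: "\<delta> < dist (slope_dir (pt i)) (slope_dir (pt j))" if "i \<in> ?I" "j \<in> ?I" "i \<noteq> j" for i j
  proof -
    have "4 * \<delta> < \<bar>pt i - pt j\<bar>" using sep[of "snd i" "snd j" "fst i" "fst j"] that by auto
    also have "\<dots> \<le> 4 * dist (slope_dir (pt i)) (slope_dir (pt j))"
      using pt[OF that(1)] pt[OF that(2)] by (intro slope_diff_le_dist_slope_dir) (auto simp: slopes_def)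
    finally show ?thesis by simp
  qed
  have inj: "inj_on (slope_dir \<circ> pt) ?I"
  proof (rule inj_onI, rule ccontr)
    fix i j assume ij: "i \<in> ?I" "j \<in> ?I" "(slope_dir \<circ> pt) i = (slope_dir \<circ> pt) j" "i \<noteq> j"
    then show False using sepW[OF ij(1,2,4)] \<delta>0 by simp
  qed
  have "card W \<le> covering_number \<delta> (slope_dir ` slopes \<epsilon>)"
  proof (rule card_separated_le_covering_number[OF bounded_slope_directions \<delta>0])
    show "finite W" by (simp add: W_def)
    show "W \<subseteq> slope_dir ` slopes \<epsilon>" using pt unfolding W_def by auto
    fix x y assume "x \<in> W" "y \<in> W" "x \<noteq> y"
    then show "\<delta> < dist x y" using sepW unfolding W_def by auto
  qed
  moreover have "card W = l * (b' + 1)" unfolding W_def card_image[OF inj] by simp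
  ultimately have "real (l * (b' + 1)) \<le> real (covering_number \<delta> (slope_dir ` slopes \<epsilon>))"
    by (simp only: of_nat_le_iff)
  moreover have "real l = L" by (simp add: l_def L_def m_def)
  ultimately have N: "L * (real b' + 1) \<le> real (covering_number \<delta> (slope_dir ` slopes \<epsilon>))" by (simp add: algebra_simps)
  have L0: "0 < L" by (simp add: L_def)
  have "L * 1 \<le> L * (real b' + 1)" using L0 by (intro mult_left_mono) auto
  then show "L \<le> real (covering_number \<delta> (slope_dir ` slopes \<epsilon>))" using N by linarith
  have "1 / (32 * 2 ^ n' * \<delta>) \<le> real b' + 1"
  proof -
    have "\<beta> > 0" by (simp add: \<beta>_def)
    then have "2 ^ (m' - n') < \<beta> * (b' + 1)"
      unfolding b'_def using dividend_less_times_div[of \<beta> "2 ^ (m' - n')"] by simp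
    then have "real (2 ^ (m' - n')) < real (\<beta> * (b' + 1))" by (simp only: of_nat_less_iff)
    then have "real (2 ^ (m' - n')) / 2 ^ m' \<le> real \<beta> * (real b' + 1) / 2 ^ m'"
      by (intro divide_right_mono) (auto simp: algebra_simps)
    also have "\<dots> = (real \<beta> / 2 ^ m') * (real b' + 1)" by simp
    also have "\<dots> \<le> (32 * \<delta>) * (real b' + 1)" using \<beta>(2) \<delta>0 by (intro mult_right_mono) auto
    also have "real (2 ^ (m' - n')) / 2 ^ m' = 1 / 2 ^ n'" by (rule real_two_power_diff_divide[OF le(2)])
    finally show ?thesis using \<delta>0 by (simp add: field_simps)
  qed
  then have "L * (1 / (32 * 2 ^ n' * \<delta>)) \<le> L * (real b' + 1)" using L0 by (intro mult_left_mono) auto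
  then show "L * (1 / (32 * 2 ^ gap \<epsilon> (Suc k) * \<delta>)) \<le> real (covering_number \<delta> (slope_dir ` slopes \<epsilon>))"
    using N unfolding n'_def by linarith
qed

text \<open>For G = gap k and X = - log 2 \<delta>, the two counts give at least G^2 - G and G^2 - G
  + X - n' - 5 bits, with n' at most G^2 / \<epsilon> + 3. Weighting them by 1 - \<epsilon> and
  \<epsilon> leaves \<epsilon> X up to a multiple of G. The error is relatively small since (k + 1)
  G <= G^2 < X.\<close>

lemma log_covering_number_slope_directions_ge:
  assumes \<epsilon>: "0 < \<epsilon>" "\<epsilon> < 1"
    and \<delta>: "1 / 2 ^ (depth \<epsilon> (Suc (Suc k)) + 2) \<le> 4 * \<delta>" "4 * \<delta> < 1 / 2 ^ (depth \<epsilon> (Suc k) + 2)"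
  shows "0 < - ln \<delta>"
    "\<epsilon> - 9 / (real k + 1) \<le> ln (real (covering_number \<delta> (slope_dir ` slopes \<epsilon>))) / (- ln \<delta>)"
proof -
  let ?N = "real (covering_number \<delta> (slope_dir ` slopes \<epsilon>))"
  define G where "G = real (gap \<epsilon> k)"
  define n' where "n' = gap \<epsilon> (Suc k)"
  define X where "X = - log 2 \<delta>"
  have m: "real (depth \<epsilon> (Suc k)) = G\<^sup>2" by (simp only: depth_Suc_eq_gap_sq G_def of_nat_power)
  have G1: "real k + 1 \<le> G" using less_gap[OF \<epsilon>, of k] by (simp add: G_def)
  have gm: "gap \<epsilon> k \<le> depth \<epsilon> (Suc k)" using gap_less_depth_Suc[OF \<epsilon>, of k] by linarith
  have "0 < (1::real) / 2 ^ (depth \<epsilon> (Suc (Suc k)) + 2)" by simp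
  then have \<delta>0: "0 < \<delta>" using \<delta>(1) by linarith
  have \<delta>X: "\<delta> = 2 powr (- X)" using \<delta>0 by (simp add: X_def)
  have lnX: "- ln \<delta> = X * ln 2" by (simp add: X_def log_def)
  have "2 powr (- X) < 2 powr (- (G\<^sup>2))"
  proof -
    have "2 powr (- X) < 1 / 2 ^ (depth \<epsilon> (Suc k) + 2)" using \<delta>(2) \<delta>0 unfolding \<delta>X[symmetric] by linarith
    also have "\<dots> \<le> 1 / 2 ^ depth \<epsilon> (Suc k)" by (intro divide_left_mono power_increasing) auto
    also have "\<dots> = 2 powr (- (G\<^sup>2))" unfolding m[symmetric] by (simp only: powr_minus_divide powr_realpow zero_less_numeral)
    finally show ?thesis .
  qed
  then have XG: "G\<^sup>2 < X" by simp
  have G0: "1 \<le> G" using G1 by linarith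
  have "1 \<le> G\<^sup>2" using power_mono[OF G0, of 2] by simp
  then have X0: "0 < X" using XG by linarith
  then show "0 < - ln \<delta>" unfolding lnX by simp
  have L: "2 ^ (depth \<epsilon> (Suc k) - gap \<epsilon> k) = 2 powr (G\<^sup>2 - G)"
  proof -
    have "G\<^sup>2 - G = real (depth \<epsilon> (Suc k) - gap \<epsilon> k)" by (simp only: of_nat_diff[OF gm] m G_def)
    then show ?thesis by (simp only: powr_realpow zero_less_numeral)
  qed
  have c1: "2 powr (G\<^sup>2 - G) \<le> ?N"
    using covering_number_slope_directions_ge(1)[OF \<epsilon> \<delta>] unfolding L .
  have c2: "2 powr (G\<^sup>2 - G + (X - real n' - 5)) \<le> ?N"
  proof -
    have e: "1 / (32 * 2 ^ n' * \<delta>) = 2 powr (X - real n' - 5)"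
      unfolding \<delta>X by (simp add: powr_diff powr_minus powr_realpow divide_simps)
    show ?thesis
      using covering_number_slope_directions_ge(2)[OF \<epsilon> \<delta>] unfolding L n'_def[symmetric] e powr_add .
  qed
  have Npos: "0 < ?N" using c1 by (rule less_le_trans[rotated]) simp
  have l1: "G\<^sup>2 - G \<le> log 2 ?N" using c1 Npos by (simp add: le_log_iff)
  have l2: "G\<^sup>2 - G + (X - real n' - 5) \<le> log 2 ?N" using c2 Npos by (simp add: le_log_iff)
  \<comment> \<open>The weighted mean of \<open>l1\<close> and \<open>l2\<close>, so the positions
    of \<delta> in the vanishing and in the free block need no separate treatment
    afterwards.\<close>
  have l3: "G\<^sup>2 - G + \<epsilon> * (X - real n' - 5) \<le> log 2 ?N"
  proof (cases "0 \<le> X - real n' - 5")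
    case True
    then have "\<epsilon> * (X - real n' - 5) \<le> 1 * (X - real n' - 5)" using \<epsilon> by (intro mult_right_mono) auto
    then show ?thesis by (intro order.trans[OF add_left_mono l2]) simp
  next
    case False
    then have "\<epsilon> * (X - real n' - 5) \<le> 0" using \<epsilon> by (intro mult_nonneg_nonpos) auto
    then show ?thesis by (intro order.trans[OF _ l1]) simp
  qed
  have "\<epsilon> * real n' \<le> \<epsilon> * (G\<^sup>2 / \<epsilon> + 3)"
    using gap_le[OF \<epsilon>(1), of "Suc k"] \<epsilon> unfolding n'_def m by (intro mult_left_mono) auto
  also have "\<dots> = G\<^sup>2 + 3 * \<epsilon>" using \<epsilon> by (simp add: distrib_left)
  finally have "\<epsilon> * X - G - 8 * \<epsilon> \<le> log 2 ?N" using l3 by (simp add: right_diff_distrib)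
  \<comment> \<open>The constant 8 is 5 from the factor 32 and 3 from \<open>gap_le\<close>; it is
    absorbed by \<epsilon> < 1 <= G.\<close>
  then have l4: "\<epsilon> * X - 9 * G \<le> log 2 ?N" using \<epsilon> G0 by linarith
  have "9 * G \<le> 9 / (real k + 1) * X"
  proof -
    have "G * (real k + 1) \<le> G * G" using G1 G0 by (intro mult_left_mono) auto
    also have "\<dots> \<le> X" using XG by (simp add: power2_eq_square)
    finally show ?thesis by (simp add: field_simps)
  qed
  then have "(\<epsilon> - 9 / (real k + 1)) * X \<le> log 2 ?N" using l4 by (simp add: left_diff_distrib)
  then have "\<epsilon> - 9 / (real k + 1) \<le> log 2 ?N / X" using X0 by (simp add: pos_le_divide_eq)
  also have "log 2 ?N / X = ln ?N / (- ln \<delta>)" unfolding lnX by (simp add: log_def)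
  finally show "\<epsilon> - 9 / (real k + 1) \<le> ln ?N / (- ln \<delta>)" .
qed

text \<open>For the upper bound on a lower limit the scales at the ends of the vanishing blocks
  suffice. The lower bound needs every small \<delta>, which is placed between two consecutive
  depths.\<close>

lemma lower_box_dim_slope_directions:
  assumes \<epsilon>: "0 < \<epsilon>" "\<epsilon> < 1"
  shows "lower_box_dim (slope_dir ` slopes \<epsilon>) = ereal \<epsilon>"
proof (rule antisym)
  let ?r = "\<lambda>\<delta>. ln (real (covering_number \<delta> (slope_dir ` slopes \<epsilon>))) / (- ln \<delta>)"
  show "lower_box_dim (slope_dir ` slopes \<epsilon>) \<le> ereal \<epsilon>"
  proof (rule ccontr)
    assume "\<not> ?thesis"
    then have "ereal \<epsilon> < lower_box_dim (slope_dir ` slopes \<epsilon>)" by simp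
    then obtain b where b: "ereal \<epsilon> < ereal b" "ereal b < lower_box_dim (slope_dir ` slopes \<epsilon>)"
      using ereal_dense2 by blast
    have "eventually (\<lambda>\<delta>. ereal b < ereal (?r \<delta>)) (at_right 0)"
      using b(2) unfolding lower_box_dim_def by (rule less_LiminfD)
    then obtain d where d: "0 < d" "\<And>\<delta>. 0 < \<delta> \<Longrightarrow> \<delta> < d \<Longrightarrow> b < ?r \<delta>"
      unfolding eventually_at_right_field by auto
    obtain k1 where k1: "(1/2) ^ k1 < d / 2" using real_arch_pow_inv[of "d / 2" "1/2"] d by auto
    obtain k2 :: nat where k2: "\<epsilon> / (b - \<epsilon>) < real k2" using reals_Archimedean2 by blast
    define k where "k = max k1 k2"
    define n where "n = gap \<epsilon> k"
    define m where "m = real (depth \<epsilon> k)"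
    define \<delta> where "\<delta> = 2 / (2::real) ^ n"
    have kn: "k < n" unfolding n_def by (rule less_gap[OF \<epsilon>])
    have nm: "m / \<epsilon> + 2 \<le> real n" unfolding m_def n_def by (rule gap_ge[OF \<epsilon>(1)])
    have km: "real k + 1 \<le> m" using less_depth[OF \<epsilon>, of k] by (simp add: m_def)
    have m0: "0 < m" "0 < m / \<epsilon>" using km \<epsilon> by auto
    have "(1/2::real) ^ n \<le> (1/2) ^ k1" using kn by (intro power_decreasing) (auto simp: k_def)
    then have "2 * (1/2::real) ^ n < d" using k1 by linarith
    then have \<delta>: "0 < \<delta>" "\<delta> < d" by (simp_all add: \<delta>_def power_one_over)
    have ln\<delta>: "- ln \<delta> = (real n - 1) * ln 2"
      by (simp add: \<delta>_def ln_div ln_realpow algebra_simps)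
    have cov: "covering_number \<delta> (slope_dir ` slopes \<epsilon>) \<le> 2 ^ Suc (depth \<epsilon> k)"
      unfolding \<delta>_def n_def by (rule covering_number_slope_directions_le[OF \<epsilon>])
    have num: "ln (real (covering_number \<delta> (slope_dir ` slopes \<epsilon>))) \<le> (m + 1) * ln 2"
    \<comment> \<open>Covering number 0 is harmless because \<open>ln 0 = 0\<close>.\<close>
    proof (cases "covering_number \<delta> (slope_dir ` slopes \<epsilon>) = 0")
      case False
      have "real (covering_number \<delta> (slope_dir ` slopes \<epsilon>)) \<le> real (2 ^ Suc (depth \<epsilon> k))"
        using cov by (simp only: of_nat_le_iff)
      then have "ln (real (covering_number \<delta> (slope_dir ` slopes \<epsilon>))) \<le> ln (real (2 ^ Suc (depth \<epsilon> k)))"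
        using False by (subst ln_le_cancel_iff) auto
      also have "\<dots> = (m + 1) * ln 2" by (simp add: ln_mult ln_realpow m_def algebra_simps)
      finally show ?thesis .
    qed (use m0 in simp)
    have n1: "m / \<epsilon> + 1 \<le> real n - 1" using nm by linarith
    then have "0 < real n - 1" using m0 by linarith
    then have "?r \<delta> \<le> ((m + 1) * ln 2) / ((real n - 1) * ln 2)"
      unfolding ln\<delta> using num by (intro divide_right_mono) auto
    also have "\<dots> = (m + 1) / (real n - 1)" by simp
    also have "\<dots> \<le> (m + 1) / (m / \<epsilon>)" using n1 m0 by (intro frac_le; linarith)
    also have "\<dots> = \<epsilon> + \<epsilon> / m" using m0 \<epsilon> by (simp add: field_simps)
    also have "\<dots> < b"
    proof -
      have "\<epsilon> / (b - \<epsilon>) < m" using k2 km by (simp add: k_def)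
      then have "\<epsilon> / m < b - \<epsilon>" using b(1) m0 by (simp add: pos_divide_less_eq mult.commute)
      then show ?thesis by simp
    qed
    finally show False using d(2)[OF \<delta>] by simp
  qed
  show "ereal \<epsilon> \<le> lower_box_dim (slope_dir ` slopes \<epsilon>)"
    unfolding lower_box_dim_def le_Liminf_iff
  proof (intro allI impI)
    fix y assume y: "y < ereal \<epsilon>"
    obtain b where b: "y < ereal b" "ereal b < ereal \<epsilon>" using ereal_dense2[OF y] by blast
    obtain k0 :: nat where k0: "9 / (\<epsilon> - b) < real k0" using reals_Archimedean2 by blast
    define D where "D k = (1::real) / 2 ^ (depth \<epsilon> (Suc k) + 2)" for k
    have "b < ?r \<delta>" if \<delta>: "0 < \<delta>" "4 * \<delta> < D k0" for \<delta>
    proof -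
      obtain k1 where k1: "(1/2) ^ k1 < 4 * \<delta>" using real_arch_pow_inv[of "4 * \<delta>" "1/2"] \<delta> by auto
      have ex: "\<exists>k. D (k0 + k) \<le> 4 * \<delta>"
      proof -
        have "depth \<epsilon> (Suc (k0 + k1)) > k1" using less_depth[OF \<epsilon>, of "Suc (k0 + k1)"] by linarith
        then have "D (k0 + k1) \<le> (1/2) ^ k1"
          unfolding D_def power_one_over by (intro divide_left_mono power_increasing) auto
        then show ?thesis using k1 by (intro exI[of _ k1]) linarith
      qed
      \<comment> \<open>The first depth from \<open>k0\<close> on whose scale is reached; it is not
        the one at \<open>k0\<close>, since 4 \<delta> < D k0, so it has a predecessor that brackets
        \<delta>.\<close>
      define i where "i = (LEAST k. D (k0 + k) \<le> 4 * \<delta>)"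
      have i: "D (k0 + i) \<le> 4 * \<delta>" unfolding i_def by (rule LeastI_ex[OF ex])
      then obtain i' where i': "i = Suc i'" using \<delta>(2) by (cases i) auto
      then have "\<not> D (k0 + i') \<le> 4 * \<delta>" using not_less_Least[of i' "\<lambda>k. D (k0 + k) \<le> 4 * \<delta>"] by (simp add: i_def)
      then have k: "D (Suc (k0 + i')) \<le> 4 * \<delta>" "4 * \<delta> < D (k0 + i')" using i i' by auto
      have "\<epsilon> - 9 / (real (k0 + i') + 1) \<le> ?r \<delta>"
        by (rule log_covering_number_slope_directions_ge(2)[OF \<epsilon>]) (use k in \<open>simp_all only: D_def\<close>)
      moreover have "9 / (real (k0 + i') + 1) < \<epsilon> - b"
      proof -
        have "9 / (\<epsilon> - b) < real (k0 + i') + 1" using k0 by simp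
        then show ?thesis using b(2) by (simp add: pos_divide_less_eq mult.commute)
      qed
      ultimately show ?thesis by linarith
    qed
    moreover have "0 < D k0 / 4" by (simp add: D_def)
    ultimately have "eventually (\<lambda>\<delta>. b < ?r \<delta>) (at_right 0)"
      unfolding eventually_at_right_field by (intro exI[of _ "D k0 / 4"]) auto
    then show "eventually (\<lambda>\<delta>. y < ereal (?r \<delta>)) (at_right 0)"
      by (rule eventually_mono) (use b(1) in \<open>auto elim: order.strict_trans\<close>)
  qed
qed

theorem theorem3:
  fixes \<epsilon> :: real
  assumes "0 < \<epsilon>" and "\<epsilon> < 1"
  shows "\<exists>D \<subseteq> sphere (0 :: real^2) 1.
           lower_box_dim D = ereal \<epsilon> \<and> universal_for D {E. weakly_regular E}"
proof (intro exI conjI)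
  show "slope_dir ` slopes \<epsilon> \<subseteq> sphere 0 1" by auto
qed (use assms in \<open>simp_all add: lower_box_dim_slope_directions universal_slope_directions\<close>)

end
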